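(* Let $\mathcal A$ be a $B$-commutative $B$-graded algebra over $\mathbb F$ and assume that $(\mathcal A,\mathcal H)$ is a $B$-quadratic toral pair with root system $R$ and bilinear form $(\cdot,\cdot)$. Let $G$ be a non-trivial torsion free abelian group and let $\lambda:G\times G\to\mathbb F^\times$ be a symmetric $2$-cocycle with $\lambda(0,0)=1$. Let $\mathcal L(\mathcal A)$, $\tilde{\mathcal L}(\mathcal A)$, $\hat{\mathcal L}(\mathcal A)$, $\tilde{\mathcal H}$, $\hat{\mathcal H}$ be constructed from these data as described in the context. (i) The pairs $(\tilde{\mathcal L}(\mathcal A),\tilde{\mathcal H})$ and $(\hat{\mathcal L}(\mathcal A),\hat{\mathcal H})$ are $B$-quadratic toral pairs with root systems $R$ and $\hat R=R+G$, respectively. Moreover, if the form on $\mathcal A$ (respectively, on $\mathcal H$) is non-degenerate, then so is the extended form on $\hat{\mathcal L}(\mathcal A)$ (respectively, on $\hat{\mathcal H}$). (ii) Suppose $(\mathcal A,\mathcal H)$ is a $B$-extended algebra. Then: (a) $(\tilde{\mathcal L}(\mathcal A),\tilde{\mathcal H})$ is a $B$-extended algebra; in particular, if $(\mathcal A,\mathcal H)$ is a $B$-extended affine algebra, then so is $(\mathcal L(\mathcal A),\mathcal H)$ (with $\mathcal H$ identified with $\mathcal H\otimes 1$). (b) If $\mathcal A^0_0=\mathcal H$ and the form is non-degenerate on $\mathcal A^0$, then $(\hat{\mathcal L}(\mathcal A),\hat{\mathcal H})$ is a $B$-extended algebra. In this case, if $(\mathcal A,\mathcal H)$ is a $B$-extended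 affine algebra, then so is $(\hat{\mathcal L}(\mathcal A),\hat{\mathcal H})$.
   Context: $\mathbb F$ is a field of characteristic zero; algebras are over $\mathbb F$ and not necessarily associative. $B$ is a finite integral domain; for $b\in B$, $\circ(b)$ is the order of $b$ in the group $(B,+)$. In a $B$-graded algebra $\mathcal A=\bigoplus_{b\in B}\mathcal A_b$ (grading with respect to $(B,+)$), $|x|$ denotes the degree of a homogeneous element $x$. Convention: elements of $B$-graded spaces occurring in the definitions below are taken to be homogeneous. $\mathcal A$ is $B$-commutative if $xy=(-1)^{\circ(|x||y|)}yx$ for all $x,y$. A bilinear form $(\cdot,\cdot):\mathcal A\times\mathcal A\to\mathbb F$ is invariant if $(xy,z)=(x,yz)$; $B$-symmetric if $(x,y)=-(-1)^{\circ(|x||y|)}(y,x)$; $B$-graded if $(\mathcal A_b,\mathcal A_{b'})=\{0\}$ unless $b+b'=0$. $\mathcal V^*$ denotes the dual space of a vector space $\mathcal V$. Toral pairs. Let $\mathcal A$ be a $B$-commutative graded algebra and $\mathcal H$ a nonzero subalgebra of $\mathcal A_0$. For $\alpha\in\mathcal H^*$ let $\mathcal A^\alpha:=\{x\in\mathcal A\mid hx=\alpha(h)x\ \forall h\in\mathcal H\}$. $(\mathcal A,\mathcal H)$ is a toral pair if $\mathcal A=\bigoplus_{\alpha\in\mathcal H^*}\mathcal A^\alpha$ and $\mathcal A^0\mathcal A^0\subseteq\mathcal A^0$. Its root system is $R:=\{\alpha\in\mathcal H^*\mid\mathcal A^\alpha\ne0\}$. Put $\mathcal A^\alpha_b:=\mathcal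 A^\alpha\cap\mathcal A_b$ and $R_b:=\{\alpha\in R\mid\mathcal A^\alpha_b\neq\{0\}\}$. A toral pair is $B$-quadratic if it is equipped with a $B$-symmetric, $B$-graded invariant bilinear form. A $B$-quadratic toral pair $(\mathcal A,\mathcal H)$ is a $B$-extended algebra if: (E1) for every $b\in B$ and $\alpha\in R_b\setminus\{0\}$ there exist $x_{\pm\alpha}\in\mathcal A^{\pm\alpha}_{\pm b}$ with $0\ne x_\alpha x_{-\alpha}\in\mathcal H$; (E2) the set of all scalars $\beta(x_\alpha x_{-\alpha})$, where $\alpha,\beta\in R$ and $x_{\pm\alpha}\in\mathcal A^{\pm\alpha}$ are homogeneous with $x_\alpha x_{-\alpha}\in\mathcal H$ and $(x_\alpha,x_{-\alpha})=1$, is finite. It is a $B$-extended affine algebra if moreover (E3) the form is non-degenerate on $\mathcal A$ and on $\mathcal H$. Construction. A symmetric $2$-cocycle is a map $\lambda$ with $\lambda(\sigma,\tau)\lambda(\sigma+\tau,\rho)=\lambda(\tau,\rho)\lambda(\sigma,\tau+\rho)$ and $\lambda(\sigma,\tau)=\lambda(\tau,\sigma)$. $\mathbb F^t[G]$ is the commutative associative algebra with basis $\{t^\sigma\mid\sigma\in G\}$ and product $t^\sigma t^\tau=\lambda(\sigma,\tau)t^{\sigma+\tau}$; $1=t^0$. Let $\mathcal L(\mathcal A):=\mathcal A\otimes\mathbb F^t[G]$ (tensor product algebra), $B$-graded by $\mathcal L(\mathcal A)_b=\mathcal A_b\otimes\mathbb F^t[G]$, with form $(x\otimes t^\sigma,y\otimes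 t^\tau):=(x,y)\lambda(\sigma,\tau)\delta_{\sigma,-\tau}$. Let $\mathcal V:=G\otimes_{\mathbb Z}\mathbb F$, with $G$ identified with $G\otimes1\subseteq\mathcal V$. Set $\tilde{\mathcal L}(\mathcal A):=\mathcal L(\mathcal A)\oplus\mathcal V$ and $\hat{\mathcal L}(\mathcal A):=\mathcal L(\mathcal A)\oplus\mathcal V\oplus\mathcal V^*$, $B$-graded with $\mathcal V$ and $\mathcal V^*$ in degree $0$ and $\mathcal A_b\otimes\mathbb F^t[G]$ in degree $b$. The products are defined by: $\mathcal V$ is central (all products with $\mathcal V$ are zero), $\mathcal V^*\mathcal V^*=\{0\}$, and for $x,y\in\mathcal A$, $\sigma,\tau\in G$, $d\in\mathcal V^*$, $$(x\otimes t^\sigma)(y\otimes t^\tau):=\lambda(\sigma,\tau)\big(xy\otimes t^{\sigma+\tau}+\delta_{\sigma,-\tau}(x,y)\sigma\big),\qquad d\cdot(x\otimes t^\sigma)=-(x\otimes t^\sigma)\cdot d:=d(\sigma)\,x\otimes t^\sigma .$$ The form on $\mathcal L(\mathcal A)$ is extended to $\tilde{\mathcal L}(\mathcal A)$ and $\hat{\mathcal L}(\mathcal A)$ by $(\mathcal V,\mathcal L(\mathcal A)\oplus\mathcal V)=(\mathcal V^*,\mathcal L(\mathcal A)\oplus\mathcal V^* )=\{0\}$ and $(d,v)=(v,d)=d(v)$ for $d\in\mathcal V^*$, $v\in\mathcal V$ (with $(\mathcal L(\mathcal A),\mathcal V)=(\mathcal L(\mathcal A),\mathcal V^* )=\{0\}$).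 Set $\tilde{\mathcal H}:=(\mathcal H\otimes1)\oplus\mathcal V$ and $\hat{\mathcal H}:=(\mathcal H\otimes1)\oplus\mathcal V\oplus\mathcal V^*$. Identify $\tilde{\mathcal H}^*$ with $\mathcal H^*\oplus\mathcal V^*$ and $\hat{\mathcal H}^*$ with $\mathcal H^*\oplus\mathcal V^*\oplus(\mathcal V^* )^*$; thus $\alpha\in\mathcal H^*$ is extended by zero on $\mathcal V$ and $\mathcal V^*$. $\mathcal V$ (hence $G$) is regarded as a subspace of $(\mathcal V^* )^*$ by evaluation, so $\sigma\in G$ acts as $d\mapsto d(\sigma)$ on $\mathcal V^*$ and as zero on $\mathcal H\otimes1$ and $\mathcal V$. $R+G=\{\alpha+\sigma\mid\alpha\in R,\sigma\in G\}\subseteq\hat{\mathcal H}^*$. *)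

theory Defs
  imports Complex_Main "HOL-Library.Poly_Mapping" "HOL-Library.Product_Plus"
begin

definition nmult :: "nat \<Rightarrow> 'a::comm_monoid_add \<Rightarrow> 'a" where
  "nmult n x = (\<Sum>i<n. x)"

text \<open>Order of an element of an additive group (only used for elements of finite order).\<close>

definition add_order :: "'a::comm_monoid_add \<Rightarrow> nat" where
  "add_order x = (LEAST n. 0 < n \<and> nmult n x = 0)"

definition bsign :: "'b::idom \<Rightarrow> 'b \<Rightarrow> 'f::field" where
  "bsign b c = (- 1) ^ add_order (b * c)"

definition bilinear_map ::
  "('f::field \<Rightarrow> 'a::ab_group_add \<Rightarrow> 'a) \<Rightarrow> ('f \<Rightarrow> 'c::ab_group_add \<Rightarrow> 'c)
    \<Rightarrow> ('f \<Rightarrow> 'd::ab_group_add \<Rightarrow> 'd) \<Rightarrow> ('a \<Rightarrow> 'c \<Rightarrow> 'd) \<Rightarrow> bool" where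
  "bilinear_map s1 s2 s3 f \<longleftrightarrow>
     (\<forall>x. Vector_Spaces.linear s2 s3 (\<lambda>y. f x y)) \<and>
     (\<forall>y. Vector_Spaces.linear s1 s3 (\<lambda>x. f x y))"

definition internal_direct_sum :: "'i set \<Rightarrow> ('i \<Rightarrow> 'a::comm_monoid_add set) \<Rightarrow> bool" where
  "internal_direct_sum I W \<longleftrightarrow>
     (\<forall>x. \<exists>!c. finite {i. c i \<noteq> 0} \<and> (\<forall>i. i \<notin> I \<longrightarrow> c i = 0) \<and> (\<forall>i\<in>I. c i \<in> W i) \<and>
        x = (\<Sum>i\<in>{i. c i \<noteq> 0}. c i))"

text \<open>The algebra is the whole type \<open>'a\<close>. The grading group is the additive group of the
  type \<open>'b\<close>, which ranges over the finite integral domains.\<close>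

record ('f, 'b, 'a) qalg =
  smul :: "'f \<Rightarrow> 'a \<Rightarrow> 'a"
  mul :: "'a \<Rightarrow> 'a \<Rightarrow> 'a"
  grade :: "'b \<Rightarrow> 'a set"
  form :: "'a \<Rightarrow> 'a \<Rightarrow> 'f"

definition graded_algebra ::
  "('f::field_char_0, 'b::{finite,idom}, 'a::ab_group_add) qalg \<Rightarrow> bool" where
  "graded_algebra A \<longleftrightarrow>
     vector_space (smul A) \<and>
     bilinear_map (smul A) (smul A) (smul A) (mul A) \<and>
     (\<forall>b. module.subspace (smul A) (grade A b)) \<and>
     internal_direct_sum UNIV (grade A) \<and>
     (\<forall>b c. \<forall>x\<in>grade A b. \<forall>y\<in>grade A c. mul A x y \<in> grade A (b + c))"

definition b_commutative ::
  "('f::field_char_0, 'b::{finite,idom}, 'a::ab_group_add) qalg \<Rightarrow> bool" where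
  "b_commutative A \<longleftrightarrow>
     (\<forall>b c. \<forall>x\<in>grade A b. \<forall>y\<in>grade A c. mul A x y = smul A (bsign b c) (mul A y x))"

definition invariant_form :: "('f, 'b, 'a) qalg \<Rightarrow> bool" where
  "invariant_form A \<longleftrightarrow> (\<forall>x y z. form A (mul A x y) z = form A x (mul A y z))"

definition b_symmetric_form ::
  "('f::field_char_0, 'b::{finite,idom}, 'a::ab_group_add) qalg \<Rightarrow> bool" where
  "b_symmetric_form A \<longleftrightarrow>
     (\<forall>b c. \<forall>x\<in>grade A b. \<forall>y\<in>grade A c. form A x y = - bsign b c * form A y x)"

definition b_graded_form ::
  "('f::field_char_0, 'b::{finite,idom}, 'a::ab_group_add) qalg \<Rightarrow> bool" where
  "b_graded_form A \<longleftrightarrow>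
     (\<forall>b c. b + c \<noteq> 0 \<longrightarrow> (\<forall>x\<in>grade A b. \<forall>y\<in>grade A c. form A x y = 0))"

definition nondegenerate_on ::
  "('f::zero, 'b, 'a::zero) qalg \<Rightarrow> 'a set \<Rightarrow> bool" where
  "nondegenerate_on A S \<longleftrightarrow>
     (\<forall>x\<in>S. (\<forall>y\<in>S. form A x y = 0) \<longrightarrow> x = 0) \<and>
     (\<forall>y\<in>S. (\<forall>x\<in>S. form A x y = 0) \<longrightarrow> y = 0)"

text \<open>The dual of a subspace \<open>H\<close>: linear functionals on \<open>H\<close>, represented by functions on the
  whole type that vanish outside \<open>H\<close>, so that equal functionals are equal functions.\<close>

definition dual_of ::
  "('f::field, 'b, 'a::ab_group_add) qalg \<Rightarrow> 'a set \<Rightarrow> ('a \<Rightarrow> 'f) set" where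
  "dual_of A H = {\<alpha>. (\<forall>x\<in>H. \<forall>y\<in>H. \<alpha> (x + y) = \<alpha> x + \<alpha> y) \<and>
     (\<forall>c. \<forall>x\<in>H. \<alpha> (smul A c x) = c * \<alpha> x) \<and> (\<forall>x. x \<notin> H \<longrightarrow> \<alpha> x = 0)}"

definition subalgebra :: "('f::field, 'b, 'a::ab_group_add) qalg \<Rightarrow> 'a set \<Rightarrow> bool" where
  "subalgebra A H \<longleftrightarrow>
     module.subspace (smul A) H \<and> (\<forall>x\<in>H. \<forall>y\<in>H. mul A x y \<in> H)"

definition root_space :: "('f, 'b, 'a) qalg \<Rightarrow> 'a set \<Rightarrow> ('a \<Rightarrow> 'f) \<Rightarrow> 'a set" where
  "root_space A H \<alpha> = {x. \<forall>h\<in>H. mul A h x = smul A (\<alpha> h) x}"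

definition roots ::
  "('f::field, 'b, 'a::ab_group_add) qalg \<Rightarrow> 'a set \<Rightarrow> ('a \<Rightarrow> 'f) set" where
  "roots A H = {\<alpha> \<in> dual_of A H. root_space A H \<alpha> \<noteq> {0}}"

definition roots_of_degree ::
  "('f::field, 'b, 'a::ab_group_add) qalg \<Rightarrow> 'a set \<Rightarrow> 'b \<Rightarrow> ('a \<Rightarrow> 'f) set" where
  "roots_of_degree A H b = {\<alpha> \<in> roots A H. root_space A H \<alpha> \<inter> grade A b \<noteq> {0}}"

definition toral_pair ::
  "('f::field_char_0, 'b::{finite,idom}, 'a::ab_group_add) qalg \<Rightarrow> 'a set \<Rightarrow> bool" where
  "toral_pair A H \<longleftrightarrow>
     graded_algebra A \<and> b_commutative A \<and>
     subalgebra A H \<and> H \<subseteq> grade A 0 \<and> H \<noteq> {0} \<and>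
     internal_direct_sum (dual_of A H) (root_space A H) \<and>
     (\<forall>x\<in>root_space A H (\<lambda>_. 0). \<forall>y\<in>root_space A H (\<lambda>_. 0).
        mul A x y \<in> root_space A H (\<lambda>_. 0))"

definition quadratic_toral_pair ::
  "('f::field_char_0, 'b::{finite,idom}, 'a::ab_group_add) qalg \<Rightarrow> 'a set \<Rightarrow> bool" where
  "quadratic_toral_pair A H \<longleftrightarrow>
     toral_pair A H \<and> bilinear_map (smul A) (smul A) (*) (form A) \<and>
     b_symmetric_form A \<and> b_graded_form A \<and> invariant_form A"

definition extended_algebra ::
  "('f::field_char_0, 'b::{finite,idom}, 'a::ab_group_add) qalg \<Rightarrow> 'a set \<Rightarrow> bool" where
  "extended_algebra A H \<longleftrightarrow>
     quadratic_toral_pair A H \<and>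
     (\<forall>b. \<forall>\<alpha> \<in> roots_of_degree A H b - {\<lambda>_. 0}.
        \<exists>x \<in> root_space A H \<alpha> \<inter> grade A b.
        \<exists>y \<in> root_space A H (\<lambda>h. - \<alpha> h) \<inter> grade A (- b).
          mul A x y \<noteq> 0 \<and> mul A x y \<in> H) \<and>
     finite {\<beta> (mul A x y) | \<alpha> \<beta> x y.
        \<alpha> \<in> roots A H \<and> \<beta> \<in> roots A H \<and>
        x \<in> root_space A H \<alpha> \<inter> (\<Union>b. grade A b) \<and>
        y \<in> root_space A H (\<lambda>h. - \<alpha> h) \<inter> (\<Union>b. grade A b) \<and>
        mul A x y \<in> H \<and> form A x y = 1}"

definition extended_affine_algebra ::
  "('f::field_char_0, 'b::{finite,idom}, 'a::ab_group_add) qalg \<Rightarrow> 'a set \<Rightarrow> bool" where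
  "extended_affine_algebra A H \<longleftrightarrow>
     extended_algebra A H \<and> nondegenerate_on A UNIV \<and> nondegenerate_on A H"

text \<open>\<open>G\<close> is the additive group of the type \<open>'g\<close>. The tensor product \<open>\<V> = G \<otimes> \<F>\<close> over the
  integers is presented as the free \<open>\<F>\<close>-space on \<open>G\<close> modulo additivity in \<open>G\<close>; that this
  has the universal property of the tensor product is the lemma \<open>gtensor_universal\<close> below.\<close>

definition pm_smul :: "('f \<Rightarrow> 'a \<Rightarrow> 'a) \<Rightarrow> 'f \<Rightarrow> ('g \<Rightarrow>\<^sub>0 'a::zero) \<Rightarrow> 'g \<Rightarrow>\<^sub>0 'a" where
  "pm_smul s c p = Poly_Mapping.map (s c) p"

lemma lookup_pm_smul:
  assumes "vector_space s"
  shows "Poly_Mapping.lookup (pm_smul s c p) k = s c (Poly_Mapping.lookup p k)"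
proof -
  interpret vector_space s by fact
  show ?thesis by (simp add: pm_smul_def Poly_Mapping.map.rep_eq when_def)
qed

lemma vector_space_field: "vector_space ((*) :: 'f::field \<Rightarrow> 'f \<Rightarrow> 'f)"
  by unfold_locales (simp_all add: algebra_simps)

lemma vector_space_pm_smul:
  assumes "vector_space s"
  shows "vector_space (pm_smul s)"
proof -
  interpret vector_space s by fact
  show ?thesis
    by unfold_locales
      (auto intro!: poly_mapping_eqI
        simp: lookup_pm_smul[OF assms] lookup_add scale_right_distrib scale_left_distrib)
qed

abbreviation fscale :: "'f::field \<Rightarrow> ('g \<Rightarrow>\<^sub>0 'f) \<Rightarrow> ('g \<Rightarrow>\<^sub>0 'f)" where
  "fscale \<equiv> pm_smul (*)"

lemmas lookup_fscale = lookup_pm_smul[OF vector_space_field]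

interpretation fpm: vector_space "fscale :: 'f::field \<Rightarrow> ('g \<Rightarrow>\<^sub>0 'f) \<Rightarrow> _"
  by (rule vector_space_pm_smul[OF vector_space_field])

definition additivity_relations :: "('g::ab_group_add \<Rightarrow>\<^sub>0 'f::field) set" where
  "additivity_relations = module.span fscale
     {Poly_Mapping.single (\<sigma> + \<tau>) 1 - Poly_Mapping.single \<sigma> 1 - Poly_Mapping.single \<tau> 1
        | \<sigma> \<tau>. True}"

definition tensor_rel :: "('g::ab_group_add \<Rightarrow>\<^sub>0 'f::field) \<Rightarrow> ('g \<Rightarrow>\<^sub>0 'f) \<Rightarrow> bool" where
  "tensor_rel p q \<longleftrightarrow> p - q \<in> additivity_relations"

lemma additivity_relations_closed:
  "0 \<in> additivity_relations"
  "p \<in> additivity_relations \<Longrightarrow> q \<in> additivity_relations \<Longrightarrow> p + q \<in> additivity_relations"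
  "p \<in> additivity_relations \<Longrightarrow> - p \<in> additivity_relations"
  "p \<in> additivity_relations \<Longrightarrow> fscale c p \<in> additivity_relations"
  unfolding additivity_relations_def
  by (auto intro: fpm.span_zero fpm.span_add fpm.span_neg fpm.span_scale)

lemma equivp_tensor_rel: "equivp tensor_rel"
proof (rule equivpI)
  show "reflp tensor_rel"
    by (auto simp: reflp_def tensor_rel_def additivity_relations_closed)
  show "symp tensor_rel"
    by (auto simp: symp_def tensor_rel_def dest: additivity_relations_closed(3))
  show "transp tensor_rel"
    by (auto simp: transp_def tensor_rel_def dest: additivity_relations_closed(2))
qed

quotient_type (overloaded) ('g, 'f) gtensor =
  "'g::ab_group_add \<Rightarrow>\<^sub>0 'f::field" / tensor_rel
  by (rule equivp_tensor_rel)

instantiation gtensor :: (ab_group_add, field) ab_group_add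
begin

lift_definition zero_gtensor :: "('a, 'b) gtensor" is "0" .

lift_definition plus_gtensor :: "('a, 'b) gtensor \<Rightarrow> ('a, 'b) gtensor \<Rightarrow> ('a, 'b) gtensor" is "(+)"
  unfolding tensor_rel_def by (drule (1) additivity_relations_closed(2)) (simp add: algebra_simps)

lift_definition uminus_gtensor :: "('a, 'b) gtensor \<Rightarrow> ('a, 'b) gtensor" is "uminus"
  unfolding tensor_rel_def by (drule additivity_relations_closed(3)) (simp add: algebra_simps)

definition minus_gtensor :: "('a, 'b) gtensor \<Rightarrow> ('a, 'b) gtensor \<Rightarrow> ('a, 'b) gtensor" where
  "minus_gtensor x y = x + - y"

instance
  by standard
    (unfold minus_gtensor_def,
     (transfer, simp add: tensor_rel_def additivity_relations_closed(1) algebra_simps)+)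

end

lift_definition vscale :: "'f::field \<Rightarrow> ('g::ab_group_add, 'f) gtensor \<Rightarrow> ('g, 'f) gtensor" is fscale
  unfolding tensor_rel_def
  by (drule additivity_relations_closed(4)) (simp add: fpm.scale_right_diff_distrib)

lift_definition gembed :: "'g::ab_group_add \<Rightarrow> ('g, 'f::field) gtensor" is
  "\<lambda>\<sigma>. Poly_Mapping.single \<sigma> 1" .

interpretation vscale: vector_space "vscale :: 'f::field \<Rightarrow> ('g::ab_group_add, 'f) gtensor \<Rightarrow> _"
  by unfold_locales
    (transfer, simp add: tensor_rel_def additivity_relations_closed(1)
      fpm.scale_right_distrib fpm.scale_left_distrib)+

text \<open>\<open>gembed \<sigma>\<close> is \<open>\<sigma> \<otimes> 1\<close>, and \<open>vscale c (gembed \<sigma>)\<close> is \<open>\<sigma> \<otimes> c\<close>.\<close>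

lemma gembed_add: "gembed (\<sigma> + \<tau>) = gembed \<sigma> + gembed \<tau>"
  by transfer
    (auto simp: tensor_rel_def additivity_relations_def diff_diff_eq intro!: fpm.span_base)

lemma gtensor_eq_sum:
  "abs_gtensor p = (\<Sum>\<sigma>\<in>Poly_Mapping.keys p. vscale (Poly_Mapping.lookup p \<sigma>) (gembed \<sigma>))"
  for p :: "'g::ab_group_add \<Rightarrow>\<^sub>0 'f::field"
proof -
  have *: "abs_gtensor (\<Sum>\<sigma>\<in>S. f \<sigma>) = (\<Sum>\<sigma>\<in>S. abs_gtensor (f \<sigma>))" if "finite S"
    for S :: "'g set" and f :: "'g \<Rightarrow> 'g \<Rightarrow>\<^sub>0 'f"
    using that
    by (induction S rule: finite_induct)
      (simp_all add: zero_gtensor.abs_eq[symmetric] plus_gtensor.abs_eq[symmetric])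
  have "p = (\<Sum>\<sigma>\<in>Poly_Mapping.keys p. Poly_Mapping.single \<sigma> (Poly_Mapping.lookup p \<sigma>))"
    by (rule poly_mapping_eqI)
      (simp add: lookup_sum lookup_single when_def in_keys_iff sum.delta)
  also have "abs_gtensor \<dots> =
      (\<Sum>\<sigma>\<in>Poly_Mapping.keys p. abs_gtensor (Poly_Mapping.single \<sigma> (Poly_Mapping.lookup p \<sigma>)))"
    by (rule *) simp
  also have "\<dots> = (\<Sum>\<sigma>\<in>Poly_Mapping.keys p. vscale (Poly_Mapping.lookup p \<sigma>) (gembed \<sigma>))"
  proof (rule sum.cong)
    fix \<sigma>
    have "Poly_Mapping.single \<sigma> (Poly_Mapping.lookup p \<sigma>) =
        fscale (Poly_Mapping.lookup p \<sigma>) (Poly_Mapping.single \<sigma> 1)"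
      by (rule poly_mapping_eqI) (simp add: lookup_fscale lookup_single when_def)
    then show "abs_gtensor (Poly_Mapping.single \<sigma> (Poly_Mapping.lookup p \<sigma>)) =
        vscale (Poly_Mapping.lookup p \<sigma>) (gembed \<sigma>)"
      by (simp add: vscale.abs_eq gembed.abs_eq)
  qed simp
  finally show ?thesis .
qed

lemma gtensor_universal:
  fixes \<phi> :: "'g::ab_group_add \<Rightarrow> 'f::field \<Rightarrow> 'm::ab_group_add"
  assumes left: "\<And>\<sigma> \<tau> c. \<phi> (\<sigma> + \<tau>) c = \<phi> \<sigma> c + \<phi> \<tau> c"
    and right: "\<And>\<sigma> c d. \<phi> \<sigma> (c + d) = \<phi> \<sigma> c + \<phi> \<sigma> d"
  shows "\<exists>!\<Phi>. (\<forall>x y. \<Phi> (x + y) = \<Phi> x + \<Phi> y) \<and> (\<forall>\<sigma> c. \<Phi> (vscale c (gembed \<sigma>)) = \<phi> \<sigma> c)"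
proof -
  have right0: "\<phi> \<sigma> 0 = 0" for \<sigma>
    using right[of \<sigma> 0 0] by simp
  define P where "P p = (\<Sum>\<sigma>\<in>Poly_Mapping.keys p. \<phi> \<sigma> (Poly_Mapping.lookup p \<sigma>))"
    for p :: "'g \<Rightarrow>\<^sub>0 'f"
  have P_sup: "P p = (\<Sum>\<sigma>\<in>S. \<phi> \<sigma> (Poly_Mapping.lookup p \<sigma>))"
    if "finite S" "Poly_Mapping.keys p \<subseteq> S" for p S
    unfolding P_def using that
    by (intro sum.mono_neutral_left) (auto simp: in_keys_iff right0)
  have P_add: "P (p + q) = P p + P q" for p q
    using Poly_Mapping.keys_add[of p q]
    by (simp add: P_sup[of "Poly_Mapping.keys p \<union> Poly_Mapping.keys q"] lookup_add right
        sum.distrib)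
  have P_minus: "P (p - q) = P p - P q" for p q
    using P_add[of "p - q" q] by (simp add: algebra_simps)
  have P_single: "P (Poly_Mapping.single \<sigma> c) = \<phi> \<sigma> c" for \<sigma> c
    by (simp add: P_def right0)
  have scale_single: "fscale c (Poly_Mapping.single \<sigma> 1) = Poly_Mapping.single \<sigma> c"
    for c :: 'f and \<sigma> :: 'g
    by (rule poly_mapping_eqI) (simp add: lookup_fscale lookup_single when_def)
  have P_zero: "P p = 0" if "p \<in> additivity_relations" for p
    using that unfolding additivity_relations_def
  proof (induction rule: fpm.span_induct_alt)
    case base
    show ?case by (simp add: P_def)
  next
    case (step c x y)
    then obtain \<sigma> \<tau> where x: "x = Poly_Mapping.single (\<sigma> + \<tau>) 1
        - Poly_Mapping.single \<sigma> 1 - Poly_Mapping.single \<tau> 1" by blast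
    have "fscale c x = Poly_Mapping.single (\<sigma> + \<tau>) c
        - Poly_Mapping.single \<sigma> c - Poly_Mapping.single \<tau> c"
      by (simp only: x fpm.scale_right_diff_distrib scale_single)
    then show ?case
      by (simp only: P_add P_minus P_single left step.IH) simp
  qed
  have P_rel: "P p = P q" if "tensor_rel p q" for p q
    using P_zero[of "p - q"] that by (simp add: tensor_rel_def P_minus)
  define \<Phi> where "\<Phi> x = P (rep_gtensor x)" for x
  have \<Phi>_abs: "\<Phi> (abs_gtensor p) = P p" for p
    unfolding \<Phi>_def
    by (rule P_rel) (rule Quotient3_rep_abs[OF Quotient3_gtensor], rule equivp_reflp[OF equivp_tensor_rel])
  show ?thesis
  proof (rule ex1I[of _ \<Phi>], intro conjI allI)
    fix x y
    show "\<Phi> (x + y) = \<Phi> x + \<Phi> y"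
      by (induction x rule: gtensor.abs_induct, induction y rule: gtensor.abs_induct)
        (simp add: plus_gtensor.abs_eq \<Phi>_abs P_add)
  next
    fix \<sigma> c
    show "\<Phi> (vscale c (gembed \<sigma>)) = \<phi> \<sigma> c"
      by (simp add: vscale.abs_eq gembed.abs_eq \<Phi>_abs scale_single P_single)
  next
    fix \<Psi> :: "('g, 'f) gtensor \<Rightarrow> 'm"
    assume \<Psi>: "(\<forall>x y. \<Psi> (x + y) = \<Psi> x + \<Psi> y) \<and>
        (\<forall>\<sigma> c. \<Psi> (vscale c (gembed \<sigma>)) = \<phi> \<sigma> c)"
    then have \<Psi>0: "\<Psi> 0 = 0" by (metis add_cancel_right_right add_0)
    have sum: "\<Psi> (\<Sum>\<sigma>\<in>S. f \<sigma>) = (\<Sum>\<sigma>\<in>S. \<Psi> (f \<sigma>))" if "finite S" for S :: "'g set" and f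
      using that by (induction S rule: finite_induct) (simp_all add: \<Psi> \<Psi>0)
    show "\<Psi> = \<Phi>"
    proof
      fix x
      show "\<Psi> x = \<Phi> x"
        by (induction x rule: gtensor.abs_induct)
          (simp only: \<Phi>_abs, simp add: gtensor_eq_sum sum \<Psi> P_def)
    qed
  qed
qed

typedef (overloaded) ('g, 'f) gdual =
  "{d :: ('g::ab_group_add, 'f::field) gtensor \<Rightarrow> 'f. Vector_Spaces.linear vscale (*) d}"
  morphisms dapp Abs_gdual
proof
  show "(\<lambda>_. 0) \<in> {d :: ('g, 'f) gtensor \<Rightarrow> 'f. Vector_Spaces.linear vscale (*) d}"
    using vector_space_field
    by (auto simp: Vector_Spaces.linear_def module_hom_def module_hom_axioms_def
        module_iff_vector_space vscale.vector_space_axioms)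
qed

setup_lifting type_definition_gdual

lemma linear_vscale_iff:
  "Vector_Spaces.linear vscale (*) d \<longleftrightarrow>
     (\<forall>x y. d (x + y) = d x + d y) \<and> (\<forall>c x. d (vscale c x) = c * d x)"
  for d :: "('g::ab_group_add, 'f::field) gtensor \<Rightarrow> 'f"
  using vector_space_field[where 'f = 'f]
  by (auto simp: Vector_Spaces.linear_def module_hom_def module_hom_axioms_def
      module_iff_vector_space vscale.vector_space_axioms)

instantiation gdual :: (ab_group_add, field) ab_group_add
begin

lift_definition zero_gdual :: "('a, 'b) gdual" is "\<lambda>_. 0"
  by (simp add: linear_vscale_iff)

lift_definition plus_gdual :: "('a, 'b) gdual \<Rightarrow> ('a, 'b) gdual \<Rightarrow> ('a, 'b) gdual" is
  "\<lambda>d e v. d v + e v"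
  by (simp add: linear_vscale_iff algebra_simps)

lift_definition uminus_gdual :: "('a, 'b) gdual \<Rightarrow> ('a, 'b) gdual" is "\<lambda>d v. - d v"
  by (simp add: linear_vscale_iff algebra_simps)

lift_definition minus_gdual :: "('a, 'b) gdual \<Rightarrow> ('a, 'b) gdual \<Rightarrow> ('a, 'b) gdual" is
  "\<lambda>d e v. d v - e v"
  by (simp add: linear_vscale_iff algebra_simps)

instance
  by standard (transfer, simp add: fun_eq_iff algebra_simps)+

end

lift_definition dscale :: "'f::field \<Rightarrow> ('g::ab_group_add, 'f) gdual \<Rightarrow> ('g, 'f) gdual" is
  "\<lambda>c d v. c * d v"
  by (simp add: linear_vscale_iff algebra_simps)

definition symmetric_cocycle :: "('g::ab_group_add \<Rightarrow> 'g \<Rightarrow> 'f::field) \<Rightarrow> bool" where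
  "symmetric_cocycle lam \<longleftrightarrow>
     (\<forall>\<sigma> \<tau>. lam \<sigma> \<tau> \<noteq> 0) \<and>
     (\<forall>\<sigma> \<tau> \<rho>. lam \<sigma> \<tau> * lam (\<sigma> + \<tau>) \<rho> = lam \<tau> \<rho> * lam \<sigma> (\<tau> + \<rho>)) \<and>
     (\<forall>\<sigma> \<tau>. lam \<sigma> \<tau> = lam \<tau> \<sigma>)"

text \<open>\<open>\<F>\<^sup>t[G]\<close> is the space of finitely supported functions from \<open>G\<close> to \<open>\<F>\<close> with the
  product below; \<open>t\<^sup>\<sigma>\<close> is \<open>Poly_Mapping.single \<sigma> 1\<close>.\<close>

definition twisted_mul ::
  "('g::ab_group_add \<Rightarrow> 'g \<Rightarrow> 'f::field) \<Rightarrow> ('g \<Rightarrow>\<^sub>0 'f) \<Rightarrow> ('g \<Rightarrow>\<^sub>0 'f) \<Rightarrow> ('g \<Rightarrow>\<^sub>0 'f)" where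
  "twisted_mul lam a b =
     (\<Sum>\<sigma>\<in>Poly_Mapping.keys a. \<Sum>\<tau>\<in>Poly_Mapping.keys b.
        Poly_Mapping.single (\<sigma> + \<tau>)
          (lam \<sigma> \<tau> * (Poly_Mapping.lookup a \<sigma> * Poly_Mapping.lookup b \<tau>)))"

text \<open>\<open>\<A> \<otimes> \<F>\<^sup>t[G]\<close> is the direct sum of the spaces \<open>\<A> \<otimes> t\<^sup>\<sigma>\<close>, so we take it to be
  the space of finitely supported functions from \<open>G\<close> to \<open>\<A>\<close>, with \<open>x \<otimes> t\<^sup>\<sigma>\<close> being
  \<open>Poly_Mapping.single \<sigma> x\<close> and \<open>x \<otimes> a\<close> being \<open>pure_tensor A x a\<close>. The lemmas
  \<open>pure_tensor_universal\<close> and \<open>loop_mul_pure_tensor\<close> below say that this is the tensor product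
  algebra. The products and forms are the (bi)linear extensions of the formulas on the elements
  \<open>x \<otimes> t\<^sup>\<sigma>\<close>; \<open>loop_cocycle\<close> is the \<open>\<V>\<close>-component of the product.\<close>

definition pure_tensor ::
  "('f::zero, 'b, 'a::zero) qalg \<Rightarrow> 'a \<Rightarrow> ('g \<Rightarrow>\<^sub>0 'f) \<Rightarrow> ('g \<Rightarrow>\<^sub>0 'a)" where
  "pure_tensor A x a = Poly_Mapping.map (\<lambda>c. smul A c x) a"

definition loop_mul ::
  "('f, 'b, 'a::ab_group_add) qalg \<Rightarrow> ('g::ab_group_add \<Rightarrow> 'g \<Rightarrow> 'f)
    \<Rightarrow> ('g \<Rightarrow>\<^sub>0 'a) \<Rightarrow> ('g \<Rightarrow>\<^sub>0 'a) \<Rightarrow> ('g \<Rightarrow>\<^sub>0 'a)" where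
  "loop_mul A lam p q =
     (\<Sum>\<sigma>\<in>Poly_Mapping.keys p. \<Sum>\<tau>\<in>Poly_Mapping.keys q.
        Poly_Mapping.single (\<sigma> + \<tau>)
          (smul A (lam \<sigma> \<tau>) (mul A (Poly_Mapping.lookup p \<sigma>) (Poly_Mapping.lookup q \<tau>))))"

definition loop_form ::
  "('f::field, 'b, 'a::ab_group_add) qalg \<Rightarrow> ('g::ab_group_add \<Rightarrow> 'g \<Rightarrow> 'f)
    \<Rightarrow> ('g \<Rightarrow>\<^sub>0 'a) \<Rightarrow> ('g \<Rightarrow>\<^sub>0 'a) \<Rightarrow> 'f" where
  "loop_form A lam p q =
     (\<Sum>\<sigma>\<in>Poly_Mapping.keys p. \<Sum>\<tau>\<in>Poly_Mapping.keys q.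
        if \<sigma> = - \<tau>
        then form A (Poly_Mapping.lookup p \<sigma>) (Poly_Mapping.lookup q \<tau>) * lam \<sigma> \<tau> else 0)"

definition loop_cocycle ::
  "('f::field, 'b, 'a::ab_group_add) qalg \<Rightarrow> ('g::ab_group_add \<Rightarrow> 'g \<Rightarrow> 'f)
    \<Rightarrow> ('g \<Rightarrow>\<^sub>0 'a) \<Rightarrow> ('g \<Rightarrow>\<^sub>0 'a) \<Rightarrow> ('g, 'f) gtensor" where
  "loop_cocycle A lam p q =
     (\<Sum>\<sigma>\<in>Poly_Mapping.keys p. \<Sum>\<tau>\<in>Poly_Mapping.keys q.
        if \<sigma> = - \<tau>
        then vscale (lam \<sigma> \<tau> * form A (Poly_Mapping.lookup p \<sigma>) (Poly_Mapping.lookup q \<tau>))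
               (gembed \<sigma>)
        else 0)"

definition degree_act ::
  "('f::field, 'b, 'a::ab_group_add) qalg \<Rightarrow> ('g::ab_group_add, 'f) gdual
    \<Rightarrow> ('g \<Rightarrow>\<^sub>0 'a) \<Rightarrow> ('g \<Rightarrow>\<^sub>0 'a)" where
  "degree_act A d p =
     (\<Sum>\<sigma>\<in>Poly_Mapping.keys p.
        Poly_Mapping.single \<sigma> (smul A (dapp d (gembed \<sigma>)) (Poly_Mapping.lookup p \<sigma>)))"

definition loop_grade :: "('f, 'b, 'a::zero) qalg \<Rightarrow> 'b \<Rightarrow> ('g \<Rightarrow>\<^sub>0 'a) set" where
  "loop_grade A b = {p. \<forall>\<sigma>. Poly_Mapping.lookup p \<sigma> \<in> grade A b}"

definition loop_alg ::
  "('f::field, 'b, 'a::ab_group_add) qalg \<Rightarrow> ('g::ab_group_add \<Rightarrow> 'g \<Rightarrow> 'f)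
    \<Rightarrow> ('f, 'b, 'g \<Rightarrow>\<^sub>0 'a) qalg" where
  "loop_alg A lam =
     \<lparr> smul = pm_smul (smul A),
       mul = loop_mul A lam,
       grade = loop_grade A,
       form = loop_form A lam \<rparr>"

definition tilde_alg ::
  "('f::field, 'b::zero, 'a::ab_group_add) qalg \<Rightarrow> ('g::ab_group_add \<Rightarrow> 'g \<Rightarrow> 'f)
    \<Rightarrow> ('f, 'b, ('g \<Rightarrow>\<^sub>0 'a) \<times> ('g, 'f) gtensor) qalg" where
  "tilde_alg A lam =
     \<lparr> smul = (\<lambda>c (p, v). (pm_smul (smul A) c p, vscale c v)),
       mul = (\<lambda>(p, v) (q, w). (loop_mul A lam p q, loop_cocycle A lam p q)),
       grade = (\<lambda>b. {(p, v). p \<in> loop_grade A b \<and> (b \<noteq> 0 \<longrightarrow> v = 0)}),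
       form = (\<lambda>(p, v) (q, w). loop_form A lam p q) \<rparr>"

definition hat_alg ::
  "('f::field, 'b::zero, 'a::ab_group_add) qalg \<Rightarrow> ('g::ab_group_add \<Rightarrow> 'g \<Rightarrow> 'f)
    \<Rightarrow> ('f, 'b, ('g \<Rightarrow>\<^sub>0 'a) \<times> ('g, 'f) gtensor \<times> ('g, 'f) gdual) qalg" where
  "hat_alg A lam =
     \<lparr> smul = (\<lambda>c (p, v, d). (pm_smul (smul A) c p, vscale c v, dscale c d)),
       mul = (\<lambda>(p, v, d) (q, w, e).
         (loop_mul A lam p q + degree_act A d q - degree_act A e p, loop_cocycle A lam p q, 0)),
       grade = (\<lambda>b. {(p, v, d). p \<in> loop_grade A b \<and> (b \<noteq> 0 \<longrightarrow> v = 0 \<and> d = 0)}),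
       form = (\<lambda>(p, v, d) (q, w, e). loop_form A lam p q + dapp d w + dapp e v) \<rparr>"

definition loop_H :: "'a::zero set \<Rightarrow> ('g::zero \<Rightarrow>\<^sub>0 'a) set" where
  "loop_H H = Poly_Mapping.single 0 ` H"

definition tilde_H ::
  "'a::zero set \<Rightarrow> (('g::ab_group_add \<Rightarrow>\<^sub>0 'a) \<times> ('g, 'f::field) gtensor) set" where
  "tilde_H H = {(p, v). p \<in> loop_H H}"

definition hat_H ::
  "'a::zero set
    \<Rightarrow> (('g::ab_group_add \<Rightarrow>\<^sub>0 'a) \<times> ('g, 'f::field) gtensor \<times> ('g, 'f) gdual) set" where
  "hat_H H = {(p, v, d). p \<in> loop_H H}"

text \<open>\<open>tilde_root H \<alpha>\<close> is \<open>\<alpha>\<close> regarded as a functional on \<open>tilde_H H\<close>, and \<open>hat_root H \<alpha> \<sigma>\<close>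
  is the functional \<open>\<alpha> + \<sigma>\<close> on \<open>hat_H H\<close>; both are zero outside these subspaces, as required
  by \<open>dual_of\<close>. For \<open>h \<otimes> 1 = Poly_Mapping.single 0 h\<close> the coefficient at \<open>0\<close> is \<open>h\<close>.\<close>

definition tilde_root ::
  "'a::zero set \<Rightarrow> ('a \<Rightarrow> 'f::field)
    \<Rightarrow> ('g::ab_group_add \<Rightarrow>\<^sub>0 'a) \<times> ('g, 'f) gtensor \<Rightarrow> 'f" where
  "tilde_root H \<alpha> = (\<lambda>(p, v).
     if (p, v) \<in> tilde_H H then \<alpha> (Poly_Mapping.lookup p 0) else 0)"

definition hat_root ::
  "'a::zero set \<Rightarrow> ('a \<Rightarrow> 'f::field) \<Rightarrow> 'g
    \<Rightarrow> ('g::ab_group_add \<Rightarrow>\<^sub>0 'a) \<times> ('g, 'f) gtensor \<times> ('g, 'f) gdual \<Rightarrow> 'f" where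
  "hat_root H \<alpha> \<sigma> = (\<lambda>(p, v, d).
     if (p, v, d) \<in> hat_H H then \<alpha> (Poly_Mapping.lookup p 0) + dapp d (gembed \<sigma>) else 0)"

lemma bilinear_mapD:
  assumes "bilinear_map s1 s2 s3 f"
  shows "f (x + x') y = f x y + f x' y" "f x (y + y') = f x y + f x y'"
    "f (s1 c x) y = s3 c (f x y)" "f x (s2 c y) = s3 c (f x y)" "f 0 y = 0" "f x 0 = 0"
proof -
  interpret l: Vector_Spaces.linear s1 s3 "\<lambda>x. f x y" for y
    using assms by (simp add: bilinear_map_def)
  interpret r: Vector_Spaces.linear s2 s3 "f x" for x
    using assms by (simp add: bilinear_map_def)
  show "f (x + x') y = f x y + f x' y" "f x (y + y') = f x y + f x y'"
    "f (s1 c x) y = s3 c (f x y)" "f x (s2 c y) = s3 c (f x y)" "f 0 y = 0" "f x 0 = 0"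
    by (rule l.add r.add l.scale r.scale l.zero r.zero)+
qed

lemma twisted_mul_single:
  "twisted_mul lam (Poly_Mapping.single \<sigma> 1) (Poly_Mapping.single \<tau> 1) =
     Poly_Mapping.single (\<sigma> + \<tau>) (lam \<sigma> \<tau>)"
  by (simp add: twisted_mul_def)

context
  fixes A :: "('f::field, 'b, 'a::ab_group_add) qalg"
  assumes vs: "vector_space (smul A)"
    and bm: "bilinear_map (smul A) (smul A) (smul A) (mul A)"
begin

interpretation vector_space "smul A" by (rule vs)

lemma lookup_pure_tensor:
  "Poly_Mapping.lookup (pure_tensor A x a) \<sigma> = smul A (Poly_Mapping.lookup a \<sigma>) x"
  by (simp add: pure_tensor_def Poly_Mapping.map.rep_eq when_def)

lemma pure_tensor_single:
  "pure_tensor A x (Poly_Mapping.single \<sigma> c) = Poly_Mapping.single \<sigma> (smul A c x)"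
  by (rule poly_mapping_eqI) (simp add: lookup_pure_tensor lookup_single when_def)

lemma pure_tensor_sum: "pure_tensor A x (\<Sum>i\<in>I. f i) = (\<Sum>i\<in>I. pure_tensor A x (f i))"
  by (rule poly_mapping_eqI) (simp add: lookup_pure_tensor lookup_sum scale_sum_left)

lemma keys_pure_tensor: "Poly_Mapping.keys (pure_tensor A x a) \<subseteq> Poly_Mapping.keys a"
  by (auto simp: in_keys_iff lookup_pure_tensor)

lemma loop_mul_superset:
  assumes "finite S" "finite T" "Poly_Mapping.keys p \<subseteq> S" "Poly_Mapping.keys q \<subseteq> T"
  shows "loop_mul A lam p q =
     (\<Sum>\<sigma>\<in>S. \<Sum>\<tau>\<in>T. Poly_Mapping.single (\<sigma> + \<tau>)
        (smul A (lam \<sigma> \<tau>) (mul A (Poly_Mapping.lookup p \<sigma>) (Poly_Mapping.lookup q \<tau>))))"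
    (is "_ = (\<Sum>\<sigma>\<in>S. \<Sum>\<tau>\<in>T. ?f \<sigma> \<tau>)")
proof -
  have "loop_mul A lam p q = (\<Sum>\<sigma>\<in>Poly_Mapping.keys p. \<Sum>\<tau>\<in>T. ?f \<sigma> \<tau>)"
    unfolding loop_mul_def using assms
    by (intro sum.cong sum.mono_neutral_left) (auto simp: in_keys_iff bilinear_mapD[OF bm])
  also have "\<dots> = (\<Sum>\<sigma>\<in>S. \<Sum>\<tau>\<in>T. ?f \<sigma> \<tau>)"
    using assms
    by (intro sum.mono_neutral_left) (auto simp: in_keys_iff bilinear_mapD[OF bm])
  finally show ?thesis .
qed

lemma loop_mul_single:
  "loop_mul A lam (Poly_Mapping.single \<sigma> x) (Poly_Mapping.single \<tau> y) =
     Poly_Mapping.single (\<sigma> + \<tau>) (smul A (lam \<sigma> \<tau>) (mul A x y))"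
  by (simp add: loop_mul_superset[of "{\<sigma>}" "{\<tau>}"])

lemma loop_mul_pure_tensor:
  "loop_mul A lam (pure_tensor A x a) (pure_tensor A y b) =
     pure_tensor A (mul A x y) (twisted_mul lam a b)"
  using keys_pure_tensor[of x a] keys_pure_tensor[of y b]
  by (simp add: loop_mul_superset[of "Poly_Mapping.keys a" "Poly_Mapping.keys b"]
      twisted_mul_def pure_tensor_sum pure_tensor_single lookup_pure_tensor
      bilinear_mapD[OF bm] mult_ac)

lemma degree_act_single:
  "degree_act A d (Poly_Mapping.single \<sigma> x) =
     Poly_Mapping.single \<sigma> (smul A (dapp d (gembed \<sigma>)) x)"
  by (simp add: degree_act_def)

lemma pure_tensor_universal:
  fixes \<phi> :: "'a \<Rightarrow> ('g \<Rightarrow>\<^sub>0 'f) \<Rightarrow> 'm::ab_group_add"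
  assumes vm: "vector_space s" and \<phi>: "bilinear_map (smul A) fscale s \<phi>"
  shows "\<exists>!\<Phi>. Vector_Spaces.linear (pm_smul (smul A)) s \<Phi> \<and>
     (\<forall>x a. \<Phi> (pure_tensor A x a) = \<phi> x a)"
proof -
  interpret m: vector_space s by (rule vm)
  note \<phi>D = bilinear_mapD[OF \<phi>]
  define P where "P p = (\<Sum>\<sigma>\<in>Poly_Mapping.keys p.
      \<phi> (Poly_Mapping.lookup p \<sigma>) (Poly_Mapping.single \<sigma> 1))" for p :: "'g \<Rightarrow>\<^sub>0 'a"
  have P_sup: "P p = (\<Sum>\<sigma>\<in>S. \<phi> (Poly_Mapping.lookup p \<sigma>) (Poly_Mapping.single \<sigma> 1))"
    if "finite S" "Poly_Mapping.keys p \<subseteq> S" for p S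
    unfolding P_def using that
    by (intro sum.mono_neutral_left) (auto simp: in_keys_iff \<phi>D)
  have P_add: "P (p + q) = P p + P q" for p q
    using Poly_Mapping.keys_add[of p q]
    by (simp add: P_sup[of "Poly_Mapping.keys p \<union> Poly_Mapping.keys q"] lookup_add \<phi>D
        sum.distrib)
  have P_scale: "P (pm_smul (smul A) c p) = s c (P p)" for c p
    by (subst P_sup[of "Poly_Mapping.keys p"])
      (auto simp: in_keys_iff lookup_pm_smul[OF vs] \<phi>D P_def m.scale_sum_right)
  have P_lin: "Vector_Spaces.linear (pm_smul (smul A)) s P"
    using vector_space_pm_smul[OF vs] vm
    by (simp add: Vector_Spaces.linear_def module_hom_def module_hom_axioms_def
        module_iff_vector_space P_add P_scale)
  have single_sum: "a = (\<Sum>\<sigma>\<in>Poly_Mapping.keys a.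
      Poly_Mapping.single \<sigma> (Poly_Mapping.lookup a \<sigma>))" for a :: "'g \<Rightarrow>\<^sub>0 'c::ab_group_add"
    by (rule poly_mapping_eqI) (simp add: lookup_sum lookup_single when_def in_keys_iff sum.delta)
  have P_tensor: "P (pure_tensor A x a) = \<phi> x a" for x a
  proof -
    interpret r: Vector_Spaces.linear fscale s "\<phi> x"
      using \<phi> by (simp add: bilinear_map_def)
    have fs: "fscale c (Poly_Mapping.single \<sigma> 1) = Poly_Mapping.single \<sigma> c" for c \<sigma>
      by (rule poly_mapping_eqI) (simp add: lookup_fscale lookup_single when_def)
    have "\<phi> x a = \<phi> x (\<Sum>\<sigma>\<in>Poly_Mapping.keys a.
        fscale (Poly_Mapping.lookup a \<sigma>) (Poly_Mapping.single \<sigma> 1))"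
      using single_sum[of a] by (simp only: fs)
    also have "\<dots> = (\<Sum>\<sigma>\<in>Poly_Mapping.keys a.
        s (Poly_Mapping.lookup a \<sigma>) (\<phi> x (Poly_Mapping.single \<sigma> 1)))"
      by (simp only: r.sum r.scale)
    finally show ?thesis
      using keys_pure_tensor[of x a]
      by (simp add: P_sup[of "Poly_Mapping.keys a"] lookup_pure_tensor \<phi>D)
  qed
  show ?thesis
  proof (rule ex1I[of _ P], intro conjI allI)
    show "Vector_Spaces.linear (pm_smul (smul A)) s P" by (rule P_lin)
    show "P (pure_tensor A x a) = \<phi> x a" for x a by (rule P_tensor)
  next
    fix Q
    assume Q: "Vector_Spaces.linear (pm_smul (smul A)) s Q \<and>
      (\<forall>x a. Q (pure_tensor A x a) = \<phi> x a)"
    then interpret q: Vector_Spaces.linear "pm_smul (smul A)" s Q by blast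
    have Q_single: "Q (Poly_Mapping.single \<sigma> x) = \<phi> x (Poly_Mapping.single \<sigma> 1)" for \<sigma> x
      using Q pure_tensor_single[of x \<sigma> 1] by (metis scale_one)
    show "Q = P"
    proof
      fix p
      have "Q p = Q (\<Sum>\<sigma>\<in>Poly_Mapping.keys p.
          Poly_Mapping.single \<sigma> (Poly_Mapping.lookup p \<sigma>))"
        by (subst (1) single_sum) (rule refl)
      also have "\<dots> = P p"
        by (simp only: q.sum Q_single P_def)
      finally show "Q p = P p" .
    qed
  qed
qed

context
  assumes bf: "bilinear_map (smul A) (smul A) (*) (form A)"
begin

lemma loop_form_single:
  "loop_form A lam (Poly_Mapping.single \<sigma> x) (Poly_Mapping.single \<tau> y) =
     (if \<sigma> = - \<tau> then form A x y * lam \<sigma> \<tau> else 0)"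
  by (auto simp: loop_form_def bilinear_mapD[OF bf])

lemma loop_cocycle_single:
  "loop_cocycle A lam (Poly_Mapping.single \<sigma> x) (Poly_Mapping.single \<tau> y) =
     (if \<sigma> = - \<tau> then vscale (lam \<sigma> \<tau> * form A x y) (gembed \<sigma>) else 0)"
  by (auto simp: loop_cocycle_def bilinear_mapD[OF bf])

end

end

end

theory Submission
  imports Defs "HOL-Computational_Algebra.Polynomial"
begin

text \<open>Eigenspaces of \<open>H\<close> are automatically independent, so for (i) it only remains to see that
  the root spaces span; the elements \<open>x \<otimes> t\<^sup>\<sigma>\<close> with \<open>x\<close> a root vector, together with the added
  central elements and derivations, do.

  The delicate point is (E2) when the form on \<open>H\<close> may be degenerate: for root vectors
  \<open>p\<close>, \<open>q\<close> of the loop algebra with many components, the product \<open>pq = T \<otimes> 1\<close> is a sum of products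
  none of which need lie in \<open>H\<close>. On the finitely generated, hence free, group \<open>G'\<close> generated
  by the supports the cocycle is a coboundary, so that \<open>t\<^sup>\<sigma> \<mapsto> \<chi> \<sigma> s\<^bsup>\<phi>(\<sigma>)\<^esup>\<close> is multiplicative for
  every \<open>s \<noteq> 0\<close> and every additive \<open>\<phi> : G' \<rightarrow> \<int>\<close>. Evaluating \<open>p\<close> and \<open>q\<close> there gives homogeneous root
  vectors of \<open>A\<close> with product \<open>T\<close>, whose form \<open>f(s)\<close> is a Laurent polynomial in \<open>s\<close> with constant
  term \<open>(p, q) = 1\<close> if \<open>\<phi>\<close> is generic. After rescaling, \<open>\<beta>(T) / f(s)\<close> is one of the finitely many
  values for \<open>A\<close> whenever \<open>f(s) \<noteq> 0\<close>; so either \<open>\<beta>(T) = 0\<close>, or \<open>f\<close> takes finitely many values,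
  is therefore constantly \<open>1\<close>, and \<open>\<beta>(T)\<close> itself is such a value.\<close>

section \<open>Finite subsets of torsion-free abelian groups\<close>

text \<open>For nonzero \<alpha> and a non-degenerate form on \<open>H\<close>, invariance gives
  \<open>(h, T) = \<alpha> h\<close> for all \<open>h\<close> in \<open>H\<close>; this determines
  \<open>T\<close>, and (E1) supplies root vectors of \<open>A\<close> with that normalized product.
  With a degenerate form \<open>T\<close> is not determined by \<alpha>, so \<open>T\<close> itself
  has to be realized as a product in \<open>A\<close>. A single pair of components of
  \<open>p\<close> and \<open>q\<close> cannot do this; specializing all components at once can.
  Torsion-freeness enters through freeness of \<open>G'\<close>: symmetric cocycles split on a free
  group, and a free group has enough additive maps to the integers.

  In the algebra with derivations two things change. The form also pairs \<open>V\<close> with its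
  dual, so \<open>(x, y) = 1\<close> no longer controls the loop parts; this happens only for the
  zero root, where \<open>T\<close> is orthogonal to \<open>H\<close> and vanishes because the form
  on \<open>A^0\<close> is non-degenerate. And (E1) must serve the roots with \<alpha> = 0 and
  nonzero \<sigma>, about which (E1) for \<open>A\<close> is silent: non-degeneracy on
  \<open>A^0\<close> provides a partner, and the central term \<open>(x, y) \<sigma>\<close> makes
  the product nonzero.\<close>

lemma nmult_simps [simp]:
  "nmult 0 x = 0" "nmult (Suc n) x = x + nmult n x" "nmult n 0 = 0"
  by (simp_all add: nmult_def add.commute)

lemma nmult_add: "nmult (m + n) x = nmult m x + nmult n x"
  by (induction m) (simp_all add: add.assoc)

lemma nmult_add_right: "nmult n (x + y) = nmult n x + nmult n y"
  by (simp add: nmult_def sum.distrib)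

lemma nmult_mult: "nmult (m * n) x = nmult m (nmult n x)"
  by (induction m) (simp_all add: nmult_add)

text \<open>Every abelian group becomes a module over the integers, so that
  \<open>zmod.span B\<close> is the subgroup generated by \<open>B\<close> and the library's
  independence and coordinates apply. The definition goes through \<open>nmult\<close> because
  torsion-freeness is stated with it.\<close>

definition zmult :: "int \<Rightarrow> 'g::ab_group_add \<Rightarrow> 'g" where
  "zmult k x = nmult (nat k) x - nmult (nat (- k)) x"

text \<open>Any presentation of an integer as a difference of naturals may be used, which spares the
  module laws below all case distinctions on signs.\<close>

lemma zmult_of_nat_diff: "zmult (int m - int n) x = nmult m x - nmult n x"
proof (cases "n \<le> m")
  case True
  then obtain k where "m = n + k" using le_Suc_ex by blast
  then show ?thesis by (simp add: zmult_def nmult_add)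
next
  case False
  then obtain k where "n = m + k" using le_Suc_ex nat_le_linear by blast
  then show ?thesis by (simp add: zmult_def nmult_add)
qed

interpretation zmod: module "zmult :: int \<Rightarrow> 'g::ab_group_add \<Rightarrow> 'g"
proof
  show "zmult a (x + y) = zmult a x + zmult a y" for a and x y :: 'g
    by (simp add: zmult_def nmult_add_right)
  show "zmult (a + b) x = zmult a x + zmult b x" for a b and x :: 'g
  proof (cases a rule: int_diff_cases, cases b rule: int_diff_cases)
    fix m n k l assume "a = int m - int n" "b = int k - int l"
    then have *: "a + b = int (m + k) - int (n + l)" by simp
    have "zmult (a + b) x = nmult (m + k) x - nmult (n + l) x"
      unfolding * by (rule zmult_of_nat_diff)
    then show ?thesis
      by (simp add: \<open>a = _\<close> \<open>b = _\<close> zmult_of_nat_diff nmult_add)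
  qed
  show "zmult a (zmult b x) = zmult (a * b) x" for a b and x :: 'g
  proof (cases a rule: int_diff_cases, cases b rule: int_diff_cases)
    fix m n k l assume "a = int m - int n" "b = int k - int l"
    then have *: "a * b = int (m * k + n * l) - int (m * l + n * k)"
      unfolding \<open>a = _\<close> \<open>b = _\<close> by (simp add: algebra_simps)
    have diff: "nmult i (y - z) = nmult i y - nmult i z" for i and y z :: 'g
      using nmult_add_right[of i "y - z" z] by (simp add: algebra_simps)
    have "zmult (a * b) x = nmult (m * k + n * l) x - nmult (m * l + n * k) x"
      unfolding * by (rule zmult_of_nat_diff)
    then show ?thesis
      unfolding \<open>a = _\<close> \<open>b = _\<close> by (simp add: zmult_of_nat_diff nmult_add nmult_mult diff)
  qed
  show "zmult 1 x = x" for x :: 'g by (simp add: zmult_def)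
qed

lemma zmult_eq_0_torsion_free:
  assumes "\<forall>n (\<sigma>::'g::ab_group_add). 0 < n \<and> nmult n \<sigma> = 0 \<longrightarrow> \<sigma> = 0"
    and "zmult k (x::'g) = 0" "k \<noteq> 0"
  shows "x = 0"
proof (cases "k > 0")
  case True
  then show ?thesis using assms(1)[rule_format, of "nat k" x] assms(2) by (simp add: zmult_def)
next
  case False
  then show ?thesis
    using assms(1)[rule_format, of "nat (- k)" x] assms(2,3) by (simp add: zmult_def)
qed

text \<open>Among the generating sets of minimal cardinality, take a relation of minimal \<open>l\<^sup>1\<close>-norm:
  a Euclidean step on two of its coefficients would decrease the norm.\<close>

lemma torsion_free_finite_independent:
  fixes X :: "'g::ab_group_add set"
  assumes tf: "\<forall>n (\<sigma>::'g). 0 < n \<and> nmult n \<sigma> = 0 \<longrightarrow> \<sigma> = 0"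
    and X: "finite X"
  obtains B where "finite B" "zmod.independent B" "X \<subseteq> zmod.span B"
proof -
  define gen where "gen B \<longleftrightarrow> finite B \<and> X \<subseteq> zmod.span B" for B
  have "gen X" using X by (simp add: gen_def zmod.span_superset)
  then obtain B0 where B0: "gen B0" and min: "\<And>B. gen B \<Longrightarrow> card B0 \<le> card B"
    using ex_has_least_nat[of gen X card] by blast
  \<comment> \<open>A Euclidean step changes the generating set along with the coefficients, so the
    descent runs over pairs of \<open>B\<close> and \<open>u\<close>; only the cardinality of
    \<open>B\<close> stays fixed.\<close>
  define rel where "rel B u \<longleftrightarrow> gen B \<and> card B = card B0 \<and> (\<Sum>v\<in>B. zmult (u v) v) = 0 \<and>
      (\<exists>v\<in>B. u v \<noteq> 0)" for B and u :: "'g \<Rightarrow> int"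
  have no_rel: "\<not> rel B u" for B u
  proof (induction "\<Sum>v\<in>B. nat \<bar>u v\<bar>" arbitrary: B u rule: less_induct)
    case less
    show ?case
    proof
      assume r: "rel B u"
      then have fB: "finite B" and XB: "X \<subseteq> zmod.span B" and cB: "card B = card B0"
        and sum0: "(\<Sum>v\<in>B. zmult (u v) v) = 0" by (auto simp: rel_def gen_def)
      from r obtain w0 where w0: "w0 \<in> B" "u w0 \<noteq> 0" by (auto simp: rel_def)
      have small: False if "X \<subseteq> zmod.span C" "finite C" "card C < card B" for C
        using min[of C] that cB by (simp add: gen_def)
      show False
      proof (cases "\<exists>v\<in>B. v \<noteq> w0 \<and> u v \<noteq> 0")
        \<comment> \<open>A relation with one term says that a nonzero multiple of \<open>w0\<close>
          is 0. Torsion-freeness gives \<open>w0 = 0\<close>, and dropping it leaves a smaller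
          generating set.\<close>
        case False
        then have "(\<Sum>v\<in>B. zmult (u v) v) = (\<Sum>v\<in>{w0}. zmult (u v) v)"
          using fB w0 by (intro sum.mono_neutral_right) auto
        then have "zmult (u w0) w0 = 0" using sum0 by simp
        then have "w0 = 0" using zmult_eq_0_torsion_free[OF tf] w0 by blast
        then have "B \<subseteq> zmod.span (B - {w0})"
          by (auto intro: zmod.span_zero zmod.span_base)
        then have "X \<subseteq> zmod.span (B - {w0})"
          using order.trans[OF XB zmod.span_minimal[OF _ zmod.subspace_span]] by simp
        then show False using small[of "B - {w0}"] card_Diff1_less[OF fB w0(1)] fB by simp
      next
        case True
        then obtain v1 where v1: "v1 \<in> B" "v1 \<noteq> w0" "u v1 \<noteq> 0" by blast
        obtain v w where vw: "v \<in> B" "w \<in> B" "v \<noteq> w" "u v \<noteq> 0" "u w \<noteq> 0" "\<bar>u w\<bar> \<le> \<bar>u v\<bar>"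
        proof (cases "\<bar>u w0\<bar> \<le> \<bar>u v1\<bar>")
          case True
          show ?thesis by (rule that[OF v1(1) w0(1) v1(2,3) w0(2) True])
        next
          case False
          then show ?thesis using that[OF w0(1) v1(1) v1(2)[symmetric] w0(2) v1(3)] by simp
        qed
        \<comment> \<open>With \<open>w' = w + k v\<close>, the relation is preserved because
          \<open>(u v) v + (u w) w = (u v - k (u w)) v + (u w) w'\<close>. The sign in
          \<open>k\<close> makes the new coefficient of \<open>v\<close> smaller in absolute value,
          as \<open>u w\<close> is nonzero and not larger than \<open>u v\<close>.\<close>
        define k where "k = sgn (u v) * sgn (u w)"
        define w' where "w' = w + zmult k v"
        define C where "C = B - {v, w}"
        have fC: "finite C" using fB by (simp add: C_def)
        have B_eq: "B = insert v (insert w C)" and vC: "v \<notin> C" "w \<notin> C"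
          using vw by (auto simp: C_def)
        have "w = w' + zmult (- k) v" by (simp add: w'_def)
        then have "w \<in> zmod.span (insert v (insert w' C))"
          by (metis zmod.span_add zmod.span_base zmod.span_scale insertI1 insertI2)
        then have "B \<subseteq> zmod.span (insert v (insert w' C))"
          by (auto simp: B_eq intro: zmod.span_base)
        then have X': "X \<subseteq> zmod.span (insert v (insert w' C))"
          using order.trans[OF XB zmod.span_minimal[OF _ zmod.subspace_span]] by simp
        have card_B: "card B = Suc (Suc (card C))"
          using fC vC vw by (simp add: B_eq)
        \<comment> \<open>A coincidence would leave a generating set with fewer elements than
          \<open>B\<close>, against minimality.\<close>
        have "w' \<notin> insert v C"
        proof
          assume "w' \<in> insert v C"
          then have "insert v (insert w' C) = insert v C" by auto
          then show False using small[OF X'] fC vC card_B by simp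
        qed
        then have w'_notin: "w' \<noteq> v" "v \<noteq> w'" "w' \<notin> C" by auto
        define B' where "B' = insert v (insert w' C)"
        define u' where "u' x =
          (if x = w' then u w else if x = v then u v - k * u w else u x)" for x
        have u'C: "u' x = u x" if "x \<in> C" for x
          using that w'_notin vC by (auto simp: u'_def)
        have u'v: "u' v = u v - k * u w" and u'w: "u' w' = u w"
          using w'_notin by (auto simp: u'_def)
        have sum_B': "(\<Sum>x\<in>B'. f x) = f v + (f w' + (\<Sum>x\<in>C. f x))"
          for f :: "'g \<Rightarrow> 'z::comm_monoid_add"
          using w'_notin vC fC by (simp add: B'_def)
        have sum_B: "(\<Sum>x\<in>B. f x) = f v + (f w + (\<Sum>x\<in>C. f x))"
          for f :: "'g \<Rightarrow> 'z::comm_monoid_add"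
          using vC fC vw by (simp add: B_eq)
        have "(\<Sum>x\<in>B'. zmult (u' x) x) = (\<Sum>x\<in>B. zmult (u x) x)"
          unfolding sum_B sum_B' u'v u'w
          by (simp add: u'C w'_def zmod.scale_left_diff_distrib zmod.scale_right_distrib
              mult.commute)
        moreover have "\<exists>x\<in>B'. u' x \<noteq> 0" using u'w vw by (auto simp: B'_def)
        moreover have "card B' = card B"
          using w'_notin vC fC card_B by (simp add: B'_def)
        ultimately have rel': "rel B' u'"
          using X' fC cB sum0 by (simp add: rel_def gen_def B'_def)
        have "\<bar>u v - k * u w\<bar> < \<bar>u v\<bar>"
          using vw unfolding k_def by (auto simp: sgn_if split: if_splits)
        then have "(\<Sum>x\<in>B'. nat \<bar>u' x\<bar>) < (\<Sum>x\<in>B. nat \<bar>u x\<bar>)"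
          unfolding sum_B sum_B' u'v u'w by (simp add: u'C)
        then show False using less(1)[of u' B'] rel' by blast
      qed
    qed
  qed
  have "zmod.independent B0"
  proof
    assume "zmod.dependent B0"
    then obtain u where "(\<exists>v\<in>B0. u v \<noteq> 0) \<and> (\<Sum>v\<in>B0. zmult (u v) v) = 0"
      using B0 by (auto simp: zmod.dependent_finite gen_def)
    then show False using no_rel[of B0 u] B0 by (simp add: rel_def)
  qed
  then show ?thesis using B0 that by (auto simp: gen_def)
qed

text \<open>Coordinates are additive, and each nonzero element of the span has a nonzero coordinate.
  The functional is corrected for one element of \<open>Y\<close> at a time, without losing the
  nonzero values reached before.\<close>

lemma generic_additive_functional:
  fixes B :: "'g::ab_group_add set"
  assumes ind: "zmod.independent B" and "finite Y" "Y \<subseteq> zmod.span B - {0}"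
  obtains \<phi> :: "'g \<Rightarrow> int" where
    "\<And>x y. x \<in> zmod.span B \<Longrightarrow> y \<in> zmod.span B \<Longrightarrow> \<phi> (x + y) = \<phi> x + \<phi> y"
    "\<And>y. y \<in> Y \<Longrightarrow> \<phi> y \<noteq> 0"
proof -
  have "\<exists>\<phi> :: 'g \<Rightarrow> int. (\<forall>x\<in>zmod.span B. \<forall>y\<in>zmod.span B. \<phi> (x + y) = \<phi> x + \<phi> y) \<and>
      (\<forall>y\<in>Y. \<phi> y \<noteq> 0)"
    using assms(2,3)
  proof (induction Y rule: finite_induct)
    case empty
    show ?case by (rule exI[of _ "\<lambda>_. 0"]) simp
  next
    case (insert z Y)
    then obtain \<phi> :: "'g \<Rightarrow> int"
      where add: "\<And>x y. x \<in> zmod.span B \<Longrightarrow> y \<in> zmod.span B \<Longrightarrow> \<phi> (x + y) = \<phi> x + \<phi> y"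
        and nz: "\<And>y. y \<in> Y \<Longrightarrow> \<phi> y \<noteq> 0" by auto
    show ?case
    proof (cases "\<phi> z = 0")
      case False
      then show ?thesis using add nz by auto
    next
      case True
      have z: "z \<in> zmod.span B" "z \<noteq> 0" using insert.prems by auto
      then obtain v where v: "zmod.representation B z v \<noteq> 0"
        using zmod.sum_nonzero_representation_eq[OF ind z(1)] by fastforce
      define \<psi> where "\<psi> x = zmod.representation B x v" for x
      \<comment> \<open>\<open>N\<close> exceeds the absolute value of \<open>\<psi>\<close> on all
        earlier elements, so \<open>\<psi> y\<close> cannot cancel the nonzero multiple
        \<open>N * \<phi> y\<close> of \<open>N\<close>; at \<open>z\<close>, where
        \<open>\<phi>\<close> vanishes, \<open>\<psi> z\<close> survives.\<close>
      define N where "N = 1 + (\<Sum>y\<in>Y. \<bar>\<psi> y\<bar>)"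
      have N: "\<bar>\<psi> y\<bar> < N" if "y \<in> Y" for y
        using member_le_sum[of y Y "\<lambda>y. \<bar>\<psi> y\<bar>"] that insert.hyps by (simp add: N_def)
      have "N * \<phi> y + \<psi> y \<noteq> 0" if "y \<in> Y" for y
      proof
        assume "N * \<phi> y + \<psi> y = 0"
        then have "\<psi> y = - (N * \<phi> y)" by simp
        then have "\<bar>\<psi> y\<bar> = N * \<bar>\<phi> y\<bar>" using N[OF that]
          by (metis abs_ge_zero abs_minus_cancel abs_mult abs_of_nonneg le_less_trans less_imp_le)
        moreover have "N * 1 \<le> N * \<bar>\<phi> y\<bar>"
          using nz[OF that] N[OF that] by (intro mult_left_mono) auto
        ultimately show False using N[OF that] by simp
      qed
      moreover have "N * \<phi> z + \<psi> z \<noteq> 0" using True v by (simp add: \<psi>_def)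
      moreover have "\<psi> (x + y) = \<psi> x + \<psi> y" if "x \<in> zmod.span B" "y \<in> zmod.span B" for x y
        using zmod.representation_add[OF ind that(2,1)] by (simp add: \<psi>_def)
      ultimately show ?thesis
        using add by (intro exI[of _ "\<lambda>x. N * \<phi> x + \<psi> x"]) (auto simp: algebra_simps)
    qed
  qed
  then show ?thesis using that by blast
qed

section \<open>Symmetric cocycles are locally coboundaries\<close>

locale normalized_cocycle =
  fixes lam :: "'g::ab_group_add \<Rightarrow> 'g \<Rightarrow> 'f::field"
  assumes cocycle: "symmetric_cocycle lam" and lam_00: "lam 0 0 = 1"
begin

lemma lam_nz [simp]: "lam \<sigma> \<tau> \<noteq> 0"
  using cocycle by (simp add: symmetric_cocycle_def)

lemma lam_sym: "lam \<sigma> \<tau> = lam \<tau> \<sigma>"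
  using cocycle unfolding symmetric_cocycle_def by blast

lemma lam_assoc: "lam \<sigma> \<tau> * lam (\<sigma> + \<tau>) \<rho> = lam \<tau> \<rho> * lam \<sigma> (\<tau> + \<rho>)"
  using cocycle unfolding symmetric_cocycle_def by blast

lemma lam_0 [simp]: "lam 0 \<sigma> = 1" "lam \<sigma> 0 = 1"
proof -
  show "lam 0 \<sigma> = 1" using lam_assoc[of 0 0 \<sigma>] by (simp add: lam_00)
  then show "lam \<sigma> 0 = 1" using lam_sym by metis
qed

text \<open>In the twisted group algebra, the two sides are the scalars of
  \<open>(t^a t^b) (t^c t^d)\<close> and \<open>(t^a t^c) (t^b t^d)\<close>. By \<open>split\<close>
  both are rebracketed around the product of the two middle factors, where symmetry exchanges
  \<open>b\<close> and \<open>c\<close>.\<close>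

lemma lam_exchange:
  "lam (a + b) (c + d) * lam a b * lam c d = lam a c * lam b d * lam (a + c) (b + d)"
proof -
  have split: "lam x y * lam z t * lam (x + y) (z + t) =
      lam y z * lam x (y + z) * lam (x + y + z) t"
    for x y z t
    by (metis lam_assoc mult.assoc mult.commute)
  have "lam a b * lam c d * lam (a + b) (c + d) = lam b c * lam a (b + c) * lam (a + b + c) d"
    by (rule split)
  moreover have "lam a c * lam b d * lam (a + c) (b + d) =
      lam c b * lam a (c + b) * lam (a + c + b) d"
    by (rule split)
  ultimately show ?thesis by (simp add: lam_sym[of c b] add_ac mult_ac)
qed

text \<open>On \<open>K\<close>, \<open>lam\<close> is the coboundary of \<open>\<chi>\<close>: when
  \<open>K\<close> is a subgroup, sending \<open>t^\<sigma>\<close> to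
  \<open>\<chi> \<sigma>\<close> is multiplicative on the part of the twisted group algebra
  supported in \<open>K\<close>.\<close>

definition trivializes :: "('g \<Rightarrow> 'f) \<Rightarrow> 'g set \<Rightarrow> bool" where
  "trivializes \<chi> K \<longleftrightarrow> \<chi> 0 = 1 \<and> (\<forall>\<sigma>\<in>K. \<chi> \<sigma> \<noteq> 0) \<and>
     (\<forall>\<sigma>\<in>K. \<forall>\<tau>\<in>K. \<chi> \<sigma> * \<chi> \<tau> = lam \<sigma> \<tau> * \<chi> (\<sigma> + \<tau>))"

text \<open>Sending \<open>t^g\<close> to 1 forces all other values: as \<open>t^(ng) t^g\<close> is
  \<open>lam (ng) g\<close> times \<open>t^((n+1)g)\<close>, the value \<open>\<psi> n\<close> must
  be \<open>c n * \<psi> (n + 1)\<close>. The two products solve this recursion upwards and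
  downwards from 0, and the cocycle identity at \<open>mg\<close>, \<open>ng\<close>,
  \<open>g\<close> extends multiplicativity from \<open>g\<close> to all multiples.\<close>

lemma trivialization_cyclic:
  obtains \<psi> :: "int \<Rightarrow> 'f" where "\<psi> 0 = 1" "\<And>n. \<psi> n \<noteq> 0"
    "\<And>m n. \<psi> m * \<psi> n = lam (zmult m g) (zmult n g) * \<psi> (m + n)"
proof -
  define c where "c n = lam (zmult n g) g" for n
  have c_nz: "c n \<noteq> 0" for n by (simp add: c_def)
  define \<psi> where "\<psi> n = (if n \<ge> 0 then \<Prod>i<nat n. 1 / c (int i)
      else \<Prod>i<nat (- n). c (- int (Suc i)))" for n
  have \<psi>_nz: "\<psi> n \<noteq> 0" for n by (auto simp: \<psi>_def c_nz)
  have step: "\<psi> n = c n * \<psi> (n + 1)" for n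
  proof (cases "n \<ge> 0")
    case True
    then have "nat (n + 1) = Suc (nat n)" by simp
    with True show ?thesis by (simp add: \<psi>_def c_nz)
  next
    case False
    then obtain k where k: "n = - int (Suc k)"
      by (metis int_cases of_nat_0_le_iff)
    show ?thesis
      by (cases k) (auto simp: \<psi>_def k nat_add_distrib)
  qed
  have lam_c: "lam (zmult m g) (zmult n g) * c (m + n) = c n * lam (zmult m g) (zmult (n + 1) g)"
    for m n
    using lam_assoc[of "zmult m g" "zmult n g" g] by (simp add: c_def zmod.scale_left_distrib)
  have "\<forall>m. \<psi> m * \<psi> n = lam (zmult m g) (zmult n g) * \<psi> (m + n)" for n
  proof (induction n rule: int_induct[where k = 0])
    case base
    show ?case by (simp add: \<psi>_def)
  next
    case (step1 n)
    show ?case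
    proof
      fix m
      have "c n * (\<psi> m * \<psi> (n + 1)) = \<psi> m * \<psi> n" by (simp add: step[of n])
      also have "\<dots> = lam (zmult m g) (zmult n g) * (c (m + n) * \<psi> (m + n + 1))"
        using step1 by (simp add: step[of "m + n"])
      also have "\<dots> = c n * (lam (zmult m g) (zmult (n + 1) g) * \<psi> (m + n + 1))"
        by (simp add: lam_c flip: mult.assoc)
      finally show "\<psi> m * \<psi> (n + 1) = lam (zmult m g) (zmult (n + 1) g) * \<psi> (m + (n + 1))"
        by (simp add: c_nz add_ac)
    qed
  next
    case (step2 n)
    show ?case
    proof
      fix m
      have "\<psi> m * \<psi> (n - 1) = c (n - 1) * (\<psi> m * \<psi> n)" by (simp add: step[of "n - 1"])
      also have "\<dots> = c (n - 1) * (lam (zmult m g) (zmult n g) * \<psi> (m + n))"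
        using step2 by simp
      also have "\<dots> = lam (zmult m g) (zmult (n - 1) g) * (c (m + (n - 1)) * \<psi> (m + n))"
        using lam_c[of m "n - 1"] by (simp flip: mult.assoc)
      finally show "\<psi> m * \<psi> (n - 1) = lam (zmult m g) (zmult (n - 1) g) * \<psi> (m + (n - 1))"
        using step[of "m + (n - 1)"] by (simp add: add_ac)
    qed
  qed
  moreover have "\<psi> 0 = 1" by (simp add: \<psi>_def)
  ultimately show ?thesis using that \<psi>_nz by blast
qed

text \<open>An explicit form of the splitting of abelian extensions of a free group. A new basis
  element \<open>g\<close> writes each \<open>x\<close> uniquely as \<open>r x\<close> in the old
  span plus a multiple of \<open>g\<close>, and a value is already known for both summands.\<close>

lemma trivialization_on_span:
  assumes "finite B" "zmod.independent B"
  shows "\<exists>\<chi>. trivializes \<chi> (zmod.span B)"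
  using assms
proof (induction B rule: finite_induct)
  case empty
  show ?case by (rule exI[of _ "\<lambda>_. 1"]) (simp add: trivializes_def)
next
  case (insert g B)
  note ind = insert.prems
  obtain \<chi> where \<chi>: "trivializes \<chi> (zmod.span B)"
    using insert.IH zmod.independent_mono[OF ind subset_insertI] by blast
  obtain \<psi> where \<psi>: "\<psi> 0 = 1" "\<And>n. \<psi> n \<noteq> 0"
      "\<And>m n. \<psi> m * \<psi> n = lam (zmult m g) (zmult n g) * \<psi> (m + n)"
    using trivialization_cyclic[of g] by blast
  define n where "n x = zmod.representation (insert g B) x g" for x
  define r where "r x = x - zmult (n x) g" for x
  have n_add: "n (x + y) = n x + n y"
    if "x \<in> zmod.span (insert g B)" "y \<in> zmod.span (insert g B)" for x y
    using zmod.representation_add[OF ind that(2,1)] by (simp add: n_def)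
  then have r_add: "r (x + y) = r x + r y"
    if "x \<in> zmod.span (insert g B)" "y \<in> zmod.span (insert g B)" for x y
    using that by (simp add: r_def zmod.scale_left_distrib)
  have r_span: "r x \<in> zmod.span B" if "x \<in> zmod.span (insert g B)" for x
  proof -
    have "x = (\<Sum>b\<in>insert g B. zmult (zmod.representation (insert g B) x b) b)"
      using zmod.sum_representation_eq[OF ind that, of "insert g B"] insert.hyps by simp
    then have "r x = (\<Sum>b\<in>B. zmult (zmod.representation (insert g B) x b) b)"
      using insert.hyps by (simp add: r_def n_def algebra_simps)
    then show ?thesis by (simp add: zmod.span_sum zmod.span_scale zmod.span_base)
  qed
  \<comment> \<open>Forced by \<open>t^(r x) t^(n x g) = lam (r x) (n x g) t^x\<close>.
    Multiplicativity then amounts to \<open>lam_exchange\<close>, applied to the splittings of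
    \<open>x\<close> and \<open>y\<close>.\<close>
  define \<chi>' where "\<chi>' x = \<chi> (r x) * \<psi> (n x) / lam (r x) (zmult (n x) g)" for x
  have x_eq: "x = r x + zmult (n x) g" for x by (simp add: r_def)
  have "\<chi>' x * \<chi>' y = lam x y * \<chi>' (x + y)"
    if x: "x \<in> zmod.span (insert g B)" and y: "y \<in> zmod.span (insert g B)" for x y
  proof -
    have 1: "\<chi> (r x) * \<chi> (r y) = lam (r x) (r y) * \<chi> (r x + r y)"
      using \<chi> r_span[OF x] r_span[OF y] by (auto simp: trivializes_def)
    have 2: "lam x y * lam (r x) (zmult (n x) g) * lam (r y) (zmult (n y) g) =
        lam (r x) (r y) * lam (zmult (n x) g) (zmult (n y) g) *
        lam (r x + r y) (zmult (n x + n y) g)"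
      using lam_exchange[of "r x" "zmult (n x) g" "r y" "zmult (n y) g"]
      by (simp add: zmod.scale_left_distrib flip: x_eq)
    have "\<chi>' x * \<chi>' y = (\<chi> (r x) * \<chi> (r y)) * (\<psi> (n x) * \<psi> (n y)) /
        (lam (r x) (zmult (n x) g) * lam (r y) (zmult (n y) g))"
      by (simp add: \<chi>'_def)
    also have "\<dots> = lam (r x) (r y) * lam (zmult (n x) g) (zmult (n y) g) *
        \<chi> (r x + r y) * \<psi> (n x + n y) / (lam (r x) (zmult (n x) g) * lam (r y) (zmult (n y) g))"
      by (simp add: 1 \<psi>(3))
    also have "\<dots> = lam x y * (\<chi> (r x + r y) * \<psi> (n x + n y) /
        lam (r x + r y) (zmult (n x + n y) g))"
      using 2 by (simp add: field_simps)
    also have "\<dots> = lam x y * \<chi>' (x + y)"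
      by (simp add: \<chi>'_def n_add[OF x y] r_add[OF x y])
    finally show ?thesis .
  qed
  moreover have "\<chi>' x \<noteq> 0" if "x \<in> zmod.span (insert g B)" for x
    using \<chi> r_span[OF that] \<psi>(2)[of "n x"] unfolding \<chi>'_def trivializes_def by simp
  moreover have "\<chi>' 0 = 1"
    using \<chi> \<psi>(1) unfolding \<chi>'_def r_def n_def trivializes_def
    by (simp add: zmod.representation_zero)
  ultimately have "trivializes \<chi>' (zmod.span (insert g B))"
    unfolding trivializes_def by blast
  then show ?case by blast
qed

end

section \<open>Direct sums and root spaces\<close>

text \<open>Induction over the span produces a decomposition, by adding each summand to the
  component it belongs to; independence, applied to the difference of two decompositions, makes it
  unique.\<close>

lemma internal_direct_sumI:
  fixes s :: "'f::field \<Rightarrow> 'a::ab_group_add \<Rightarrow> 'a" and W :: "'i \<Rightarrow> 'a set"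
  assumes "vector_space s"
    and sub: "\<And>i. i \<in> I \<Longrightarrow> module.subspace s (W i)"
    and span: "\<And>x. x \<in> module.span s (\<Union>i\<in>I. W i)"
    and indep: "\<And>S c. finite S \<Longrightarrow> S \<subseteq> I \<Longrightarrow> (\<And>i. i \<in> S \<Longrightarrow> c i \<in> W i) \<Longrightarrow>
      (\<Sum>i\<in>S. c i) = 0 \<Longrightarrow> (\<And>i. i \<in> S \<Longrightarrow> c i = 0)"
  shows "internal_direct_sum I W"
proof -
  interpret vector_space s by fact
  define dec where "dec x c \<longleftrightarrow> finite {i. c i \<noteq> 0} \<and> (\<forall>i. i \<notin> I \<longrightarrow> c i = 0) \<and>
      (\<forall>i\<in>I. c i \<in> W i) \<and> x = (\<Sum>i\<in>{i. c i \<noteq> 0}. c i)" for x c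
  have dec_sum: "x = (\<Sum>i\<in>S. c i)" if "dec x c" "finite S" "{i. c i \<noteq> 0} \<subseteq> S" for x c S
    using that unfolding dec_def by (auto intro!: sum.mono_neutral_left)
  have decI: "dec (\<Sum>i\<in>S. c i) c"
    if "finite S" "\<And>i. i \<notin> I \<Longrightarrow> c i = 0" "\<And>i. i \<in> I \<Longrightarrow> c i \<in> W i" "{i. c i \<noteq> 0} \<subseteq> S" for c S
    using that finite_subset[OF that(4,1)] unfolding dec_def
    by (auto intro!: sum.mono_neutral_right)
  have "\<exists>c. dec x c" for x
    using span[of x]
  proof (induction rule: span_induct_alt)
    case base
    have "dec 0 (\<lambda>_. 0)" using sub subspace_0 by (auto simp: dec_def)
    then show ?case by (rule exI[of _ "\<lambda>_. 0"])
  next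
    case (step k x y)
    then obtain i c where i: "i \<in> I" "x \<in> W i" and c: "dec y c" by blast
    define c' where "c' = c(i := s k x + c i)"
    have fin: "finite (insert i {j. c j \<noteq> 0})" (is "finite ?S") using c by (simp add: dec_def)
    have "y = (\<Sum>j\<in>?S. c j)" using dec_sum[OF c fin] by auto
    also have "\<dots> = c i + (\<Sum>j\<in>?S - {i}. c j)" using fin by (subst sum.remove[of _ i]) auto
    finally have y: "y = c i + (\<Sum>j\<in>?S - {i}. c j)" .
    have "(\<Sum>j\<in>?S. c' j) = c' i + (\<Sum>j\<in>?S - {i}. c' j)"
      using fin by (subst sum.remove[of _ i]) auto
    also have "\<dots> = s k x + y" unfolding y by (simp add: c'_def add.assoc)
    finally have sum: "(\<Sum>j\<in>?S. c' j) = s k x + y" .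
    have "c' j \<in> W j" if "j \<in> I" for j
      using that c i sub[OF i(1)] by (auto simp: c'_def dec_def intro: subspace_add subspace_scale)
    moreover have "c' j = 0" if "j \<notin> I" for j using that c i by (auto simp: c'_def dec_def)
    moreover have "{j. c' j \<noteq> 0} \<subseteq> ?S" by (auto simp: c'_def)
    ultimately have "dec (s k x + y) c'"
      using decI[OF fin, of c'] unfolding sum by simp
    then show ?case by (rule exI[of _ c'])
  qed
  moreover have "c = c'" if "dec x c" "dec x c'" for x c c'
  proof
    fix i
    let ?S = "{i. c i \<noteq> 0} \<union> {i. c' i \<noteq> 0}"
    have fin: "finite ?S" using that by (simp add: dec_def)
    have "?S \<subseteq> I" using that by (auto simp: dec_def)
    moreover have "(\<Sum>i\<in>?S. c i - c' i) = 0"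
      using dec_sum[OF that(1) fin] dec_sum[OF that(2) fin] by (simp add: sum_subtractf)
    moreover have "c j - c' j \<in> W j" if "j \<in> ?S" for j
      using that \<open>dec x c\<close> \<open>dec x c'\<close> sub[of j] by (auto simp: dec_def intro!: subspace_diff)
    ultimately have "c i - c' i = 0" if "i \<in> ?S"
      using indep[OF fin, of "\<lambda>i. c i - c' i" i] that by blast
    then show "c i = c' i" by (cases "i \<in> ?S") auto
  qed
  ultimately have "\<forall>x. \<exists>!c. dec x c" by blast
  then show ?thesis unfolding internal_direct_sum_def dec_def .
qed

lemma internal_direct_sum_decomposition:
  assumes "internal_direct_sum I W"
  shows "\<exists>S c. finite S \<and> S \<subseteq> I \<and> (\<forall>i\<in>S. c i \<in> W i) \<and> x = (\<Sum>i\<in>S. c i)"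
proof -
  obtain c where c: "finite {i. c i \<noteq> 0}" "\<forall>i. i \<notin> I \<longrightarrow> c i = 0" "\<forall>i\<in>I. c i \<in> W i"
      "x = (\<Sum>i\<in>{i. c i \<noteq> 0}. c i)"
    using assms unfolding internal_direct_sum_def by meson
  then show ?thesis by (intro exI[of _ "{i. c i \<noteq> 0}"] exI[of _ c]) auto
qed

lemma internal_direct_sum_in_span:
  assumes "vector_space s" "internal_direct_sum I W"
  shows "x \<in> module.span s (\<Union>i\<in>I. W i)"
proof -
  interpret vector_space s by fact
  obtain S c where S: "finite S" "S \<subseteq> I" "\<And>i. i \<in> S \<Longrightarrow> c i \<in> W i" and x: "x = (\<Sum>i\<in>S. c i)"
    using internal_direct_sum_decomposition[OF assms(2), of x] by blast
  show ?thesis unfolding x using S by (intro span_sum span_base) auto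
qed

text \<open>The family \<open>c\<close>, extended by zero, and the zero family both decompose 0, so
  uniqueness identifies them.\<close>

lemma internal_direct_sum_independent:
  assumes ids: "internal_direct_sum I W" and zero: "\<And>i. i \<in> I \<Longrightarrow> 0 \<in> W i"
    and S: "finite S" "S \<subseteq> I" "\<And>i. i \<in> S \<Longrightarrow> c i \<in> W i" "(\<Sum>i\<in>S. c i) = 0" and i: "i \<in> S"
  shows "c i = 0"
proof -
  define c' where "c' i = (if i \<in> S then c i else 0)" for i
  have sub: "{i. c' i \<noteq> 0} \<subseteq> S" by (auto simp: c'_def)
  define P where "P d \<longleftrightarrow> finite {i. d i \<noteq> 0} \<and> (\<forall>i. i \<notin> I \<longrightarrow> d i = 0) \<and> (\<forall>i\<in>I. d i \<in> W i) \<and>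
      0 = (\<Sum>i\<in>{i. d i \<noteq> 0}. d i)" for d
  have "(\<Sum>i\<in>{i. c' i \<noteq> 0}. c' i) = (\<Sum>i\<in>S. c' i)"
    using S(1) sub by (intro sum.mono_neutral_left) auto
  also have "\<dots> = 0" using S by (simp add: c'_def)
  finally have "P c'"
    using S zero finite_subset[OF sub] by (auto simp: c'_def P_def)
  have "P (\<lambda>_. 0)" using zero by (simp add: P_def)
  have "\<exists>!d. P d" using ids unfolding internal_direct_sum_def P_def by (rule spec)
  then obtain d where d: "\<And>e. P e \<Longrightarrow> e = d" by (rule ex1E) (rule that, simp)
  have "c' = (\<lambda>_. 0)"
    unfolding d[OF \<open>P c'\<close>] d[OF \<open>P (\<lambda>_. 0)\<close>] by (rule refl)
  then show ?thesis using i by (metis c'_def)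
qed

lemma span_hom:
  assumes s1: "vector_space s1" and s2: "vector_space s2"
    and add: "\<And>x y. f (x + y) = f x + f y" and scale: "\<And>c x. f (s1 c x) = s2 c (f x)"
    and X: "\<And>x. x \<in> X \<Longrightarrow> f x \<in> module.span s2 Y" and x: "x \<in> module.span s1 X"
  shows "f x \<in> module.span s2 Y"
proof -
  interpret v1: vector_space s1 by (rule s1)
  interpret v2: vector_space s2 by (rule s2)
  have "f 0 = 0" using add[of 0 0] by simp
  from x show ?thesis
    by (induction rule: v1.span_induct_alt)
      (simp_all add: \<open>f 0 = 0\<close> add scale X v2.span_zero v2.span_add v2.span_scale)
qed

lemma bilinear_mapI:
  assumes "vector_space s1" "vector_space s2" "vector_space s3"
    and "\<And>x x' y. f (x + x') y = f x y + f x' y" "\<And>x y y'. f x (y + y') = f x y + f x y'"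
    and "\<And>c x y. f (s1 c x) y = s3 c (f x y)" "\<And>c x y. f x (s2 c y) = s3 c (f x y)"
  shows "bilinear_map s1 s2 s3 f"
  using assms
  by (simp add: bilinear_map_def Vector_Spaces.linear_def module_hom_def module_hom_axioms_def
      module_iff_vector_space)

lemma add_order_0: "add_order 0 = 1"
  unfolding add_order_def by (rule Least_equality) auto

text \<open>The order of 0 is 1, hence the sign is -1: elements of degree 0 anticommute with all
  homogeneous elements, while the form, with its additional minus sign, is symmetric on
  them.\<close>

lemma bsign_0 [simp]: "bsign 0 c = - 1" "bsign c 0 = - 1"
  by (simp_all add: bsign_def add_order_0)

text \<open>The common base of \<open>A\<close> and of the three algebras built from it, so that the
  facts on root spaces are proved once and reach the others through
  \<open>sublocale\<close>.\<close>

locale bilinear_algebra =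
  fixes A :: "('f::field_char_0, 'b::{finite,idom}, 'a::ab_group_add) qalg"
  assumes vs: "vector_space (smul A)"
    and bilinear_mul: "bilinear_map (smul A) (smul A) (smul A) (mul A)"
begin

sublocale vector_space "smul A" by (rule vs)

lemmas mul_add_left = bilinear_mapD(1)[OF bilinear_mul]
  and mul_add_right = bilinear_mapD(2)[OF bilinear_mul]
  and mul_scale_left [simp] = bilinear_mapD(3)[OF bilinear_mul]
  and mul_scale_right [simp] = bilinear_mapD(4)[OF bilinear_mul]
  and mul_zero [simp] = bilinear_mapD(5,6)[OF bilinear_mul]

lemma mul_sum_right: "mul A x (\<Sum>i\<in>S. f i) = (\<Sum>i\<in>S. mul A x (f i))"
  by (induction S rule: infinite_finite_induct) (simp_all add: mul_add_right)

lemma mul_sum_left: "mul A (\<Sum>i\<in>S. f i) x = (\<Sum>i\<in>S. mul A (f i) x)"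
  by (induction S rule: infinite_finite_induct) (simp_all add: mul_add_left)

lemma subspace_root_space: "subspace (root_space A H \<alpha>)"
  by (auto simp: subspace_def root_space_def mul_add_right scale_right_distrib mult.commute)

text \<open>The eigenvector argument: applying \<open>h - \<beta> h\<close> to a vanishing sum
  removes the component at \<open>\<beta>\<close> and multiplies the one at \<open>\<gamma>\<close>
  by \<open>\<gamma> h - \<beta> h\<close>. Distinct functionals are separated by an element of
  \<open>H\<close>, since members of \<open>dual_of\<close> vanish elsewhere.\<close>

lemma root_spaces_independent:
  assumes "finite S" "S \<subseteq> dual_of A H" "\<And>\<alpha>. \<alpha> \<in> S \<Longrightarrow> c \<alpha> \<in> root_space A H \<alpha>"
    and "(\<Sum>\<alpha>\<in>S. c \<alpha>) = 0" "\<alpha> \<in> S"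
  shows "c \<alpha> = 0"
proof -
  have "\<forall>\<alpha>\<in>S. c \<alpha> = 0"
    using assms(1-4)
  proof (induction S arbitrary: c rule: finite_induct)
    case empty
    then show ?case by simp
  next
    case (insert \<beta> S)
    have zero: "c \<alpha> = 0" if \<alpha>: "\<alpha> \<in> S" for \<alpha>
    proof -
      have "\<alpha> \<noteq> \<beta>" using \<alpha> insert.hyps by blast
      then obtain h where h: "\<alpha> h \<noteq> \<beta> h" by blast
      have hH: "h \<in> H"
      proof (rule ccontr)
        assume "h \<notin> H"
        then have "\<alpha> h = 0" "\<beta> h = 0" using insert.prems(1) \<alpha> by (auto simp: dual_of_def)
        then show False using h by simp
      qed
      have act: "mul A h (c \<gamma>) = smul A (\<gamma> h) (c \<gamma>)" if "\<gamma> \<in> insert \<beta> S" for \<gamma>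
        using insert.prems(2)[OF that] hH by (simp add: root_space_def)
      let ?c = "\<lambda>\<gamma>. smul A (\<gamma> h - \<beta> h) (c \<gamma>)"
      have "0 = mul A h (\<Sum>\<gamma>\<in>insert \<beta> S. c \<gamma>) - smul A (\<beta> h) (\<Sum>\<gamma>\<in>insert \<beta> S. c \<gamma>)"
        using insert.prems(3) by simp
      also have "\<dots> = (\<Sum>\<gamma>\<in>insert \<beta> S. ?c \<gamma>)"
        by (simp only: mul_sum_right scale_sum_right act scale_left_diff_distrib sum_subtractf
            cong: sum.cong)
      also have "\<dots> = (\<Sum>\<gamma>\<in>S. ?c \<gamma>)" using insert.hyps by simp
      finally have "(\<Sum>\<gamma>\<in>S. ?c \<gamma>) = 0" by simp
      moreover have "?c \<gamma> \<in> root_space A H \<gamma>" if "\<gamma> \<in> S" for \<gamma>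
        using insert.prems(2) that subspace_root_space subspace_scale by blast
      ultimately have "?c \<alpha> = 0" using insert.IH[of ?c] insert.prems(1) \<alpha> by blast
      then show ?thesis using h by simp
    qed
    then show ?case using insert.prems(3) insert.hyps by simp
  qed
  then show ?thesis using assms by blast
qed

lemma toral_pairI:
  assumes "\<And>b. subspace (grade A b)"
    and "\<And>x. x \<in> span (\<Union>b. grade A b)"
    and "\<And>S c. (\<And>b. b \<in> S \<Longrightarrow> c b \<in> grade A b) \<Longrightarrow>
      (\<Sum>b\<in>S. c b) = 0 \<Longrightarrow> (\<And>b. b \<in> S \<Longrightarrow> c b = 0)"
    and "\<And>b c x y. x \<in> grade A b \<Longrightarrow> y \<in> grade A c \<Longrightarrow> mul A x y \<in> grade A (b + c)"
    and "b_commutative A" "subalgebra A H" "H \<subseteq> grade A 0" "H \<noteq> {0}"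
    and "\<And>x. x \<in> span (\<Union>\<alpha>\<in>dual_of A H. root_space A H \<alpha>)"
    and "\<And>x y. x \<in> root_space A H (\<lambda>_. 0) \<Longrightarrow> y \<in> root_space A H (\<lambda>_. 0) \<Longrightarrow>
      mul A x y \<in> root_space A H (\<lambda>_. 0)"
  shows "toral_pair A H"
proof -
  have "internal_direct_sum UNIV (grade A)"
  proof (rule internal_direct_sumI[OF vs])
    show "c b = 0" if "\<And>b. b \<in> S \<Longrightarrow> c b \<in> grade A b" "(\<Sum>b\<in>S. c b) = 0" "b \<in> S" for S c b
      using assms(3)[of S c b] that by blast
  qed (use assms(1,2) in auto)
  moreover have "internal_direct_sum (dual_of A H) (root_space A H)"
  proof (rule internal_direct_sumI[OF vs])
    show "c \<alpha> = 0" if "finite S" "S \<subseteq> dual_of A H"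
      "\<And>\<alpha>. \<alpha> \<in> S \<Longrightarrow> c \<alpha> \<in> root_space A H \<alpha>" "(\<Sum>\<alpha>\<in>S. c \<alpha>) = 0" "\<alpha> \<in> S" for S c \<alpha>
      using that by (rule root_spaces_independent)
  qed (use subspace_root_space assms(9) in auto)
  ultimately show ?thesis
    by (simp add: toral_pair_def graded_algebra_def vs bilinear_mul assms(1,4-8,10))
qed

end

section \<open>Consequences of the axioms of a quadratic toral pair\<close>

lemma dual_of_zero: "(\<lambda>_. 0) \<in> dual_of A H"
  by (simp add: dual_of_def)

locale quadratic_pair =
  fixes A :: "('f::field_char_0, 'b::{finite,idom}, 'a::ab_group_add) qalg" and H :: "'a set"
  assumes quadratic: "quadratic_toral_pair A H"
begin

sublocale bilinear_algebra A
  using quadratic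
  by (simp add: bilinear_algebra_def quadratic_toral_pair_def toral_pair_def graded_algebra_def)

lemma bilinear_form: "bilinear_map (smul A) (smul A) (*) (form A)"
  using quadratic by (simp add: quadratic_toral_pair_def)

lemmas form_add_left = bilinear_mapD(1)[OF bilinear_form]
  and form_add_right = bilinear_mapD(2)[OF bilinear_form]
  and form_scale_left [simp] = bilinear_mapD(3)[OF bilinear_form]
  and form_scale_right [simp] = bilinear_mapD(4)[OF bilinear_form]
  and form_zero [simp] = bilinear_mapD(5,6)[OF bilinear_form]

lemma form_sum_right: "form A x (\<Sum>i\<in>S. f i) = (\<Sum>i\<in>S. form A x (f i))"
  by (induction S rule: infinite_finite_induct) (simp_all add: form_add_right)

lemma form_sum_left: "form A (\<Sum>i\<in>S. f i) x = (\<Sum>i\<in>S. form A (f i) x)"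
  by (induction S rule: infinite_finite_induct) (simp_all add: form_add_left)

lemma form_invariant: "form A (mul A x y) z = form A x (mul A y z)"
  using quadratic by (simp add: quadratic_toral_pair_def invariant_form_def)

lemma form_symmetric:
  "x \<in> grade A b \<Longrightarrow> y \<in> grade A c \<Longrightarrow> form A x y = - bsign b c * form A y x"
  using quadratic unfolding quadratic_toral_pair_def b_symmetric_form_def by blast

lemma form_graded:
  "x \<in> grade A b \<Longrightarrow> y \<in> grade A c \<Longrightarrow> b + c \<noteq> 0 \<Longrightarrow> form A x y = 0"
  using quadratic unfolding quadratic_toral_pair_def b_graded_form_def by blast

lemma mul_commutative:
  "x \<in> grade A b \<Longrightarrow> y \<in> grade A c \<Longrightarrow> mul A x y = smul A (bsign b c) (mul A y x)"
  using quadratic unfolding quadratic_toral_pair_def toral_pair_def b_commutative_def by blast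

lemma mul_graded:
  "x \<in> grade A b \<Longrightarrow> y \<in> grade A c \<Longrightarrow> mul A x y \<in> grade A (b + c)"
  using quadratic unfolding quadratic_toral_pair_def toral_pair_def graded_algebra_def by blast

lemma subspace_grade: "subspace (grade A b)"
  using quadratic unfolding quadratic_toral_pair_def toral_pair_def graded_algebra_def by blast

lemma grading: "internal_direct_sum UNIV (grade A)"
  using quadratic unfolding quadratic_toral_pair_def toral_pair_def graded_algebra_def by blast

lemma grade_independent:
  assumes "\<And>b. b \<in> S \<Longrightarrow> c b \<in> grade A b" "(\<Sum>b\<in>S. c b) = 0" "b \<in> S"
  shows "c b = 0"
  using internal_direct_sum_independent[OF grading _ _ _ assms] subspace_0[OF subspace_grade]
  by simp

lemma root_decomposition: "internal_direct_sum (dual_of A H) (root_space A H)"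
  using quadratic unfolding quadratic_toral_pair_def toral_pair_def by blast

lemma subspace_H: "subspace H" and mul_H: "h \<in> H \<Longrightarrow> h' \<in> H \<Longrightarrow> mul A h h' \<in> H"
  and H_grade: "h \<in> H \<Longrightarrow> h \<in> grade A 0" and H_nonzero: "H \<noteq> {0}"
  using quadratic unfolding quadratic_toral_pair_def toral_pair_def subalgebra_def by blast+

lemma mul_root_space_0:
  "x \<in> root_space A H (\<lambda>_. 0) \<Longrightarrow> y \<in> root_space A H (\<lambda>_. 0) \<Longrightarrow>
   mul A x y \<in> root_space A H (\<lambda>_. 0)"
  using quadratic unfolding quadratic_toral_pair_def toral_pair_def by blast

lemma root_spaceD: "x \<in> root_space A H \<alpha> \<Longrightarrow> h \<in> H \<Longrightarrow> mul A h x = smul A (\<alpha> h) x"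
  by (simp add: root_space_def)

lemma mul_H_anticommute: "h \<in> H \<Longrightarrow> h' \<in> H \<Longrightarrow> mul A h h' = - mul A h' h"
  using mul_commutative[of h 0 h' 0] H_grade by simp

text \<open>Comparing root components in \<open>hh = 0\<close> and \<open>hh' = - h'h\<close> shows that \<open>H\<close> has zero
  multiplication.\<close>

lemma mul_H_zero:
  assumes h: "h \<in> H" and h': "h' \<in> H"
  shows "mul A h h' = 0"
proof -
  obtain S c where S: "finite S" "S \<subseteq> dual_of A H" "\<And>\<alpha>. \<alpha> \<in> S \<Longrightarrow> c \<alpha> \<in> root_space A H \<alpha>"
      and h_eq: "h = (\<Sum>\<alpha>\<in>S. c \<alpha>)"
    using internal_direct_sum_decomposition[OF root_decomposition, of h]
    by (elim exE conjE) (rule that, auto)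
  obtain S' c' where S': "finite S'" "S' \<subseteq> dual_of A H"
      "\<And>\<alpha>. \<alpha> \<in> S' \<Longrightarrow> c' \<alpha> \<in> root_space A H \<alpha>" and h'_eq: "h' = (\<Sum>\<alpha>\<in>S'. c' \<alpha>)"
    using internal_direct_sum_decomposition[OF root_decomposition, of h']
    by (elim exE conjE) (rule that, auto)
  define T where "T = S \<union> S'"
  define d where "d \<alpha> = (if \<alpha> \<in> S then c \<alpha> else 0)" for \<alpha>
  define d' where "d' \<alpha> = (if \<alpha> \<in> S' then c' \<alpha> else 0)" for \<alpha>
  have T: "finite T" "T \<subseteq> dual_of A H" using S S' by (auto simp: T_def)
  have d: "d \<alpha> \<in> root_space A H \<alpha>" "d' \<alpha> \<in> root_space A H \<alpha>" for \<alpha>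
    using S(3) S'(3) subspace_0[OF subspace_root_space] by (auto simp: d_def d'_def)
  have "(\<Sum>\<alpha>\<in>T. d \<alpha>) = (\<Sum>\<alpha>\<in>S. d \<alpha>)" "(\<Sum>\<alpha>\<in>T. d' \<alpha>) = (\<Sum>\<alpha>\<in>S'. d' \<alpha>)"
    using T unfolding T_def by (intro sum.mono_neutral_right; auto simp: d_def d'_def)+
  then have h_sum: "h = (\<Sum>\<alpha>\<in>T. d \<alpha>)" and h'_sum: "h' = (\<Sum>\<alpha>\<in>T. d' \<alpha>)"
    by (simp_all add: h_eq h'_eq d_def d'_def)
  have expand: "mul A k h = (\<Sum>\<alpha>\<in>T. smul A (\<alpha> k) (d \<alpha>))"
      "mul A k h' = (\<Sum>\<alpha>\<in>T. smul A (\<alpha> k) (d' \<alpha>))" if "k \<in> H" for k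
    using root_spaceD[OF d(1) that] root_spaceD[OF d(2) that]
    by (simp_all add: h_sum h'_sum mul_sum_right)
  have sq: "mul A k k = 0" if "k \<in> H" for k
  proof -
    have "smul A 2 (mul A k k) = mul A k k + mul A k k"
      using scale_left_distrib[of 1 1] by simp
    also have "\<dots> = 0" using mul_H_anticommute[OF that that] by (metis add.left_inverse)
    finally show ?thesis by simp
  qed
  have zero_h: "smul A (\<alpha> h) (d \<alpha>) = 0" if "\<alpha> \<in> T" for \<alpha>
    using root_spaces_independent[OF T, of "\<lambda>\<alpha>. smul A (\<alpha> h) (d \<alpha>)"] sq[OF h] expand(1)[OF h]
      subspace_scale[OF subspace_root_space d(1)] that by auto
  have "smul A (\<alpha> h) (d' \<alpha>) + smul A (\<alpha> h') (d \<alpha>) = 0" if "\<alpha> \<in> T" for \<alpha>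
  proof (rule root_spaces_independent[OF T,
        where c = "\<lambda>\<alpha>. smul A (\<alpha> h) (d' \<alpha>) + smul A (\<alpha> h') (d \<alpha>)"])
    show "(\<Sum>\<alpha>\<in>T. smul A (\<alpha> h) (d' \<alpha>) + smul A (\<alpha> h') (d \<alpha>)) = 0"
      using mul_H_anticommute[OF h h'] expand(2)[OF h] expand(1)[OF h'] by (simp add: sum.distrib)
  qed (use that d subspace_scale[OF subspace_root_space] subspace_add[OF subspace_root_space]
      in auto)
  \<comment> \<open>If \<open>\<alpha> h\<close> is nonzero, \<open>zero_h\<close> gives
    \<open>d \<alpha> = 0\<close>, so the second term of the mixed relation drops out.\<close>
  then have "smul A (\<alpha> h) (d' \<alpha>) = 0" if "\<alpha> \<in> T" for \<alpha>
    using zero_h[OF that] that by (cases "\<alpha> h = 0") fastforce+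
  then show ?thesis unfolding expand(2)[OF h] by (rule sum.neutral[rule_format])
qed

lemma H_root_space_0: "h \<in> H \<Longrightarrow> h \<in> root_space A H (\<lambda>_. 0)"
  by (simp add: root_space_def mul_H_zero)

text \<open>The new summands of the extensions lie in the zero root space, so 0 has to be a root of
  \<open>A\<close> already for the root systems to come out as \<open>R\<close> and
  \<open>R + G\<close>.\<close>

lemma zero_root: "(\<lambda>_. 0) \<in> roots A H"
  using H_nonzero H_root_space_0 subspace_0[OF subspace_H] by (auto simp: roots_def dual_of_zero)

text \<open>\<open>H\<close> has degree 0, so \<open>h - \<alpha> h\<close> preserves each graded
  piece and can annihilate \<open>x\<close> only by annihilating every component of
  \<open>x\<close>.\<close>

lemma root_space_component:
  assumes x: "x \<in> root_space A H \<alpha>" "x = (\<Sum>b\<in>S. c b)" and c: "\<And>b. b \<in> S \<Longrightarrow> c b \<in> grade A b"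
    and b: "b \<in> S"
  shows "c b \<in> root_space A H \<alpha>"
  unfolding root_space_def
proof (safe)
  fix h assume h: "h \<in> H"
  have "(\<Sum>b\<in>S. mul A h (c b) - smul A (\<alpha> h) (c b)) = 0"
    using root_spaceD[OF x(1) h] by (simp add: x(2) mul_sum_right scale_sum_right sum_subtractf)
  moreover have "mul A h (c b) - smul A (\<alpha> h) (c b) \<in> grade A b" if "b \<in> S" for b
    using mul_graded[OF H_grade[OF h] c[OF that]] c[OF that] subspace_grade
    by (simp add: subspace_diff subspace_scale)
  ultimately have "mul A h (c b) - smul A (\<alpha> h) (c b) = 0"
    using grade_independent[of S "\<lambda>b. mul A h (c b) - smul A (\<alpha> h) (c b)" b] b by simp
  then show "mul A h (c b) = smul A (\<alpha> h) (c b)" by simp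
qed

text \<open>Degree \<open>b\<close> is paired nontrivially with degree \<open>- b\<close> only, so
  some component of \<open>y\<close> in that degree already pairs nontrivially with
  \<open>x\<close>, and it stays in the root space of \<open>y\<close>.\<close>

lemma homogeneous_partner:
  assumes x: "x \<in> grade A b" and y: "y \<in> root_space A H \<alpha>" "form A x y \<noteq> 0"
  obtains y' where "y' \<in> root_space A H \<alpha>" "y' \<in> grade A (- b)" "form A x y' \<noteq> 0"
proof -
  obtain S c where "finite S" "S \<subseteq> UNIV" and S: "\<And>b. b \<in> S \<Longrightarrow> c b \<in> grade A b"
    and y_eq: "y = (\<Sum>b\<in>S. c b)"
    using internal_direct_sum_decomposition[OF grading, of y] by (elim exE conjE) (rule that, auto)
  have "(\<Sum>b\<in>S. form A x (c b)) \<noteq> 0" using y(2) by (simp add: y_eq form_sum_right)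
  then obtain b' where b': "b' \<in> S" "form A x (c b') \<noteq> 0" by (meson sum.neutral)
  then have "b + b' = 0" using form_graded[OF x S] by blast
  then have "b' = - b" by (simp add: eq_neg_iff_add_eq_0 add.commute)
  then show ?thesis
    using that[OF root_space_component[OF y(1) y_eq S b'(1)] _ b'(2)] S[OF b'(1)] by simp
qed

text \<open>Non-degeneracy descends from \<open>A^0\<close> to its degree-0 part: a nonzero
  \<open>x\<close> in \<open>H\<close> has a partner in \<open>A^0\<close>, which can be chosen of
  degree 0 and then lies in \<open>H\<close>. The symmetry of the form in degree 0 exchanges the two
  arguments.\<close>

lemma nondegenerate_on_H:
  assumes nd: "nondegenerate_on A (root_space A H (\<lambda>_. 0))"
    and H: "root_space A H (\<lambda>_. 0) \<inter> grade A 0 = H"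
    and x: "x \<in> H" "\<And>h. h \<in> H \<Longrightarrow> form A h x = 0"
  shows "x = 0"
proof (rule ccontr)
  assume "x \<noteq> 0"
  then obtain y where y: "y \<in> root_space A H (\<lambda>_. 0)" "form A x y \<noteq> 0"
    using nd H_root_space_0[OF x(1)] unfolding nondegenerate_on_def by blast
  obtain y' where y': "y' \<in> root_space A H (\<lambda>_. 0)" "y' \<in> grade A (- 0)" "form A x y' \<noteq> 0"
    by (rule homogeneous_partner[OF H_grade[OF x(1)] y])
  then have y'H: "y' \<in> H" using H by auto
  then have "form A x y' = form A y' x"
    using form_symmetric[of x 0 y' 0] H_grade[OF x(1)] H_grade[OF y'H] by simp
  then show False using x(2)[OF y'H] y'(3) by simp
qed

end

section \<open>Products and forms on the loop space\<close>

lemma poly_mapping_eq_sum_single: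
  "p = (\<Sum>\<sigma>\<in>Poly_Mapping.keys p. Poly_Mapping.single \<sigma> (Poly_Mapping.lookup p \<sigma>))"
  by (rule poly_mapping_eqI) (simp add: lookup_sum lookup_single when_def in_keys_iff sum.delta)

text \<open>Reduces identities between multilinear expressions on loops to the elements
  \<open>x \<otimes> t^\<sigma>\<close>, one argument at a time.\<close>

lemma poly_mapping_additive_eqI:
  fixes F G :: "('g \<Rightarrow>\<^sub>0 'a::ab_group_add) \<Rightarrow> 'c::ab_group_add"
  assumes F: "\<And>p q. F (p + q) = F p + F q" and G: "\<And>p q. G (p + q) = G p + G q"
    and single: "\<And>\<sigma> x. F (Poly_Mapping.single \<sigma> x) = G (Poly_Mapping.single \<sigma> x)"
  shows "F p = G p"
proof -
  have F0: "F 0 = 0" using F[of 0 0] by simp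
  have G0: "G 0 = 0" using G[of 0 0] by simp
  have "F (\<Sum>\<sigma>\<in>S. Poly_Mapping.single \<sigma> (f \<sigma>)) = G (\<Sum>\<sigma>\<in>S. Poly_Mapping.single \<sigma> (f \<sigma>))"
    for S and f :: "'g \<Rightarrow> 'a"
    by (induction S rule: infinite_finite_induct) (simp_all add: F G F0 G0 single)
  then show ?thesis using poly_mapping_eq_sum_single[of p] by metis
qed

lemma pm_smul_single:
  assumes "vector_space s"
  shows "pm_smul s c (Poly_Mapping.single \<sigma> x) = Poly_Mapping.single \<sigma> (s c x)"
proof -
  interpret vector_space s by fact
  show ?thesis
    by (rule poly_mapping_eqI) (simp add: lookup_pm_smul[OF assms] lookup_single when_def)
qed

text \<open>Product, form and cocycle on loops are all double sums over supports of terms biadditive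
  in the coefficients; their bilinearity is proved here once for all three.\<close>

locale biadditive =
  fixes f :: "'g \<Rightarrow> 'g \<Rightarrow> 'a::ab_group_add \<Rightarrow> 'a \<Rightarrow> 'd::ab_group_add"
  assumes add_left: "f \<sigma> \<tau> (x + x') y = f \<sigma> \<tau> x y + f \<sigma> \<tau> x' y"
    and add_right: "f \<sigma> \<tau> x (y + y') = f \<sigma> \<tau> x y + f \<sigma> \<tau> x y'"
begin

definition bisum :: "('g \<Rightarrow>\<^sub>0 'a) \<Rightarrow> ('g \<Rightarrow>\<^sub>0 'a) \<Rightarrow> 'd" where
  "bisum p q = (\<Sum>\<sigma>\<in>Poly_Mapping.keys p. \<Sum>\<tau>\<in>Poly_Mapping.keys q.
     f \<sigma> \<tau> (Poly_Mapping.lookup p \<sigma>) (Poly_Mapping.lookup q \<tau>))"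

lemma zero [simp]: "f \<sigma> \<tau> 0 y = 0" "f \<sigma> \<tau> x 0 = 0"
  using add_left[of \<sigma> \<tau> 0 0 y] add_right[of \<sigma> \<tau> x 0 0] by auto

text \<open>Supports change under addition and scaling, so sums are compared over fixed larger index
  sets, where the additional terms vanish.\<close>

lemma bisum_superset:
  assumes "finite S" "finite T" "Poly_Mapping.keys p \<subseteq> S" "Poly_Mapping.keys q \<subseteq> T"
  shows "bisum p q = (\<Sum>\<sigma>\<in>S. \<Sum>\<tau>\<in>T.
     f \<sigma> \<tau> (Poly_Mapping.lookup p \<sigma>) (Poly_Mapping.lookup q \<tau>))" (is "_ = (\<Sum>\<sigma>\<in>S. \<Sum>\<tau>\<in>T. ?f \<sigma> \<tau>)")
proof -
  have "bisum p q = (\<Sum>\<sigma>\<in>Poly_Mapping.keys p. \<Sum>\<tau>\<in>T. ?f \<sigma> \<tau>)"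
    unfolding bisum_def using assms
    by (intro sum.cong sum.mono_neutral_left) (auto simp: in_keys_iff)
  also have "\<dots> = (\<Sum>\<sigma>\<in>S. \<Sum>\<tau>\<in>T. ?f \<sigma> \<tau>)"
    using assms by (intro sum.mono_neutral_left) (auto simp: in_keys_iff)
  finally show ?thesis .
qed

lemma bisum_add_left: "bisum (p + p') q = bisum p q + bisum p' q"
  using Poly_Mapping.keys_add[of p p']
  by (simp add: bisum_superset[of "Poly_Mapping.keys p \<union> Poly_Mapping.keys p'"
        "Poly_Mapping.keys q"]
      lookup_add add_left sum.distrib)

lemma bisum_add_right: "bisum p (q + q') = bisum p q + bisum p q'"
  using Poly_Mapping.keys_add[of q q']
  by (simp add: bisum_superset[of "Poly_Mapping.keys p"
        "Poly_Mapping.keys q \<union> Poly_Mapping.keys q'"]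
      lookup_add add_right sum.distrib)

lemma bisum_scale:
  assumes s: "vector_space s" and t: "vector_space t"
  shows "(\<And>\<sigma> \<tau> x y. f \<sigma> \<tau> (s c x) y = t c (f \<sigma> \<tau> x y)) \<Longrightarrow> bisum (pm_smul s c p) q = t c (bisum p q)"
    and "(\<And>\<sigma> \<tau> x y. f \<sigma> \<tau> x (s c y) = t c (f \<sigma> \<tau> x y)) \<Longrightarrow> bisum p (pm_smul s c q) = t c (bisum p q)"
proof -
  interpret s: vector_space s by fact
  interpret t: vector_space t by fact
  have keys: "Poly_Mapping.keys (pm_smul s c r) \<subseteq> Poly_Mapping.keys r" for r
    by (auto simp: in_keys_iff lookup_pm_smul[OF s])
  show "bisum (pm_smul s c p) q = t c (bisum p q)"
    if "\<And>\<sigma> \<tau> x y. f \<sigma> \<tau> (s c x) y = t c (f \<sigma> \<tau> x y)"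
    using keys[of p]
    by (simp add: bisum_superset[of "Poly_Mapping.keys p" "Poly_Mapping.keys q"]
        lookup_pm_smul[OF s] that t.scale_sum_right)
  show "bisum p (pm_smul s c q) = t c (bisum p q)"
    if "\<And>\<sigma> \<tau> x y. f \<sigma> \<tau> x (s c y) = t c (f \<sigma> \<tau> x y)"
    using keys[of q]
    by (simp add: bisum_superset[of "Poly_Mapping.keys p" "Poly_Mapping.keys q"]
        lookup_pm_smul[OF s] that t.scale_sum_right)
qed

end

section \<open>The space V and its dual\<close>

lemma gembed_0 [simp]: "gembed 0 = 0"
  using gembed_add[of 0 0] by simp

lemma gembed_minus: "gembed (- \<sigma>) = - gembed \<sigma>"
  using gembed_add[of \<sigma> "- \<sigma>"] by (simp add: eq_neg_iff_add_eq_0 add.commute)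

lemma dapp_linear:
  "dapp d (x + y) = dapp d x + dapp d y" "dapp d (vscale c x) = c * dapp d x"
  using dapp[of d] by (auto simp: linear_vscale_iff)

lemma dapp_zero [simp]: "dapp d 0 = 0" "dapp 0 x = 0"
  using dapp_linear(2)[of d 0 0] by (auto simp: zero_gdual.rep_eq)

lemma dapp_minus: "dapp d (- x) = - dapp d x"
  using dapp_linear(1)[of d x "- x"] by (simp add: eq_neg_iff_add_eq_0 add.commute)

lemma gdual_eqI: "(\<And>x. dapp d x = dapp e x) \<Longrightarrow> d = e"
  by (simp add: dapp_inject[symmetric] fun_eq_iff)

text \<open>The vector \<open>v\<close> is extended to a basis, so the argument also covers
  infinite-dimensional \<open>V\<close>.\<close>

lemma gdual_separates:
  fixes v :: "('g::ab_group_add, 'f::field) gtensor"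
  assumes "v \<noteq> 0"
  obtains d :: "('g, 'f) gdual" where "dapp d v \<noteq> 0"
proof -
  interpret vsp: vector_space_pair vscale "(*) :: 'f \<Rightarrow> 'f \<Rightarrow> 'f"
    using vector_space_field vscale.vector_space_axioms by (simp add: vector_space_pair_def)
  have "vscale.independent {v}" using assms by simp
  then obtain g where g: "Vector_Spaces.linear vscale (*) g" "g v = 1"
    using vsp.linear_independent_extend[of "{v}" "\<lambda>_. 1"] by auto
  then show ?thesis using that[of "Abs_gdual g"] by (simp add: Abs_gdual_inverse)
qed

lemma vector_space_dscale: "vector_space (dscale :: 'f::field \<Rightarrow> ('g::ab_group_add, 'f) gdual \<Rightarrow> _)"
  by unfold_locales (transfer, simp add: fun_eq_iff algebra_simps)+

interpretation dscale: vector_space "dscale :: 'f::field \<Rightarrow> ('g::ab_group_add, 'f) gdual \<Rightarrow> _"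
  by (rule vector_space_dscale)

section \<open>Bilinearity, signs and invariance on the loop space\<close>

locale loop_construction = quadratic_pair A H + normalized_cocycle lam
  for A :: "('f::field_char_0, 'b::{finite,idom}, 'a::ab_group_add) qalg" and H :: "'a set"
    and lam :: "'g::ab_group_add \<Rightarrow> 'g \<Rightarrow> 'f"
begin

abbreviation coef :: "('g \<Rightarrow>\<^sub>0 'a) \<Rightarrow> 'g \<Rightarrow> 'a" where
  "coef \<equiv> Poly_Mapping.lookup"

abbreviation pure :: "'g \<Rightarrow> 'a \<Rightarrow> ('g \<Rightarrow>\<^sub>0 'a)" where
  "pure \<equiv> Poly_Mapping.single"

abbreviation lscale :: "'f \<Rightarrow> ('g \<Rightarrow>\<^sub>0 'a) \<Rightarrow> ('g \<Rightarrow>\<^sub>0 'a)" where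
  "lscale \<equiv> pm_smul (smul A)"

sublocale L: vector_space lscale
  by (rule vector_space_pm_smul[OF vs])

lemmas coef_lscale [simp] = lookup_pm_smul[OF vs]
  and lscale_pure [simp] = pm_smul_single[OF vs]

sublocale Lmul: biadditive "\<lambda>\<sigma> \<tau> x y. pure (\<sigma> + \<tau>) (smul A (lam \<sigma> \<tau>) (mul A x y))"
  rewrites "Lmul.bisum = loop_mul A lam"
proof -
  show *: "biadditive (\<lambda>\<sigma> \<tau> x y. pure (\<sigma> + \<tau>) (smul A (lam \<sigma> \<tau>) (mul A x y)))"
    by unfold_locales (simp_all add: mul_add_left mul_add_right scale_right_distrib single_add)
  show "biadditive.bisum (\<lambda>\<sigma> \<tau> x y. pure (\<sigma> + \<tau>) (smul A (lam \<sigma> \<tau>) (mul A x y))) = loop_mul A lam"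
    by (intro ext) (simp add: biadditive.bisum_def[OF *] loop_mul_def)
qed

sublocale Lform: biadditive "\<lambda>\<sigma> \<tau> x y. if \<sigma> = - \<tau> then form A x y * lam \<sigma> \<tau> else 0"
  rewrites "Lform.bisum = loop_form A lam"
proof -
  show *: "biadditive (\<lambda>\<sigma> \<tau> x y. if \<sigma> = - \<tau> then form A x y * lam \<sigma> \<tau> else 0)"
    by unfold_locales (simp_all add: form_add_left form_add_right distrib_right)
  show "biadditive.bisum (\<lambda>\<sigma> \<tau> x y. if \<sigma> = - \<tau> then form A x y * lam \<sigma> \<tau> else 0) = loop_form A lam"
    by (intro ext) (simp add: biadditive.bisum_def[OF *] loop_form_def)
qed

sublocale Lco: biadditive
    "\<lambda>\<sigma> \<tau> x y. if \<sigma> = - \<tau> then vscale (lam \<sigma> \<tau> * form A x y) (gembed \<sigma>) else 0"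
  rewrites "Lco.bisum = loop_cocycle A lam"
proof -
  show *: "biadditive
    (\<lambda>\<sigma> \<tau> x y. if \<sigma> = - \<tau> then vscale (lam \<sigma> \<tau> * form A x y) (gembed \<sigma>) else 0)"
    by unfold_locales
      (simp_all add: form_add_left form_add_right distrib_left vscale.scale_left_distrib)
  show "biadditive.bisum
    (\<lambda>\<sigma> \<tau> x y. if \<sigma> = - \<tau> then vscale (lam \<sigma> \<tau> * form A x y) (gembed \<sigma>) else 0) =
    loop_cocycle A lam"
    by (intro ext) (simp add: biadditive.bisum_def[OF *] loop_cocycle_def)
qed

lemma bilinear_loop_mul: "bilinear_map lscale lscale lscale (loop_mul A lam)"
  by (intro bilinear_mapI L.vector_space_axioms Lmul.bisum_add_left Lmul.bisum_add_right
      Lmul.bisum_scale vs) (simp_all add: mult.commute)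

lemma bilinear_loop_form: "bilinear_map lscale lscale (*) (loop_form A lam)"
  by (intro bilinear_mapI L.vector_space_axioms vector_space_field Lform.bisum_add_left
      Lform.bisum_add_right Lform.bisum_scale vs) simp_all

lemma bilinear_loop_cocycle: "bilinear_map lscale lscale vscale (loop_cocycle A lam)"
  by (intro bilinear_mapI L.vector_space_axioms vscale.vector_space_axioms Lco.bisum_add_left
      Lco.bisum_add_right Lco.bisum_scale vs) (simp_all add: mult_ac)

lemmas loop_bilinear_simps [simp] =
  bilinear_mapD[OF bilinear_loop_mul] bilinear_mapD[OF bilinear_loop_form]
  bilinear_mapD[OF bilinear_loop_cocycle]

lemmas loop_single_simps [simp] = loop_mul_single[OF vs bilinear_mul]
  loop_form_single[OF vs bilinear_mul bilinear_form]
  loop_cocycle_single[OF vs bilinear_mul bilinear_form]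
  degree_act_single[OF vs bilinear_mul]

lemma coef_degree_act [simp]: "coef (degree_act A d p) \<sigma> = smul A (dapp d (gembed \<sigma>)) (coef p \<sigma>)"
  by (simp add: degree_act_def lookup_sum lookup_single when_def in_keys_iff sum.delta)

lemma degree_act_linear [simp]:
  "degree_act A (d + e) p = degree_act A d p + degree_act A e p"
  "degree_act A d (p + q) = degree_act A d p + degree_act A d q"
  "degree_act A (dscale c d) p = lscale c (degree_act A d p)"
  "degree_act A d (lscale c p) = lscale c (degree_act A d p)"
  "degree_act A 0 p = 0" "degree_act A d 0 = 0"
  by (rule poly_mapping_eqI; simp add: lookup_add plus_gdual.rep_eq dscale.rep_eq
      scale_left_distrib scale_right_distrib mult.commute)+

text \<open>Since \<open>lam 0 \<sigma> = 1\<close>, the element \<open>h \<otimes> 1\<close> acts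
  on each coefficient as \<open>h\<close> acts on \<open>A\<close>. This is what makes the root
  spaces of the extensions computable coefficientwise.\<close>

lemma coef_loop_mul_pure_0 [simp]: "coef (loop_mul A lam (pure 0 h) p) \<sigma> = mul A h (coef p \<sigma>)"
  by (rule poly_mapping_additive_eqI[where p = p])
    (simp_all add: lookup_add mul_add_right lookup_single when_def)

text \<open>Only degree 0 of \<open>p\<close> could contribute, and its central term is a multiple
  of \<open>gembed 0 = 0\<close>.\<close>

lemma loop_cocycle_pure_0 [simp]: "loop_cocycle A lam (pure 0 h) p = 0"
  by (rule poly_mapping_additive_eqI[where p = p]) simp_all

lemma coef_loop_mul_mem:
  assumes "subspace W" "\<And>\<sigma> \<tau>. mul A (coef p \<sigma>) (coef q \<tau>) \<in> W"
  shows "coef (loop_mul A lam p q) \<rho> \<in> W"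
  unfolding loop_mul_def lookup_sum lookup_single when_def
  using assms by (auto intro!: subspace_sum subspace_scale subspace_0)

lemma loop_mul_commutative:
  assumes "p \<in> loop_grade A b" "q \<in> loop_grade A c"
  shows "loop_mul A lam p q = lscale (bsign b c) (loop_mul A lam q p)"
proof -
  have "loop_mul A lam p q = (\<Sum>\<tau>\<in>Poly_Mapping.keys q. \<Sum>\<sigma>\<in>Poly_Mapping.keys p.
      pure (\<sigma> + \<tau>) (smul A (lam \<sigma> \<tau>) (mul A (coef p \<sigma>) (coef q \<tau>))))"
    unfolding loop_mul_def by (rule sum.swap)
  also have "\<dots> = (\<Sum>\<tau>\<in>Poly_Mapping.keys q. \<Sum>\<sigma>\<in>Poly_Mapping.keys p. lscale (bsign b c)
      (pure (\<tau> + \<sigma>) (smul A (lam \<tau> \<sigma>) (mul A (coef q \<tau>) (coef p \<sigma>)))))"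
  proof (intro sum.cong refl)
    fix \<sigma> \<tau>
    have "mul A (coef p \<sigma>) (coef q \<tau>) = smul A (bsign b c) (mul A (coef q \<tau>) (coef p \<sigma>))"
      using assms by (intro mul_commutative) (auto simp: loop_grade_def)
    then show "pure (\<sigma> + \<tau>) (smul A (lam \<sigma> \<tau>) (mul A (coef p \<sigma>) (coef q \<tau>))) =
        lscale (bsign b c) (pure (\<tau> + \<sigma>) (smul A (lam \<tau> \<sigma>) (mul A (coef q \<tau>) (coef p \<sigma>))))"
      by (simp add: add.commute[of \<tau> \<sigma>] lam_sym[of \<tau> \<sigma>] mult.commute)
  qed
  finally show ?thesis by (simp only: loop_mul_def L.scale_sum_right)
qed

lemma loop_form_symmetric:
  assumes "p \<in> loop_grade A b" "q \<in> loop_grade A c"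
  shows "loop_form A lam p q = - bsign b c * loop_form A lam q p"
proof -
  have "loop_form A lam p q = (\<Sum>\<tau>\<in>Poly_Mapping.keys q. \<Sum>\<sigma>\<in>Poly_Mapping.keys p.
      if \<sigma> = - \<tau> then form A (coef p \<sigma>) (coef q \<tau>) * lam \<sigma> \<tau> else 0)"
    unfolding loop_form_def by (rule sum.swap)
  also have "\<dots> = (\<Sum>\<tau>\<in>Poly_Mapping.keys q. \<Sum>\<sigma>\<in>Poly_Mapping.keys p. - bsign b c *
      (if \<tau> = - \<sigma> then form A (coef q \<tau>) (coef p \<sigma>) * lam \<tau> \<sigma> else 0))"
  proof (intro sum.cong refl)
    fix \<sigma> \<tau>
    have "form A (coef p \<sigma>) (coef q \<tau>) = - bsign b c * form A (coef q \<tau>) (coef p \<sigma>)"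
      using assms by (intro form_symmetric) (auto simp: loop_grade_def)
    then show "(if \<sigma> = - \<tau> then form A (coef p \<sigma>) (coef q \<tau>) * lam \<sigma> \<tau> else 0) = - bsign b c *
        (if \<tau> = - \<sigma> then form A (coef q \<tau>) (coef p \<sigma>) * lam \<tau> \<sigma> else 0)"
      using lam_sym[of \<sigma> "- \<sigma>"] by auto
  qed
  finally show ?thesis by (simp only: loop_form_def sum_distrib_left)
qed

text \<open>Exchanging the arguments of the form costs \<open>- bsign b c\<close>, and \<tau> =
  -\<sigma> replaces \<open>gembed \<sigma>\<close> by its negative; the two minus signs cancel,
  which leaves the sign of the product.\<close>

lemma loop_cocycle_commutative:
  assumes "p \<in> loop_grade A b" "q \<in> loop_grade A c"
  shows "loop_cocycle A lam p q = vscale (bsign b c) (loop_cocycle A lam q p)"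
proof -
  have "loop_cocycle A lam p q = (\<Sum>\<tau>\<in>Poly_Mapping.keys q. \<Sum>\<sigma>\<in>Poly_Mapping.keys p.
      if \<sigma> = - \<tau> then vscale (lam \<sigma> \<tau> * form A (coef p \<sigma>) (coef q \<tau>)) (gembed \<sigma>) else 0)"
    unfolding loop_cocycle_def by (rule sum.swap)
  also have "\<dots> = (\<Sum>\<tau>\<in>Poly_Mapping.keys q. \<Sum>\<sigma>\<in>Poly_Mapping.keys p. vscale (bsign b c)
      (if \<tau> = - \<sigma> then vscale (lam \<tau> \<sigma> * form A (coef q \<tau>) (coef p \<sigma>)) (gembed \<tau>) else 0))"
  proof (intro sum.cong refl)
    fix \<sigma> \<tau>
    have "form A (coef p \<sigma>) (coef q \<tau>) = - bsign b c * form A (coef q \<tau>) (coef p \<sigma>)"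
      using assms by (intro form_symmetric) (auto simp: loop_grade_def)
    then show "(if \<sigma> = - \<tau> then vscale (lam \<sigma> \<tau> * form A (coef p \<sigma>) (coef q \<tau>)) (gembed \<sigma>) else 0)
      = vscale (bsign b c)
        (if \<tau> = - \<sigma> then vscale (lam \<tau> \<sigma> * form A (coef q \<tau>) (coef p \<sigma>)) (gembed \<tau>) else 0)"
      using lam_sym[of \<sigma> "- \<sigma>"] by (auto simp: gembed_minus mult_ac)
  qed
  finally show ?thesis by (simp only: loop_cocycle_def vscale.scale_sum_right)
qed

lemma loop_form_graded:
  assumes "p \<in> loop_grade A b" "q \<in> loop_grade A c" "b + c \<noteq> 0"
  shows "loop_form A lam p q = 0" "loop_cocycle A lam p q = 0"
proof -
  have "form A (coef p \<sigma>) (coef q \<tau>) = 0" for \<sigma> \<tau>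
    using assms by (intro form_graded) (auto simp: loop_grade_def)
  then show "loop_form A lam p q = 0" "loop_cocycle A lam p q = 0"
    by (simp_all add: loop_form_def loop_cocycle_def cong: if_cong)
qed

text \<open>On pure elements both sides vanish unless the three degrees in \<open>G\<close> add up
  to 0; then the cocycle identity equates their weights and invariance on \<open>A\<close> does the
  rest.\<close>

lemma loop_form_invariant:
  "loop_form A lam (loop_mul A lam p q) r = loop_form A lam p (loop_mul A lam q r)"
proof (rule poly_mapping_additive_eqI[where p = p])
  fix \<sigma> x
  show "loop_form A lam (loop_mul A lam (pure \<sigma> x) q) r =
      loop_form A lam (pure \<sigma> x) (loop_mul A lam q r)"
  proof (rule poly_mapping_additive_eqI[where p = q])
    fix \<tau> y
    show "loop_form A lam (loop_mul A lam (pure \<sigma> x) (pure \<tau> y)) r =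
        loop_form A lam (pure \<sigma> x) (loop_mul A lam (pure \<tau> y) r)"
    proof (rule poly_mapping_additive_eqI[where p = r])
      fix \<rho> z
      have "\<sigma> + \<tau> = - \<rho> \<longleftrightarrow> \<sigma> = - (\<tau> + \<rho>)" by (auto simp: algebra_simps eq_neg_iff_add_eq_0)
      then show "loop_form A lam (loop_mul A lam (pure \<sigma> x) (pure \<tau> y)) (pure \<rho> z) =
          loop_form A lam (pure \<sigma> x) (loop_mul A lam (pure \<tau> y) (pure \<rho> z))"
        using lam_assoc[of "- \<tau> - \<rho>" \<tau> \<rho>] by (simp add: form_invariant)
    qed simp_all
  qed simp_all
qed simp_all

text \<open>The central term of the product is chosen to make this hold: it expresses
  \<open>(d p, q) = (d, p q)\<close>, the instance of invariance that links the derivations to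
  \<open>V\<close>.\<close>

lemma loop_form_degree_act:
  "loop_form A lam (degree_act A d p) q = dapp d (loop_cocycle A lam p q)"
  "loop_form A lam p (degree_act A d q) = - dapp d (loop_cocycle A lam p q)"
proof -
  show "loop_form A lam (degree_act A d p) q = dapp d (loop_cocycle A lam p q)"
  proof (rule poly_mapping_additive_eqI[where p = p])
    fix \<sigma> x
    show "loop_form A lam (degree_act A d (pure \<sigma> x)) q = dapp d (loop_cocycle A lam (pure \<sigma> x) q)"
      by (rule poly_mapping_additive_eqI[where p = q]) (simp_all add: dapp_linear)
  qed (simp_all add: dapp_linear)
  show "loop_form A lam p (degree_act A d q) = - dapp d (loop_cocycle A lam p q)"
  proof (rule poly_mapping_additive_eqI[where p = p])
    fix \<sigma> x
    show "loop_form A lam (pure \<sigma> x) (degree_act A d q) =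
        - dapp d (loop_cocycle A lam (pure \<sigma> x) q)"
      by (rule poly_mapping_additive_eqI[where p = q])
        (simp_all add: dapp_linear gembed_minus dapp_minus)
  qed (simp_all add: dapp_linear)
qed

lemma loop_form_pure_right:
  "loop_form A lam p (pure (- \<sigma>) y) = form A (coef p \<sigma>) y * lam \<sigma> (- \<sigma>)"
  by (rule poly_mapping_additive_eqI[where p = p])
    (auto simp: lookup_add form_add_left distrib_right lookup_single when_def)

lemma loop_form_pure_left:
  "loop_form A lam (pure (- \<sigma>) x) q = form A x (coef q \<sigma>) * lam (- \<sigma>) \<sigma>"
  by (rule poly_mapping_additive_eqI[where p = q])
    (auto simp: lookup_add form_add_right distrib_right lookup_single when_def)

text \<open>Pairing with elements of degree -\<sigma> isolates the coefficient at \<sigma>, up to a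
  nonzero value of \<open>lam\<close>.\<close>

lemma loop_nondegenerate:
  assumes nd: "nondegenerate_on A UNIV"
  shows "(\<And>q. loop_form A lam p q = 0) \<Longrightarrow> p = 0" "(\<And>p. loop_form A lam p q = 0) \<Longrightarrow> q = 0"
proof -
  show "p = 0" if z: "\<And>q. loop_form A lam p q = 0"
  proof (rule poly_mapping_eqI)
    fix \<sigma>
    have "form A (coef p \<sigma>) y = 0" for y
      using z[of "pure (- \<sigma>) y"] by (simp add: loop_form_pure_right)
    then show "coef p \<sigma> = coef 0 \<sigma>" using nd by (simp add: nondegenerate_on_def)
  qed
  show "q = 0" if z: "\<And>p. loop_form A lam p q = 0"
  proof (rule poly_mapping_eqI)
    fix \<sigma>
    have "form A x (coef q \<sigma>) = 0" for x
      using z[of "pure (- \<sigma>) x"] by (simp add: loop_form_pure_left)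
    then show "coef q \<sigma> = coef 0 \<sigma>" using nd by (simp add: nondegenerate_on_def)
  qed
qed

end

section \<open>Gradings and root spaces in terms of coefficients\<close>

lemma root_space_iff: "x \<in> root_space A H \<alpha> \<longleftrightarrow> (\<forall>h\<in>H. mul A h x = smul A (\<alpha> h) x)"
  by (simp add: root_space_def)

context loop_construction
begin

text \<open>Here \<open>f\<close> is the inclusion of the loop space into one of the three algebras,
  and the \<open>W i\<close> are the graded pieces or the root spaces of \<open>A\<close>; all the
  spanning claims come from this lemma.\<close>

lemma loop_span_into:
  assumes s: "vector_space s"
    and f: "\<And>p q. f (p + q) = f p + f q" "\<And>c p. f (lscale c p) = s c (f p)"
    and span: "\<And>x. x \<in> span (\<Union>i\<in>I. W i)"
    and Y: "\<And>\<sigma> i x. i \<in> I \<Longrightarrow> x \<in> W i \<Longrightarrow> f (pure \<sigma> x) \<in> Y"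
  shows "f p \<in> module.span s Y"
proof -
  interpret s: vector_space s by fact
  have "f 0 = 0" using f(1)[of 0 0] by simp
  then have f_sum: "f (\<Sum>\<sigma>\<in>S. g \<sigma>) = (\<Sum>\<sigma>\<in>S. f (g \<sigma>))" for S :: "'g set" and g
    by (induction S rule: infinite_finite_induct) (simp_all add: f)
  have "f (pure \<sigma> x) \<in> s.span Y" for \<sigma> x
  proof (rule span_hom[OF vs s _ _ _ span])
    show "f (pure \<sigma> (x + y)) = f (pure \<sigma> x) + f (pure \<sigma> y)" for x y
      by (simp add: single_add f)
    show "f (pure \<sigma> (smul A c x)) = s c (f (pure \<sigma> x))" for c x
      by (simp flip: f(2))
    show "f (pure \<sigma> x) \<in> s.span Y" if "x \<in> (\<Union>i\<in>I. W i)" for x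
      using that Y by (auto intro: s.span_base)
  qed
  then have "(\<Sum>\<sigma>\<in>Poly_Mapping.keys p. f (pure \<sigma> (coef p \<sigma>))) \<in> s.span Y"
    by (intro s.span_sum)
  then show ?thesis by (simp flip: f_sum poly_mapping_eq_sum_single)
qed

lemma in_span_grade: "x \<in> span (\<Union>b\<in>UNIV. grade A b)"
  by (rule internal_direct_sum_in_span[OF vs grading])

lemma in_span_roots: "x \<in> span (\<Union>\<alpha>\<in>dual_of A H. root_space A H \<alpha>)"
  by (rule internal_direct_sum_in_span[OF vs root_decomposition])

lemma loop_gradeD: "p \<in> loop_grade A b \<Longrightarrow> coef p \<sigma> \<in> grade A b"
  by (simp add: loop_grade_def)

lemma loop_grade_pure: "x \<in> grade A b \<Longrightarrow> pure \<sigma> x \<in> loop_grade A b"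
  using subspace_0[OF subspace_grade] by (simp add: loop_grade_def lookup_single when_def)

lemma subspace_loop_grade: "L.subspace (loop_grade A b)"
  using subspace_grade[of b]
  by (auto simp: L.subspace_def loop_grade_def lookup_add
      intro: subspace_0 subspace_add subspace_scale)

lemma loop_grade_mul:
  "p \<in> loop_grade A b \<Longrightarrow> q \<in> loop_grade A c \<Longrightarrow> loop_mul A lam p q \<in> loop_grade A (b + c)"
  unfolding loop_grade_def using coef_loop_mul_mem[OF subspace_grade] mul_graded by auto

lemma loop_grade_degree_act:
  "(p :: 'g \<Rightarrow>\<^sub>0 'a) \<in> loop_grade A b \<Longrightarrow> degree_act A d p \<in> loop_grade A b"
  using subspace_scale[OF subspace_grade] by (auto simp: loop_grade_def)

lemma loop_grade_independent:
  fixes c :: "'b \<Rightarrow> 'g \<Rightarrow>\<^sub>0 'a"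
  assumes c: "\<And>b. b \<in> S \<Longrightarrow> c b \<in> loop_grade A b" and sum: "(\<Sum>b\<in>S. c b) = 0" and b: "b \<in> S"
  shows "c b = 0"
proof (rule poly_mapping_eqI)
  fix \<sigma>
  have "(\<Sum>b\<in>S. coef (c b) \<sigma>) = 0" using sum by (simp flip: lookup_sum)
  then show "coef (c b) \<sigma> = coef 0 \<sigma>"
    using grade_independent[of S "\<lambda>b. coef (c b) \<sigma>" b] c b loop_gradeD by simp
qed

text \<open>Holds because \<open>d\<close> is additive on \<open>G\<close>. It shows that products
  of loops annihilated by all \<open>d\<close> are again annihilated, as closure of the zero root
  space of the algebra with derivations requires.\<close>

lemma degree_act_derivation:
  "degree_act A d (loop_mul A lam p q) =
   loop_mul A lam (degree_act A d p) q + loop_mul A lam p (degree_act A d q)"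
proof (rule poly_mapping_additive_eqI[where p = p])
  fix \<sigma> x
  show "degree_act A d (loop_mul A lam (pure \<sigma> x) q) =
      loop_mul A lam (degree_act A d (pure \<sigma> x)) q + loop_mul A lam (pure \<sigma> x) (degree_act A d q)"
    by (rule poly_mapping_additive_eqI[where p = q])
      (simp_all add: gembed_add dapp_linear scale_left_distrib distrib_left mult_ac
        flip: single_add)
qed simp_all

text \<open>The subspace \<open>W \<otimes> F^t[G]\<close> of the loop space; for \<open>W\<close> a
  root space of \<open>A\<close> it is the root space of the loop algebra.\<close>

definition components_in :: "'a set \<Rightarrow> ('g \<Rightarrow>\<^sub>0 'a) set" where
  "components_in W = {p. \<forall>\<sigma>. coef p \<sigma> \<in> W}"

lemma components_in_pure: "subspace W \<Longrightarrow> x \<in> W \<Longrightarrow> pure \<sigma> x \<in> components_in W"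
  by (auto simp: components_in_def lookup_single when_def subspace_0)

lemma components_in_root_space:
  "p \<in> components_in (root_space A H \<alpha>) \<longleftrightarrow>
     (\<forall>h\<in>H. loop_mul A lam (pure 0 h) p = lscale (\<alpha> h) p)"
  by (auto simp: components_in_def root_space_def poly_mapping_eq_iff fun_eq_iff)

lemma loop_mul_root_space_0:
  "p \<in> components_in (root_space A H (\<lambda>_. 0)) \<Longrightarrow> q \<in> components_in (root_space A H (\<lambda>_. 0)) \<Longrightarrow>
   loop_mul A lam p q \<in> components_in (root_space A H (\<lambda>_. 0))"
  unfolding components_in_def
  using coef_loop_mul_mem[OF subspace_root_space] mul_root_space_0 by auto

lemma pure_eq_iff [simp]: "pure \<sigma> x = pure \<sigma> y \<longleftrightarrow> x = y"
  by (metis lookup_single_eq)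

lemma pure_eq_0_iff [simp]: "pure \<sigma> x = 0 \<longleftrightarrow> x = 0"
  by (metis pure_eq_iff single_zero)

lemma pure_in_loop_H [simp]: "pure 0 h \<in> loop_H H \<longleftrightarrow> h \<in> H"
  by (auto simp: loop_H_def)

lemma zero_in_loop_H [simp]: "(0 :: 'g \<Rightarrow>\<^sub>0 'a) \<in> loop_H H"
  using pure_in_loop_H[of 0] subspace_0[OF subspace_H] by simp

lemma loop_H_cases:
  assumes "p \<in> loop_H H"
  obtains h where "h \<in> H" "p = pure 0 h"
  using assms by (auto simp: loop_H_def)

lemma ball_loop_H: "(\<forall>p\<in>loop_H H. P p) \<longleftrightarrow> (\<forall>h\<in>H. P (pure 0 h))"
  by (simp add: loop_H_def)

lemma obtain_nonzero_H:
  obtains h where "h \<in> H" "h \<noteq> 0"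
  using H_nonzero subspace_0[OF subspace_H] by blast

lemma rootE:
  assumes "\<alpha> \<in> roots A H"
  obtains x where "x \<in> root_space A H \<alpha>" "x \<noteq> 0"
  using assms subspace_0[OF subspace_root_space] by (auto simp: roots_def)

lemma rootI: "\<alpha> \<in> dual_of A H \<Longrightarrow> x \<in> root_space A H \<alpha> \<Longrightarrow> x \<noteq> 0 \<Longrightarrow> \<alpha> \<in> roots A H"
  by (auto simp: roots_def)

lemma poly_mapping_nonzeroE:
  assumes "p \<noteq> (0 :: 'g \<Rightarrow>\<^sub>0 'a)"
  obtains \<sigma> where "coef p \<sigma> \<noteq> 0"
  using assms by (metis lookup_zero poly_mapping_eqI)

lemma dual_eqI:
  assumes "\<alpha> \<in> dual_of A H" "\<And>h. h \<in> H \<Longrightarrow> \<alpha> h = 0"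
  shows "\<alpha> = (\<lambda>_. 0)"
proof
  show "\<alpha> h = 0" for h using assms by (cases "h \<in> H") (auto simp: dual_of_def)
qed

lemma dualD:
  assumes "\<alpha> \<in> dual_of A H"
  shows "h \<in> H \<Longrightarrow> h' \<in> H \<Longrightarrow> \<alpha> (h + h') = \<alpha> h + \<alpha> h'" "h \<in> H \<Longrightarrow> \<alpha> (smul A c h) = c * \<alpha> h"
    "h \<notin> H \<Longrightarrow> \<alpha> h = 0" "\<alpha> 0 = 0"
proof -
  show "h \<in> H \<Longrightarrow> h' \<in> H \<Longrightarrow> \<alpha> (h + h') = \<alpha> h + \<alpha> h'" "h \<in> H \<Longrightarrow> \<alpha> (smul A c h) = c * \<alpha> h" for h c
    using assms by (auto simp: dual_of_def)
  from this(2)[OF subspace_0[OF subspace_H], of 0] show "\<alpha> 0 = 0" by simp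
  show "h \<notin> H \<Longrightarrow> \<alpha> h = 0" using assms by (auto simp: dual_of_def)
qed

subsection \<open>The loop algebra\<close>

definition loop_root :: "('a \<Rightarrow> 'f) \<Rightarrow> ('g \<Rightarrow>\<^sub>0 'a) \<Rightarrow> 'f" where
  "loop_root \<alpha> = (\<lambda>p. if p \<in> loop_H H then \<alpha> (coef p 0) else 0)"

abbreviation "LA \<equiv> loop_alg A lam"

lemma loop_alg_simps [simp]: "smul LA = lscale" "mul LA = loop_mul A lam" "grade LA = loop_grade A"
  "form LA = loop_form A lam"
  by (simp_all add: loop_alg_def)

lemma loop_root_neg: "(\<lambda>p. - loop_root \<alpha> p) = loop_root (\<lambda>h. - \<alpha> h)"
  by (auto simp: loop_root_def)

lemma loop_root_zero: "(\<lambda>_. 0) = loop_root (\<lambda>_. 0)"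
  by (auto simp: loop_root_def)

lemma loop_root_space: "root_space LA (loop_H H) (loop_root \<alpha>) = components_in (root_space A H \<alpha>)"
  by (rule set_eqI)
    (simp add: components_in_root_space root_space_iff ball_loop_H loop_root_def)

lemma loop_root_dual: "\<alpha> \<in> dual_of A H \<Longrightarrow> loop_root \<alpha> \<in> dual_of LA (loop_H H)"
  using subspace_add[OF subspace_H] subspace_scale[OF subspace_H]
  by (auto simp: dual_of_def[of LA] loop_root_def dualD lookup_add elim!: loop_H_cases
      simp flip: single_add)

lemma loop_dual_cases:
  assumes "\<beta> \<in> dual_of LA (loop_H H)"
  obtains \<alpha> where "\<alpha> \<in> dual_of A H" "\<beta> = loop_root \<alpha>"
proof
  let ?\<alpha> = "\<lambda>h. if h \<in> H then \<beta> (pure 0 h) else 0"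
  have add: "\<beta> (p + q) = \<beta> p + \<beta> q" if "p \<in> loop_H H" "q \<in> loop_H H" for p q
    using assms that by (auto simp: dual_of_def)
  have scale: "\<beta> (lscale c p) = c * \<beta> p" if "p \<in> loop_H H" for c p
    using assms that by (auto simp: dual_of_def)
  have "\<beta> (pure 0 (x + y)) = \<beta> (pure 0 x) + \<beta> (pure 0 y)" if "x \<in> H" "y \<in> H" for x y
    using add[of "pure 0 x" "pure 0 y"] that by (simp add: single_add)
  moreover have "\<beta> (pure 0 (smul A c x)) = c * \<beta> (pure 0 x)" if "x \<in> H" for c x
    using scale[of "pure 0 x" c] that by simp
  ultimately show "?\<alpha> \<in> dual_of A H"
    using subspace_add[OF subspace_H] subspace_scale[OF subspace_H] by (simp add: dual_of_def)
  show "\<beta> = loop_root ?\<alpha>"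
    using assms by (auto simp: dual_of_def loop_root_def fun_eq_iff elim!: loop_H_cases)
qed

lemma loop_roots: "roots LA (loop_H H) = loop_root ` roots A H"
proof (intro equalityI subsetI)
  fix \<beta> assume "\<beta> \<in> roots LA (loop_H H)"
  then have \<beta>: "\<beta> \<in> dual_of LA (loop_H H)" "root_space LA (loop_H H) \<beta> \<noteq> {0}"
    by (auto simp: roots_def)
  obtain \<alpha> where \<alpha>: "\<alpha> \<in> dual_of A H" "\<beta> = loop_root \<alpha>" using \<beta>(1) by (rule loop_dual_cases)
  moreover have "0 \<in> components_in (root_space A H \<alpha>)"
    by (simp add: components_in_root_space)
  ultimately obtain p where p: "p \<in> components_in (root_space A H \<alpha>)" "p \<noteq> 0"
    using \<beta>(2) by (auto simp: loop_root_space)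
  then obtain \<sigma> where "coef p \<sigma> \<noteq> 0" using poly_mapping_nonzeroE by blast
  then have "\<alpha> \<in> roots A H" using p(1) rootI[OF \<alpha>(1)] by (auto simp: components_in_def)
  then show "\<beta> \<in> loop_root ` roots A H" using \<alpha>(2) by blast
next
  fix \<beta> assume "\<beta> \<in> loop_root ` roots A H"
  then obtain \<alpha> where \<alpha>: "\<alpha> \<in> roots A H" "\<beta> = loop_root \<alpha>" by blast
  then obtain x where x: "x \<in> root_space A H \<alpha>" "x \<noteq> 0" using rootE by blast
  then have "pure 0 x \<in> root_space LA (loop_H H) \<beta>" "pure 0 x \<noteq> 0"
    by (simp_all add: \<alpha>(2) loop_root_space components_in_pure subspace_root_space)
  then show "\<beta> \<in> roots LA (loop_H H)" using loop_root_dual \<alpha> by (auto simp: roots_def)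
qed

sublocale LA: bilinear_algebra LA
  by (simp add: bilinear_algebra_def L.vector_space_axioms bilinear_loop_mul)

text \<open>The form on the central extension ignores the \<open>V\<close> component, so the affine
  claim is made for the loop algebra and needs the toral structure here as well.\<close>

lemma quadratic_loop: "quadratic_toral_pair LA (loop_H H)"
proof -
  have into: "p \<in> L.span Y"
    if "\<And>x. x \<in> span (\<Union>i\<in>I. W i)" "\<And>\<sigma> i x. i \<in> I \<Longrightarrow> x \<in> W i \<Longrightarrow> pure \<sigma> x \<in> Y"
    for Y p and I :: "'i set" and W
    by (rule loop_span_into[OF L.vector_space_axioms, where f = "\<lambda>p. p", OF refl refl that])
  have "toral_pair LA (loop_H H)"
  proof (rule LA.toral_pairI, unfold loop_alg_simps)
    show "L.subspace (loop_grade A b)" for b by (rule subspace_loop_grade)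
    show "p \<in> L.span (\<Union>b. loop_grade A b)" for p
      by (rule into[OF in_span_grade]) (auto intro: loop_grade_pure)
    show "p \<in> L.span (\<Union>\<alpha>\<in>dual_of LA (loop_H H). root_space LA (loop_H H) \<alpha>)" for p
    proof (rule into[OF in_span_roots])
      fix \<sigma> \<alpha> x assume "\<alpha> \<in> dual_of A H" "x \<in> root_space A H \<alpha>"
      then show "pure \<sigma> x \<in> (\<Union>\<alpha>\<in>dual_of LA (loop_H H). root_space LA (loop_H H) \<alpha>)"
        by (intro UN_I[of "loop_root \<alpha>"] loop_root_dual)
          (simp_all add: loop_root_space components_in_pure subspace_root_space)
    qed
    show "c b = 0" if "\<And>b. b \<in> S \<Longrightarrow> c b \<in> loop_grade A b" "(\<Sum>b\<in>S. c b) = 0" "b \<in> S" for S b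
      and c :: "'b \<Rightarrow> 'g \<Rightarrow>\<^sub>0 'a"
      using that by (rule loop_grade_independent)
    show "loop_mul A lam p q \<in> loop_grade A (b + c)" if "p \<in> loop_grade A b" "q \<in> loop_grade A c"
      for p q b c using that by (rule loop_grade_mul)
    show "b_commutative LA" by (simp add: b_commutative_def loop_mul_commutative[symmetric])
    show "subalgebra LA (loop_H H)"
      using subspace_add[OF subspace_H] subspace_scale[OF subspace_H] mul_H
      by (auto simp: subalgebra_def L.subspace_def elim!: loop_H_cases simp flip: single_add)
    show "loop_H H \<subseteq> (loop_grade A 0 :: ('g \<Rightarrow>\<^sub>0 'a) set)"
      by (auto intro: loop_grade_pure H_grade elim!: loop_H_cases)
    obtain h where "h \<in> H" "h \<noteq> 0" by (rule obtain_nonzero_H)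
    then have "pure 0 h \<in> loop_H H" "pure 0 h \<noteq> 0" by simp_all
    then show "loop_H H \<noteq> ({0} :: ('g \<Rightarrow>\<^sub>0 'a) set)" by (metis singletonD)
    show "loop_mul A lam p q \<in> root_space LA (loop_H H) (\<lambda>_. 0)"
      if "p \<in> root_space LA (loop_H H) (\<lambda>_. 0)" "q \<in> root_space LA (loop_H H) (\<lambda>_. 0)" for p q
      using that unfolding loop_root_zero loop_root_space by (rule loop_mul_root_space_0)
  qed
  moreover have "b_symmetric_form LA"
    unfolding b_symmetric_form_def loop_alg_simps
    by (intro allI ballI) (rule loop_form_symmetric)
  moreover have "b_graded_form LA" "invariant_form LA"
    by (auto simp: b_graded_form_def invariant_form_def loop_form_graded loop_form_invariant)
  ultimately show ?thesis by (simp add: quadratic_toral_pair_def bilinear_loop_form)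
qed

subsection \<open>The central extension\<close>

abbreviation "TA \<equiv> tilde_alg A lam"

lemma tilde_alg_simps [simp]:
  "smul TA c (p, v) = (lscale c p, vscale c v)"
  "mul TA (p, v) (q, w) = (loop_mul A lam p q, loop_cocycle A lam p q)"
  "(p, v) \<in> grade TA b \<longleftrightarrow> p \<in> loop_grade A b \<and> (b \<noteq> 0 \<longrightarrow> v = 0)"
  "form TA (p, v) (q, w) = loop_form A lam p q"
  by (simp_all add: tilde_alg_def)

lemma in_tilde_H [simp]: "(p, v) \<in> tilde_H H \<longleftrightarrow> p \<in> loop_H H"
  by (simp add: tilde_H_def)

lemma ball_tilde_H: "(\<forall>x\<in>tilde_H H. P x) \<longleftrightarrow> (\<forall>h\<in>H. \<forall>v. P (pure 0 h, v))"
  using ball_loop_H[of "\<lambda>p. \<forall>v. P (p, v)"] by auto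

lemma tilde_root_neg: "(\<lambda>x. - tilde_root H \<alpha> x) = tilde_root H (\<lambda>h. - \<alpha> h)"
  by (auto simp: tilde_root_def)

lemma tilde_root_zero: "(\<lambda>_. 0) = tilde_root H (\<lambda>_. 0)"
  by (auto simp: tilde_root_def)

lemma tilde_root_pure [simp]: "tilde_root H \<alpha> (pure 0 h, v) = (if h \<in> H then \<alpha> h else 0)"
  by (simp add: tilde_root_def)

lemma vector_space_tilde: "vector_space (smul TA)"
  by unfold_locales
    (auto simp: L.scale_right_distrib L.scale_left_distrib vscale.scale_right_distrib
      vscale.scale_left_distrib)

lemma bilinear_tilde: "bilinear_map (smul TA) (smul TA) (smul TA) (mul TA)"
  by (rule bilinear_mapI) (auto simp: vector_space_tilde)

sublocale TA: bilinear_algebra TA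
  by (simp add: bilinear_algebra_def vector_space_tilde bilinear_tilde)

text \<open>The action of the toral part never produces a \<open>V\<close> component, so a root
  vector can have one only where the eigenvalue vanishes identically.\<close>

lemma tilde_root_space:
  "(p, v) \<in> root_space TA (tilde_H H) (tilde_root H \<alpha>) \<longleftrightarrow>
     p \<in> components_in (root_space A H \<alpha>) \<and> (v = 0 \<or> (\<forall>h\<in>H. \<alpha> h = 0))"
  by (auto simp: components_in_root_space root_space_iff ball_tilde_H)

lemma tilde_root_dual: "\<alpha> \<in> dual_of A H \<Longrightarrow> tilde_root H \<alpha> \<in> dual_of TA (tilde_H H)"
  using subspace_add[OF subspace_H] subspace_scale[OF subspace_H]
  by (auto simp: dual_of_def[of TA] dualD tilde_root_def lookup_add elim!: loop_H_cases
      simp flip: single_add)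

lemma tilde_roots: "roots TA (tilde_H H) = tilde_root H ` roots A H"
proof (intro equalityI subsetI)
  fix \<beta> assume "\<beta> \<in> roots TA (tilde_H H)"
  then have \<beta>: "\<beta> \<in> dual_of TA (tilde_H H)" "root_space TA (tilde_H H) \<beta> \<noteq> {0}"
    by (auto simp: roots_def)
  have "0 \<in> root_space TA (tilde_H H) \<beta>" by (rule TA.subspace_0[OF TA.subspace_root_space])
  with \<beta>(2) obtain x where "x \<in> root_space TA (tilde_H H) \<beta>" "x \<noteq> 0" by blast
  then obtain p v where pv: "(p, v) \<in> root_space TA (tilde_H H) \<beta>" "(p, v) \<noteq> 0"
    by (cases x) simp
  have add: "\<beta> (x + y) = \<beta> x + \<beta> y" if "x \<in> tilde_H H" "y \<in> tilde_H H" for x y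
    using \<beta>(1) that by (auto simp: dual_of_def)
  have scale: "\<beta> (smul TA c x) = c * \<beta> x" if "x \<in> tilde_H H" for c x
    using \<beta>(1) that by (auto simp: dual_of_def)
  \<comment> \<open>\<open>V\<close> annihilates the root vector, which is nonzero, so every root
    vanishes on \<open>V\<close>.\<close>
  have "smul TA (\<beta> (0, w)) (p, v) = 0" for w
    using bspec[OF pv(1)[unfolded root_space_iff], of "(0, w)"] by (simp add: zero_prod_def)
  then have central: "\<beta> (0, w) = 0" for w
    using pv(2) TA.scale_eq_0_iff[of "\<beta> (0, w)" "(p, v)"] by simp
  define \<alpha> where "\<alpha> h = (if h \<in> H then \<beta> (pure 0 h, 0) else 0)" for h
  have "\<beta> (pure 0 (x + y), 0) = \<beta> (pure 0 x, 0) + \<beta> (pure 0 y, 0)" if "x \<in> H" "y \<in> H" for x y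
    using add[of "(pure 0 x, 0)" "(pure 0 y, 0)"] that by (simp add: single_add)
  moreover have "\<beta> (pure 0 (smul A c x), 0) = c * \<beta> (pure 0 x, 0)" if "x \<in> H" for c x
    using scale[of "(pure 0 x, 0)" c] that by simp
  ultimately have \<alpha>: "\<alpha> \<in> dual_of A H"
    using subspace_add[OF subspace_H] subspace_scale[OF subspace_H]
    by (simp add: dual_of_def \<alpha>_def)
  have eq: "\<beta> (pure 0 h, w) = \<alpha> h" if "h \<in> H" for h w
    using add[of "(pure 0 h, 0)" "(0, w)"] that central by (simp add: \<alpha>_def)
  have out: "\<beta> x = 0" if "x \<notin> tilde_H H" for x
    using \<beta>(1) that unfolding dual_of_def by blast
  have \<beta>_eq: "\<beta> = tilde_root H \<alpha>"
    by (auto simp: tilde_root_def fun_eq_iff out eq elim!: loop_H_cases)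
  have comps: "p \<in> components_in (root_space A H \<alpha>)" "v = 0 \<or> (\<forall>h\<in>H. \<alpha> h = 0)"
    using pv(1) by (simp_all add: \<beta>_eq tilde_root_space)
  have "\<alpha> \<in> roots A H"
  proof (cases "p = 0")
    \<comment> \<open>The root vector is central and nonzero, so \<alpha> is zero, which is a root
      of \<open>A\<close>.\<close>
    case True
    then have "\<alpha> = (\<lambda>_. 0)" using comps(2) pv(2)
      by (intro dual_eqI[OF \<alpha>]) (auto simp: zero_prod_def)
    then show ?thesis using zero_root by simp
  next
    case False
    then obtain \<sigma> where "coef p \<sigma> \<noteq> 0" using poly_mapping_nonzeroE by blast
    then show ?thesis using comps(1) rootI[OF \<alpha>] by (auto simp: components_in_def)
  qed
  then show "\<beta> \<in> tilde_root H ` roots A H" using \<beta>_eq by blast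
next
  fix \<beta> :: "('g \<Rightarrow>\<^sub>0 'a) \<times> ('g, 'f) gtensor \<Rightarrow> 'f"
  assume "\<beta> \<in> tilde_root H ` roots A H"
  then obtain \<alpha> where \<alpha>: "\<alpha> \<in> roots A H" "\<beta> = tilde_root H \<alpha>" by blast
  then obtain x where x: "x \<in> root_space A H \<alpha>" "x \<noteq> 0" using rootE by blast
  then have "(pure 0 x, 0) \<in> root_space TA (tilde_H H) \<beta>" "(pure 0 x, 0) \<noteq> 0"
    by (simp_all add: \<alpha>(2) tilde_root_space components_in_pure subspace_root_space zero_prod_def)
  then show "\<beta> \<in> roots TA (tilde_H H)" using tilde_root_dual \<alpha> by (auto simp: roots_def)
qed

lemma quadratic_tilde: "quadratic_toral_pair TA (tilde_H H)"
proof -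
  have split: "(p, v) \<in> TA.span Y" if "\<And>p. (p, 0) \<in> TA.span Y" "\<And>v. (0, v) \<in> Y" for Y p v
    using TA.span_add[OF that(1)[of p] TA.span_base[OF that(2)[of v]]] by simp
  have into: "(p, 0) \<in> TA.span Y"
    if "\<And>x. x \<in> span (\<Union>i\<in>I. W i)" "\<And>\<sigma> i x. i \<in> I \<Longrightarrow> x \<in> W i \<Longrightarrow> (pure \<sigma> x, 0) \<in> Y"
    for Y p and I :: "'i set" and W
    by (rule loop_span_into[OF vector_space_tilde, where f = "\<lambda>p. (p, 0)", OF _ _ that]) auto
  have "toral_pair TA (tilde_H H)"
  proof (rule TA.toral_pairI)
    show "TA.subspace (grade TA b)" for b
      using subspace_loop_grade[of b]
      by (auto simp: TA.subspace_def L.subspace_def zero_prod_def)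
    show "x \<in> TA.span (\<Union>b. grade TA b)" for x
    proof (cases x, simp, rule split)
      show "(p, 0) \<in> TA.span (\<Union>b. grade TA b)" for p
        by (rule into[OF in_span_grade]) (auto intro: loop_grade_pure)
      show "(0, v) \<in> (\<Union>b. grade TA b)" for v
        using L.subspace_0[OF subspace_loop_grade] by (auto intro!: exI[of _ 0])
    qed
    show "x \<in> TA.span (\<Union>\<alpha>\<in>dual_of TA (tilde_H H). root_space TA (tilde_H H) \<alpha>)" for x
    proof (cases x, simp, rule split)
      show "(p, 0) \<in> TA.span (\<Union>\<alpha>\<in>dual_of TA (tilde_H H). root_space TA (tilde_H H) \<alpha>)" for p
      proof (rule into[OF in_span_roots])
        fix \<sigma> \<alpha> x assume "\<alpha> \<in> dual_of A H" "x \<in> root_space A H \<alpha>"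
        then show "(pure \<sigma> x, 0) \<in> (\<Union>\<alpha>\<in>dual_of TA (tilde_H H). root_space TA (tilde_H H) \<alpha>)"
          by (intro UN_I[of "tilde_root H \<alpha>"] tilde_root_dual)
            (simp_all add: tilde_root_space components_in_pure subspace_root_space)
      qed
      have "(0, v) \<in> root_space TA (tilde_H H) (\<lambda>_. 0)" for v
        unfolding tilde_root_zero by (simp add: tilde_root_space components_in_root_space)
      then show "(0, v) \<in> (\<Union>\<alpha>\<in>dual_of TA (tilde_H H). root_space TA (tilde_H H) \<alpha>)" for v
        using dual_of_zero by blast
    qed
    show "c b = 0" if c: "\<And>b. b \<in> S \<Longrightarrow> c b \<in> grade TA b" and sum: "(\<Sum>b\<in>S. c b) = 0" and b: "b \<in> S"
      for S c b
    proof -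
      have fst: "fst (c b) \<in> loop_grade A b" "b \<noteq> 0 \<Longrightarrow> snd (c b) = 0" if "b \<in> S" for b
        using c[OF that] by (cases "c b"; simp)+
      have sums: "(\<Sum>b\<in>S. fst (c b)) = 0" "(\<Sum>b\<in>S. snd (c b)) = 0"
        using sum by (simp_all flip: fst_sum snd_sum)
      \<comment> \<open>The \<open>V\<close> component lives in degree 0 only, so a vanishing sum
        has a vanishing \<open>V\<close> component there.\<close>
      have "(\<Sum>b\<in>S. snd (c b)) = snd (c 0)" if "0 \<in> S"
        using that fst(2) by (subst sum.mono_neutral_right[of S "{0}"]) auto
      then have "snd (c b) = 0" using fst(2) sums(2) b by (cases "b = 0") auto
      moreover have "fst (c b) = 0" using fst(1) sums(1) b by (rule loop_grade_independent)
      ultimately show ?thesis by (simp add: prod_eq_iff)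
    qed
    show "mul TA x y \<in> grade TA (b + c)" if "x \<in> grade TA b" "y \<in> grade TA c" for b c x y
      using that loop_grade_mul loop_form_graded by (cases x; cases y) auto
    show "b_commutative TA"
      unfolding b_commutative_def
      by (auto simp: loop_mul_commutative[symmetric] loop_cocycle_commutative[symmetric])
    show "subalgebra TA (tilde_H H)"
      unfolding subalgebra_def TA.subspace_def
      using subspace_add[OF subspace_H] subspace_scale[OF subspace_H] mul_H
      by (auto simp: zero_prod_def elim!: loop_H_cases simp flip: single_add)
    show "tilde_H H \<subseteq> grade TA 0"
      by (auto simp: loop_grade_pure H_grade elim!: loop_H_cases)
    obtain h where "h \<in> H" "h \<noteq> 0" by (rule obtain_nonzero_H)
    then have "(pure 0 h, 0) \<in> tilde_H H" "(pure 0 h, 0 :: ('g, 'f) gtensor) \<noteq> 0"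
      by (simp_all add: zero_prod_def)
    then show "tilde_H H \<noteq> ({0} :: (('g \<Rightarrow>\<^sub>0 'a) \<times> ('g, 'f) gtensor) set)"
      by (metis singletonD)
    show "mul TA x y \<in> root_space TA (tilde_H H) (\<lambda>_. 0)"
      if "x \<in> root_space TA (tilde_H H) (\<lambda>_. 0)" "y \<in> root_space TA (tilde_H H) (\<lambda>_. 0)" for x y
      using that unfolding tilde_root_zero
      by (cases x; cases y) (simp add: tilde_root_space loop_mul_root_space_0)
  qed
  moreover have "bilinear_map (smul TA) (smul TA) (*) (form TA)"
    by (rule bilinear_mapI) (auto simp: vector_space_tilde vector_space_field)
  moreover have "b_symmetric_form TA"
    unfolding b_symmetric_form_def
  proof (intro allI ballI)
    fix b c x y assume "x \<in> grade TA b" "y \<in> grade TA c"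
    then show "form TA x y = - bsign b c * form TA y x"
      using loop_form_symmetric[of "fst x" b "fst y" c] by (cases x; cases y) simp
  qed
  moreover have "b_graded_form TA" "invariant_form TA"
    by (auto simp: b_graded_form_def invariant_form_def loop_form_graded loop_form_invariant)
  ultimately show ?thesis by (simp add: quadratic_toral_pair_def)
qed


subsection \<open>The extension by derivations\<close>

abbreviation "HA \<equiv> hat_alg A lam"

lemma hat_alg_simps [simp]:
  "smul HA c (p, v, d) = (lscale c p, vscale c v, dscale c d)"
  "mul HA (p, v, d) (q, w, e) =
     (loop_mul A lam p q + degree_act A d q - degree_act A e p, loop_cocycle A lam p q, 0)"
  "(p, v, d) \<in> grade HA b \<longleftrightarrow> p \<in> loop_grade A b \<and> (b \<noteq> 0 \<longrightarrow> v = 0 \<and> d = 0)"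
  "form HA (p, v, d) (q, w, e) = loop_form A lam p q + dapp d w + dapp e v"
  by (simp_all add: hat_alg_def)

lemma in_hat_H [simp]: "(p, v, d) \<in> hat_H H \<longleftrightarrow> p \<in> loop_H H"
  by (simp add: hat_H_def)

lemma ball_hat_H: "(\<forall>x\<in>hat_H H. P x) \<longleftrightarrow> (\<forall>h\<in>H. \<forall>v d. P (pure 0 h, v, d))"
  using ball_loop_H[of "\<lambda>p. \<forall>v d. P (p, v, d)"] by auto

lemma hat_root_neg: "(\<lambda>x. - hat_root H \<alpha> \<sigma> x) = hat_root H (\<lambda>h. - \<alpha> h) (- \<sigma>)"
  by (auto simp: hat_root_def gembed_minus dapp_minus)

lemma hat_root_zero: "(\<lambda>_. 0) = hat_root H (\<lambda>_. 0) 0"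
  by (auto simp: hat_root_def)

lemma hat_root_pure [simp]:
  "hat_root H \<alpha> \<sigma> (pure 0 h, v, d) = (if h \<in> H then \<alpha> h + dapp d (gembed \<sigma>) else 0)"
  by (simp add: hat_root_def)

lemma dapp_gdual_linear [simp]:
  "dapp (d + e) v = dapp d v + dapp e v" "dapp (dscale c d) v = c * dapp d v"
  by (simp_all add: plus_gdual.rep_eq dscale.rep_eq)

lemma vector_space_hat: "vector_space (smul HA)"
  by unfold_locales
    (auto simp: L.scale_right_distrib L.scale_left_distrib vscale.scale_right_distrib
      vscale.scale_left_distrib dscale.scale_right_distrib dscale.scale_left_distrib)

lemma bilinear_hat: "bilinear_map (smul HA) (smul HA) (smul HA) (mul HA)"
  by (rule bilinear_mapI)
    (auto simp: vector_space_hat L.scale_right_distrib L.scale_right_diff_distrib)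

sublocale HA: bilinear_algebra HA
  by (simp add: bilinear_algebra_def vector_space_hat bilinear_hat)

text \<open>The condition is tested separately with \<open>e = 0\<close> and \<open>h = 0\<close>,
  which splits it into a condition for \<alpha> and one for \<sigma>. The summands outside the loop
  space are annihilated by the toral part (a derivation kills \<open>h \<otimes> 1\<close>), hence
  occur only for the zero functional.\<close>

lemma hat_root_space:
  "(p, v, d) \<in> root_space HA (hat_H H) (hat_root H \<alpha> \<sigma>) \<longleftrightarrow>
     p \<in> components_in (root_space A H \<alpha>) \<and>
     (\<forall>e. degree_act A e p = lscale (dapp e (gembed \<sigma>)) p) \<and>
     (v = 0 \<and> d = 0 \<or> (\<forall>h\<in>H. \<alpha> h = 0) \<and> (\<forall>e :: ('g, 'f) gdual. dapp e (gembed \<sigma>) = 0))"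
    (is "?L \<longleftrightarrow> ?R")
proof -
  have L: "?L \<longleftrightarrow> (\<forall>h\<in>H. \<forall>e.
      loop_mul A lam (pure 0 h) p + degree_act A e p = lscale (\<alpha> h + dapp e (gembed \<sigma>)) p \<and>
      (v = 0 \<and> d = 0 \<or> \<alpha> h + dapp e (gembed \<sigma>) = 0))"
    by (auto simp: root_space_iff ball_hat_H)
  show ?thesis
  proof
    assume l: ?L
    have act: "loop_mul A lam (pure 0 h) p = lscale (\<alpha> h) p" if "h \<in> H" for h
      using l[unfolded L, rule_format, of h 0] that by simp
    moreover have "degree_act A e p = lscale (dapp e (gembed \<sigma>)) p" for e
      using l[unfolded L, rule_format, of 0 e] act[of 0] subspace_0[OF subspace_H]
      by (simp add: L.scale_left_distrib)
    moreover have "\<alpha> h = 0" if "h \<in> H" "\<not> (v = 0 \<and> d = 0)" for h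
      using l[unfolded L, rule_format, of h 0] that by auto
    moreover have "dapp e (gembed \<sigma>) = 0" if "\<not> (v = 0 \<and> d = 0)"
      for e :: "('g, 'f) gdual"
      using l[unfolded L, rule_format, of 0 e] l[unfolded L, rule_format, of 0 0] that
        subspace_0[OF subspace_H] by auto
    ultimately show ?R by (auto simp: components_in_root_space)
  next
    assume ?R
    then show ?L unfolding L by (auto simp: components_in_root_space L.scale_left_distrib)
  qed
qed

lemma hat_root_dual: "\<alpha> \<in> dual_of A H \<Longrightarrow> hat_root H \<alpha> \<sigma> \<in> dual_of HA (hat_H H)"
  using subspace_add[OF subspace_H] subspace_scale[OF subspace_H]
  by (auto simp: dual_of_def[of HA] dualD hat_root_def lookup_add algebra_simps elim!: loop_H_cases
      simp flip: single_add)

lemma hat_roots: "roots HA (hat_H H) = {hat_root H \<alpha> \<sigma> | \<alpha> \<sigma>. \<alpha> \<in> roots A H}"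
proof (intro equalityI subsetI)
  fix \<beta> assume "\<beta> \<in> roots HA (hat_H H)"
  then have \<beta>: "\<beta> \<in> dual_of HA (hat_H H)" "root_space HA (hat_H H) \<beta> \<noteq> {0}"
    by (auto simp: roots_def)
  have "0 \<in> root_space HA (hat_H H) \<beta>" by (rule HA.subspace_0[OF HA.subspace_root_space])
  with \<beta>(2) obtain x where "x \<in> root_space HA (hat_H H) \<beta>" "x \<noteq> 0" by blast
  then obtain p v d where pv: "(p, v, d) \<in> root_space HA (hat_H H) \<beta>" "(p, v, d) \<noteq> 0"
    by (cases x) simp
  have add: "\<beta> (x + y) = \<beta> x + \<beta> y" if "x \<in> hat_H H" "y \<in> hat_H H" for x y
    using \<beta>(1) that unfolding dual_of_def by blast
  have scale: "\<beta> (smul HA c x) = c * \<beta> x" if "x \<in> hat_H H" for c x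
    using \<beta>(1) that unfolding dual_of_def by blast
  have "smul HA (\<beta> (0, w, 0)) (p, v, d) = 0" for w
    using bspec[OF pv(1)[unfolded root_space_iff], of "(0, w, 0)"] by (simp add: zero_prod_def)
  then have central: "\<beta> (0, w, 0) = 0" for w
    using pv(2) HA.scale_eq_0_iff[of "\<beta> (0, w, 0)" "(p, v, d)"] by simp
  define \<alpha> where "\<alpha> h = (if h \<in> H then \<beta> (pure 0 h, 0, 0) else 0)" for h
  have "\<beta> (pure 0 (x + y), 0, 0) = \<beta> (pure 0 x, 0, 0) + \<beta> (pure 0 y, 0, 0)"
    if "x \<in> H" "y \<in> H" for x y
    using add[of "(pure 0 x, 0, 0)" "(pure 0 y, 0, 0)"] that by (simp add: single_add)
  moreover have "\<beta> (pure 0 (smul A c x), 0, 0) = c * \<beta> (pure 0 x, 0, 0)" if "x \<in> H" for c x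
    using scale[of "(pure 0 x, 0, 0)" c] that by simp
  ultimately have \<alpha>: "\<alpha> \<in> dual_of A H"
    using subspace_add[OF subspace_H] subspace_scale[OF subspace_H]
    by (simp add: dual_of_def \<alpha>_def)
  have eq: "\<beta> (pure 0 h, w, e) = \<alpha> h + \<beta> (0, 0, e)" if "h \<in> H" for h w e
    using add[of "(pure 0 h, 0, 0)" "(0, w, e)"] add[of "(0, w, 0)" "(0, 0, e)"] that central
    by (simp add: \<alpha>_def)
  have out: "\<beta> x = 0" if "x \<notin> hat_H H" for x
    using \<beta>(1) that unfolding dual_of_def by blast
  have act: "degree_act A e p = lscale (\<beta> (0, 0, e)) p" "\<beta> (0, 0, e) = 0 \<or> v = 0 \<and> d = 0" for e
    using bspec[OF pv(1)[unfolded root_space_iff], of "(0, 0, e)"] by auto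
  \<comment> \<open>A derivation \<open>e\<close> multiplies the coefficient of \<open>p\<close> at
    \<sigma> by \<open>e(\<sigma>)\<close>, so any \<sigma> in the support of \<open>p\<close>
    serves. For \<open>p = 0\<close> the root vector has a nonzero component in \<open>V\<close> or
    its dual; the root then vanishes on derivations and \<sigma> = 0 is taken.\<close>
  obtain \<sigma> where \<sigma>: "\<And>e. \<beta> (0, 0, e) = dapp e (gembed \<sigma>)" "p \<noteq> 0 \<Longrightarrow> coef p \<sigma> \<noteq> 0"
  proof (cases "p = 0")
    case True
    then show ?thesis using that[of 0] act(2) pv(2) by (auto simp: zero_prod_def)
  next
    case False
    then obtain \<sigma> where \<sigma>: "coef p \<sigma> \<noteq> 0" using poly_mapping_nonzeroE by blast
    have "\<beta> (0, 0, e) = dapp e (gembed \<sigma>)" for e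
      using arg_cong[OF act(1)[of e], of "\<lambda>q. coef q \<sigma>"] \<sigma> by simp
    then show ?thesis using that \<sigma> by blast
  qed
  have \<beta>_eq: "\<beta> = hat_root H \<alpha> \<sigma>"
    by (auto simp: hat_root_def fun_eq_iff out eq \<sigma>(1) elim!: loop_H_cases)
  have comps: "p \<in> components_in (root_space A H \<alpha>)"
      "v = 0 \<and> d = 0 \<or> (\<forall>h\<in>H. \<alpha> h = 0) \<and> (\<forall>e :: ('g, 'f) gdual. dapp e (gembed \<sigma>) = 0)"
    using pv(1) unfolding \<beta>_eq hat_root_space by blast+
  have "\<alpha> \<in> roots A H"
  proof (cases "p = 0")
    case True
    then have "\<alpha> = (\<lambda>_. 0)" using comps(2) pv(2)
      by (intro dual_eqI[OF \<alpha>]) (auto simp: zero_prod_def)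
    then show ?thesis using zero_root by simp
  next
    case False
    then show ?thesis using comps(1) \<sigma>(2) rootI[OF \<alpha>] by (auto simp: components_in_def)
  qed
  then show "\<beta> \<in> {hat_root H \<alpha> \<sigma> | \<alpha> \<sigma>. \<alpha> \<in> roots A H}" using \<beta>_eq by blast
next
  fix \<beta> :: "('g \<Rightarrow>\<^sub>0 'a) \<times> ('g, 'f) gtensor \<times> ('g, 'f) gdual \<Rightarrow> 'f"
  assume "\<beta> \<in> {hat_root H \<alpha> \<sigma> | \<alpha> \<sigma>. \<alpha> \<in> roots A H}"
  then obtain \<alpha> \<sigma> where \<alpha>: "\<alpha> \<in> roots A H" "\<beta> = hat_root H \<alpha> \<sigma>" by blast
  then obtain x where x: "x \<in> root_space A H \<alpha>" "x \<noteq> 0" using rootE by blast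
  then have "(pure \<sigma> x, 0, 0) \<in> root_space HA (hat_H H) \<beta>" "(pure \<sigma> x, 0, 0) \<noteq> 0"
    by (simp_all add: \<alpha>(2) hat_root_space components_in_pure subspace_root_space zero_prod_def)
  then show "\<beta> \<in> roots HA (hat_H H)" using hat_root_dual \<alpha> by (auto simp: roots_def)
qed

lemma hat_root_space_0:
  "(p, v, d) \<in> root_space HA (hat_H H) (\<lambda>_. 0) \<longleftrightarrow>
     p \<in> components_in (root_space A H (\<lambda>_. 0)) \<and> (\<forall>e. degree_act A e p = 0)"
  unfolding hat_root_zero by (simp add: hat_root_space)

lemma loop_form_diff:
  "loop_form A lam (p - q) r = loop_form A lam p r - loop_form A lam q r"
  "loop_form A lam p (q - r) = loop_form A lam p q - loop_form A lam p r"
  using bilinear_mapD(1)[OF bilinear_loop_form, of "p - q" q r]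
    bilinear_mapD(2)[OF bilinear_loop_form, of p "q - r" r] by simp_all

lemma quadratic_hat: "quadratic_toral_pair HA (hat_H H)"
proof -
  have split: "(p, v, d) \<in> HA.span Y"
    if "\<And>p. (p, 0, 0) \<in> HA.span Y" "\<And>v d. (0, v, d) \<in> Y" for Y p v d
    using HA.span_add[OF that(1)[of p] HA.span_base[OF that(2)[of v d]]] by simp
  have into: "(p, 0, 0) \<in> HA.span Y"
    if "\<And>x. x \<in> span (\<Union>i\<in>I. W i)" "\<And>\<sigma> i x. i \<in> I \<Longrightarrow> x \<in> W i \<Longrightarrow> (pure \<sigma> x, 0, 0) \<in> Y"
    for Y p and I :: "'i set" and W
    by (rule loop_span_into[OF vector_space_hat, where f = "\<lambda>p. (p, 0, 0)", OF _ _ that]) auto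
  have "toral_pair HA (hat_H H)"
  proof (rule HA.toral_pairI)
    show "HA.subspace (grade HA b)" for b
      using subspace_loop_grade[of b]
      by (auto simp: HA.subspace_def L.subspace_def zero_prod_def)
    show "x \<in> HA.span (\<Union>b. grade HA b)" for x
    proof (cases x, simp, rule split)
      show "(p, 0, 0) \<in> HA.span (\<Union>b. grade HA b)" for p
        by (rule into[OF in_span_grade]) (auto intro: loop_grade_pure)
      show "(0, v, d) \<in> (\<Union>b. grade HA b)" for v d
        using L.subspace_0[OF subspace_loop_grade] by (auto intro!: exI[of _ 0])
    qed
    show "x \<in> HA.span (\<Union>\<alpha>\<in>dual_of HA (hat_H H). root_space HA (hat_H H) \<alpha>)" for x
    proof (cases x, simp, rule split)
      show "(p, 0, 0) \<in> HA.span (\<Union>\<alpha>\<in>dual_of HA (hat_H H). root_space HA (hat_H H) \<alpha>)" for p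
      proof (rule into[OF in_span_roots])
        fix \<sigma> \<alpha> x assume "\<alpha> \<in> dual_of A H" "x \<in> root_space A H \<alpha>"
        then show "(pure \<sigma> x, 0, 0) \<in> (\<Union>\<alpha>\<in>dual_of HA (hat_H H). root_space HA (hat_H H) \<alpha>)"
          by (intro UN_I[of "hat_root H \<alpha> \<sigma>"] hat_root_dual)
            (simp_all add: hat_root_space components_in_pure subspace_root_space)
      qed
      have "(0, v, d) \<in> root_space HA (hat_H H) (\<lambda>_. 0)" for v d
        by (simp add: hat_root_space_0 components_in_root_space)
      then show "(0, v, d) \<in> (\<Union>\<alpha>\<in>dual_of HA (hat_H H). root_space HA (hat_H H) \<alpha>)" for v d
        using dual_of_zero by blast
    qed
    show "c b = 0" if c: "\<And>b. b \<in> S \<Longrightarrow> c b \<in> grade HA b" and sum: "(\<Sum>b\<in>S. c b) = 0" and b: "b \<in> S"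
      for S c b
    proof -
      have fst: "fst (c b) \<in> loop_grade A b" "b \<noteq> 0 \<Longrightarrow> snd (c b) = 0" if "b \<in> S" for b
        using c[OF that] by (cases "c b"; simp add: zero_prod_def)+
      have sums: "(\<Sum>b\<in>S. fst (c b)) = 0" "(\<Sum>b\<in>S. snd (c b)) = 0"
        using sum by (simp_all flip: fst_sum snd_sum)
      have "(\<Sum>b\<in>S. snd (c b)) = snd (c 0)" if "0 \<in> S"
        using that fst(2) by (subst sum.mono_neutral_right[of S "{0}"]) auto
      then have "snd (c b) = 0" using fst(2) sums(2) b by (cases "b = 0") auto
      moreover have "fst (c b) = 0" using fst(1) sums(1) b by (rule loop_grade_independent)
      ultimately show ?thesis by (simp add: prod_eq_iff)
    qed
    show "mul HA x y \<in> grade HA (b + c)" if "x \<in> grade HA b" "y \<in> grade HA c" for b c x y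
    proof -
      obtain p v d q w e where xy: "x = (p, v, d)" "y = (q, w, e)" by (cases x; cases y)
      have "degree_act A d q \<in> loop_grade A (b + c)" "degree_act A e p \<in> loop_grade A (b + c)"
        using that L.subspace_0[OF subspace_loop_grade] loop_grade_degree_act
        unfolding xy by (cases "b = 0"; cases "c = 0"; simp)+
      then show ?thesis
        using that loop_grade_mul[of p b q c] loop_form_graded[of p b q c]
          L.subspace_add[OF subspace_loop_grade] L.subspace_diff[OF subspace_loop_grade]
        unfolding xy by auto
    qed
    show "b_commutative HA"
      unfolding b_commutative_def
    proof (intro allI ballI)
      fix b c x y assume xy: "x \<in> grade HA b" "y \<in> grade HA c"
      obtain p v d q w e where eqs: "x = (p, v, d)" "y = (q, w, e)" by (cases x; cases y)
      have *: "p \<in> loop_grade A b" "q \<in> loop_grade A c" using xy by (auto simp: eqs)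
      \<comment> \<open>A derivation part occurs in degree 0 only, where the sign is -1; this agrees
        with its antisymmetric action.\<close>
      have "bsign b c = (- 1 :: 'f) \<or> d = 0 \<and> e = 0" using xy by (auto simp: eqs)
      then have "degree_act A d q - degree_act A e p =
          lscale (bsign b c) (degree_act A e p - degree_act A d q)" by auto
      then show "mul HA x y = smul HA (bsign b c) (mul HA y x)"
        unfolding eqs using loop_mul_commutative[OF *] loop_cocycle_commutative[OF *]
        by (simp add: L.scale_right_distrib L.scale_right_diff_distrib algebra_simps)
    qed
    show "subalgebra HA (hat_H H)"
      unfolding subalgebra_def HA.subspace_def
      using subspace_add[OF subspace_H] subspace_scale[OF subspace_H] mul_H
      by (auto simp: zero_prod_def elim!: loop_H_cases simp flip: single_add)
    show "hat_H H \<subseteq> grade HA 0"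
      by (auto simp: loop_grade_pure H_grade elim!: loop_H_cases)
    obtain h where "h \<in> H" "h \<noteq> 0" by (rule obtain_nonzero_H)
    then have "(pure 0 h, 0, 0) \<in> hat_H H"
        "(pure 0 h, 0 :: ('g, 'f) gtensor, 0 :: ('g, 'f) gdual) \<noteq> 0"
      by (simp_all add: zero_prod_def)
    then show "hat_H H \<noteq> ({0} :: (('g \<Rightarrow>\<^sub>0 'a) \<times> ('g, 'f) gtensor \<times> ('g, 'f) gdual) set)"
      by (metis singletonD)
    show "mul HA x y \<in> root_space HA (hat_H H) (\<lambda>_. 0)"
      if "x \<in> root_space HA (hat_H H) (\<lambda>_. 0)" "y \<in> root_space HA (hat_H H) (\<lambda>_. 0)" for x y
      using that
      by (cases x; cases y) (simp add: hat_root_space_0 loop_mul_root_space_0 degree_act_derivation)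
  qed
  moreover have "bilinear_map (smul HA) (smul HA) (*) (form HA)"
    by (rule bilinear_mapI)
      (auto simp: vector_space_hat vector_space_field dapp_linear algebra_simps)
  moreover have "b_symmetric_form HA"
    unfolding b_symmetric_form_def
  proof (intro allI ballI)
    fix b c x y assume "x \<in> grade HA b" "y \<in> grade HA c"
    then show "form HA x y = - bsign b c * form HA y x"
      using loop_form_symmetric[of "fst x" b "fst y" c]
      by (cases x; cases y; cases "b = 0"; cases "c = 0") auto
  qed
  moreover have "b_graded_form HA"
    unfolding b_graded_form_def
  proof (intro allI impI ballI)
    fix b c x y assume "b + c \<noteq> 0" "x \<in> grade HA b" "y \<in> grade HA c"
    then show "form HA x y = 0"
      using loop_form_graded(1)[of "fst x" b "fst y" c]
      by (cases x; cases y; cases "b = 0"; cases "c = 0") auto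
  qed
  \<comment> \<open>Each term containing one derivation on the left has its counterpart on the
    right: \<open>(d q, r)\<close> and \<open>d\<close> of the cocycle of \<open>q\<close>,
    \<open>r\<close>, for example, agree by \<open>loop_form_degree_act\<close>.\<close>
  moreover have "invariant_form HA"
    by (auto simp: invariant_form_def loop_form_invariant loop_form_degree_act
        loop_form_diff)
  ultimately show ?thesis by (simp add: quadratic_toral_pair_def)
qed

text \<open>\<open>V\<close> and its dual pair with each other and are orthogonal to the loop space.
  Functionals separate the points of \<open>V\<close> and are determined by their values, so this
  complement is non-degenerate on its own.\<close>

lemma hat_nondegenerate:
  assumes nd: "nondegenerate_on A UNIV"
  shows "nondegenerate_on HA UNIV"
proof -
  have zero: "v = 0" "d = 0" if "\<And>e. dapp e v = 0" "\<And>w. dapp d w = 0"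
    for v :: "('g, 'f) gtensor" and d :: "('g, 'f) gdual"
    using that gdual_separates by (blast, intro gdual_eqI) simp
  have left: "(p, v, d) = 0" if z: "\<And>y. form HA (p, v, d) y = 0" for p v d
  proof -
    have "loop_form A lam p q = 0" for q using z[of "(q, 0, 0)"] by simp
    then have "p = 0" by (rule loop_nondegenerate(1)[OF nd])
    moreover have "dapp e v = 0" "dapp d w = 0" for e w
      using z[of "(0, 0, e)"] z[of "(0, w, 0)"] by simp_all
    ultimately show ?thesis using zero[of v d] by (simp add: zero_prod_def)
  qed
  have right: "(q, w, e) = 0" if z: "\<And>x. form HA x (q, w, e) = 0" for q w e
  proof -
    have "loop_form A lam p q = 0" for p using z[of "(p, 0, 0)"] by simp
    then have "q = 0" by (rule loop_nondegenerate(2)[OF nd])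
    moreover have "dapp d w = 0" "dapp e v = 0" for d v
      using z[of "(0, 0, d)"] z[of "(0, v, 0)"] by simp_all
    ultimately show ?thesis using zero[of w e] by (simp add: zero_prod_def)
  qed
  show ?thesis
    unfolding nondegenerate_on_def using left right
    by (metis (no_types, lifting) UNIV_I prod_cases3)
qed

lemma hat_H_nondegenerate:
  assumes nd: "nondegenerate_on A H"
  shows "nondegenerate_on HA (hat_H H)"
proof -
  have zero: "v = 0" "d = 0" if "\<And>e. dapp e v = 0" "\<And>w. dapp d w = 0"
    for v :: "('g, 'f) gtensor" and d :: "('g, 'f) gdual"
    using that gdual_separates by (blast, intro gdual_eqI) simp
  have left: "(p, v, d) = 0"
    if p: "p \<in> loop_H H" and z: "\<And>y. y \<in> hat_H H \<Longrightarrow> form HA (p, v, d) y = 0" for p v d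
  proof -
    obtain h where h: "h \<in> H" "p = pure 0 h" using p by (rule loop_H_cases)
    have "form A h h' = 0" if "h' \<in> H" for h' using z[of "(pure 0 h', 0, 0)"] that h by simp
    then have "p = 0" using nd h by (simp add: nondegenerate_on_def)
    moreover have "dapp e v = 0" "dapp d w = 0" for e w
      using z[of "(0, 0, e)"] z[of "(0, w, 0)"] by simp_all
    ultimately show ?thesis using zero[of v d] by (simp add: zero_prod_def)
  qed
  have right: "(q, w, e) = 0"
    if q: "q \<in> loop_H H" and z: "\<And>x. x \<in> hat_H H \<Longrightarrow> form HA x (q, w, e) = 0" for q w e
  proof -
    obtain h where h: "h \<in> H" "q = pure 0 h" using q by (rule loop_H_cases)
    have "form A h' h = 0" if "h' \<in> H" for h' using z[of "(pure 0 h', 0, 0)"] that h by simp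
    then have "q = 0" using nd h by (simp add: nondegenerate_on_def)
    moreover have "dapp d w = 0" "dapp e v = 0" for d v
      using z[of "(0, 0, d)"] z[of "(0, v, 0)"] by simp_all
    ultimately show ?thesis using zero[of w e] by (simp add: zero_prod_def)
  qed
  show ?thesis
    unfolding nondegenerate_on_def
  proof (intro conjI ballI impI)
    fix x assume "x \<in> hat_H H" "\<forall>y\<in>hat_H H. form HA x y = 0"
    then show "x = 0"
      using left[of "fst x" "fst (snd x)" "snd (snd x)"] by (cases x) auto
  next
    fix y assume "y \<in> hat_H H" "\<forall>x\<in>hat_H H. form HA x y = 0"
    then show "y = 0"
      using right[of "fst y" "fst (snd y)" "snd (snd y)"] by (cases y) auto
  qed
qed

end

section \<open>Evaluation of loops at characters\<close>

text \<open>A finite range forces some value on infinitely many arguments; a Laurent polynomial that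
  does this is constant, and the constant is its constant term 1.\<close>

lemma laurent_finite_range_attains_1:
  fixes a :: "'i \<Rightarrow> 'f::field_char_0" and k :: "'i \<Rightarrow> int"
  assumes "finite I" and const: "(\<Sum>i\<in>{i\<in>I. k i = 0}. a i) = 1"
    and fin: "finite ((\<lambda>s. \<Sum>i\<in>I. a i * s powi k i) ` (UNIV - {0}))"
  shows "\<exists>s. s \<noteq> 0 \<and> (\<Sum>i\<in>I. a i * s powi k i) = 1"
proof -
  define f where "f s = (\<Sum>i\<in>I. a i * s powi k i)" for s
  have "infinite (UNIV - {0 :: 'f})" using infinite_UNIV_char_0 by simp
  then obtain s0 where s0: "s0 \<in> UNIV - {0}" "infinite {s \<in> UNIV - {0}. f s = f s0}"
    using pigeonhole_infinite[of "UNIV - {0}" f] fin by (auto simp: f_def)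
  obtain N where N: "\<And>i. i \<in> I \<Longrightarrow> 0 \<le> k i + int N"
  proof
    fix i assume "i \<in> I"
    then have "nat \<bar>k i\<bar> \<le> (\<Sum>i\<in>I. nat \<bar>k i\<bar>)"
      using \<open>finite I\<close> by (intro member_le_sum) auto
    then show "0 \<le> k i + int (\<Sum>i\<in>I. nat \<bar>k i\<bar>)" by linarith
  qed
  \<comment> \<open>The factor \<open>s^N\<close> clears negative exponents. The coefficient at
    \<open>N\<close> is then the constant term of \<open>f\<close> minus
    \<open>f s0\<close>.\<close>
  define P where "P = (\<Sum>i\<in>I. monom (a i) (nat (k i + int N))) - monom (f s0) N"
  have eval: "poly P s = s ^ N * (f s - f s0)" if "s \<noteq> 0" for s
  proof -
    have "a i * s ^ nat (k i + int N) = s ^ N * (a i * s powi k i)" if "i \<in> I" for i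
    proof -
      have "s ^ nat (k i + int N) = s powi (k i + int N)"
        using N[OF that] by (simp add: power_int_def)
      also have "\<dots> = s powi k i * s ^ N" using \<open>s \<noteq> 0\<close> by (simp add: power_int_add)
      finally show ?thesis by (simp add: mult_ac)
    qed
    then have "(\<Sum>i\<in>I. a i * s ^ nat (k i + int N)) = (\<Sum>i\<in>I. s ^ N * (a i * s powi k i))"
      by (rule sum.cong[OF refl])
    then show ?thesis
      by (simp add: P_def poly_sum poly_monom f_def sum_distrib_left
          right_diff_distrib mult.commute)
  qed
  have "infinite {s. poly P s = 0}"
    using s0(2) by (rule contrapos_nn) (auto elim!: finite_subset[rotated] simp: eval)
  then have "P = 0" using poly_roots_finite by blast
  then have "coeff P N = 0" by simp
  moreover have "coeff P N = (\<Sum>i\<in>I. if k i = 0 then a i else 0) - f s0"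
  proof -
    have "nat (k i + int N) = N \<longleftrightarrow> k i = 0" if "i \<in> I" for i using N[OF that] by auto
    then show ?thesis by (simp add: P_def coeff_sum cong: sum.cong)
  qed
  moreover have "(\<Sum>i\<in>I. if k i = 0 then a i else 0) = 1"
    using const \<open>finite I\<close> by (simp add: sum.inter_filter)
  ultimately have "f s0 = 1" by simp
  then show ?thesis using s0(1) by (auto simp: f_def)
qed

definition coroot_values :: "('f::field, 'b, 'a::ab_group_add) qalg \<Rightarrow> 'a set \<Rightarrow> 'f set" where
  "coroot_values A H = {\<beta> (mul A x y) | \<alpha> \<beta> x y.
        \<alpha> \<in> roots A H \<and> \<beta> \<in> roots A H \<and>
        x \<in> root_space A H \<alpha> \<inter> (\<Union>b. grade A b) \<and>
        y \<in> root_space A H (\<lambda>h. - \<alpha> h) \<inter> (\<Union>b. grade A b) \<and>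
        mul A x y \<in> H \<and> form A x y = 1}"

context loop_construction
begin

text \<open>The bound depends on \<open>A\<close> alone, not on \<open>p\<close> and
  \<open>q\<close>, so (E2) passes to each extension by inclusion in a finite set. The inserted 0
  covers \<open>\<beta> T = 0\<close>, where the quotients by \<open>f s\<close> say nothing about
  the range of \<open>f\<close>.\<close>

lemma coroot_values_loop:
  assumes tf: "\<forall>n (\<sigma>::'g). 0 < n \<and> nmult n \<sigma> = 0 \<longrightarrow> \<sigma> = 0"
    and fin: "finite (coroot_values A H)"
    and \<alpha>: "\<alpha> \<in> roots A H" and \<beta>: "\<beta> \<in> roots A H"
    and p: "p \<in> components_in (root_space A H \<alpha>)" "p \<in> loop_grade A b"
    and q: "q \<in> components_in (root_space A H (\<lambda>h. - \<alpha> h))" "q \<in> loop_grade A c"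
    and T: "loop_mul A lam p q = pure 0 T" "T \<in> H" and form: "loop_form A lam p q = 1"
  shows "\<beta> T \<in> insert 0 (coroot_values A H)"
proof -
  let ?P = "Poly_Mapping.keys p" and ?Q = "Poly_Mapping.keys q"
  obtain B where B: "finite B" "zmod.independent B" "?P \<union> ?Q \<subseteq> zmod.span B"
    using torsion_free_finite_independent[OF tf, of "?P \<union> ?Q"] by auto
  obtain \<chi> where "trivializes \<chi> (zmod.span B)" using trivialization_on_span[OF B(1,2)] by blast
  then have \<chi>: "\<chi> 0 = 1" "\<And>\<sigma> \<tau>. \<sigma> \<in> zmod.span B \<Longrightarrow> \<tau> \<in> zmod.span B \<Longrightarrow> \<chi> \<sigma> * \<chi> \<tau> = lam \<sigma> \<tau> * \<chi> (\<sigma> + \<tau>)"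
    by (auto simp: trivializes_def)
  \<comment> \<open>The functional must not vanish on nonzero degrees of products of components;
    then only pairs of opposite degree contribute to the constant term of the form.\<close>
  define Y where "Y = (\<lambda>(\<sigma>, \<tau>). \<sigma> + \<tau>) ` (?P \<times> ?Q) - {0}"
  have "finite Y" "Y \<subseteq> zmod.span B - {0}"
    using B(3) by (auto simp: Y_def intro!: zmod.span_add)
  then obtain \<phi> :: "'g \<Rightarrow> int" where
    \<phi>: "\<And>x y. x \<in> zmod.span B \<Longrightarrow> y \<in> zmod.span B \<Longrightarrow> \<phi> (x + y) = \<phi> x + \<phi> y"
      "\<And>y. y \<in> Y \<Longrightarrow> \<phi> y \<noteq> 0"
    using generic_additive_functional[OF B(2)] by blast
  have \<phi>0: "\<phi> 0 = 0" using \<phi>(1)[of 0 0] zmod.span_zero[of B] by simp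
  have \<phi>_eq_0: "\<phi> (\<sigma> + \<tau>) = 0 \<longleftrightarrow> \<sigma> + \<tau> = 0" if "\<sigma> \<in> ?P" "\<tau> \<in> ?Q" for \<sigma> \<tau>
    using \<phi>(2)[of "\<sigma> + \<tau>"] \<phi>0 that by (force simp: Y_def)
  \<comment> \<open>Specialization of \<open>t^\<sigma>\<close> at
    \<open>\<chi> \<sigma> * s powi \<phi> \<sigma>\<close>, with coefficients kept in
    \<open>A\<close>. Being linear in the coefficients, it preserves degrees and root
    spaces.\<close>
  define ev where "ev s r = (\<Sum>\<sigma>\<in>Poly_Mapping.keys r. smul A (\<chi> \<sigma> * s powi \<phi> \<sigma>) (coef r \<sigma>))" for s r
  have ev_superset: "ev s r = (\<Sum>\<sigma>\<in>S. smul A (\<chi> \<sigma> * s powi \<phi> \<sigma>) (coef r \<sigma>))"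
    if "finite S" "Poly_Mapping.keys r \<subseteq> S" for s r S
    unfolding ev_def using that by (intro sum.mono_neutral_left) (auto simp: in_keys_iff)
  have ev_add: "ev s (r + r') = ev s r + ev s r'" for s r r'
    using Poly_Mapping.keys_add[of r r']
    by (simp add: ev_superset[of "Poly_Mapping.keys r \<union> Poly_Mapping.keys r'"] lookup_add
        scale_right_distrib sum.distrib)
  have ev_0: "ev s 0 = 0" for s by (simp add: ev_def)
  have ev_sum: "ev s (\<Sum>i\<in>S. r i) = (\<Sum>i\<in>S. ev s (r i))" for s S and r :: "'g \<Rightarrow> _"
    by (induction S rule: infinite_finite_induct) (simp_all add: ev_add ev_0)
  have ev_pure: "ev s (pure \<rho> x) = smul A (\<chi> \<rho> * s powi \<phi> \<rho>) x" for s \<rho> x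
    by (simp add: ev_superset[of "{\<rho>}"])
  have weight: "(\<chi> \<sigma> * s powi \<phi> \<sigma>) * (\<chi> \<tau> * s powi \<phi> \<tau>) =
      \<chi> (\<sigma> + \<tau>) * s powi \<phi> (\<sigma> + \<tau>) * lam \<sigma> \<tau>"
    if "\<sigma> \<in> ?P" "\<tau> \<in> ?Q" "s \<noteq> 0" for \<sigma> \<tau> s
  proof -
    have mem: "\<sigma> \<in> zmod.span B" "\<tau> \<in> zmod.span B" using B(3) that by auto
    have powi: "s powi \<phi> (\<sigma> + \<tau>) = s powi \<phi> \<sigma> * s powi \<phi> \<tau>"
      using \<phi>(1)[OF mem] \<open>s \<noteq> 0\<close> by (simp add: power_int_add)
    have "(\<chi> \<sigma> * s powi \<phi> \<sigma>) * (\<chi> \<tau> * s powi \<phi> \<tau>) =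
        (\<chi> \<sigma> * \<chi> \<tau>) * (s powi \<phi> \<sigma> * s powi \<phi> \<tau>)" by (simp only: mult_ac)
    then show ?thesis unfolding powi \<chi>(2)[OF mem] by (simp only: mult_ac)
  qed
  have ev_mul: "mul A (ev s p) (ev s q) = T" if s: "s \<noteq> 0" for s
  proof -
    have "mul A (ev s p) (ev s q) = (\<Sum>\<sigma>\<in>?P. \<Sum>\<tau>\<in>?Q.
        smul A ((\<chi> \<sigma> * s powi \<phi> \<sigma>) * (\<chi> \<tau> * s powi \<phi> \<tau>)) (mul A (coef p \<sigma>) (coef q \<tau>)))"
      unfolding ev_def mul_sum_left unfolding mul_sum_right by (simp add: mult_ac)
    also have "\<dots> = (\<Sum>\<sigma>\<in>?P. \<Sum>\<tau>\<in>?Q.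
        ev s (pure (\<sigma> + \<tau>) (smul A (lam \<sigma> \<tau>) (mul A (coef p \<sigma>) (coef q \<tau>)))))"
      by (intro sum.cong refl) (simp only: weight[OF _ _ s] ev_pure scale_scale)
    also have "\<dots> = ev s (loop_mul A lam p q)"
      by (simp add: loop_mul_def ev_sum)
    \<comment> \<open>The product is concentrated at \<open>t^0\<close>, which specializes to 1 for
      every \<open>s\<close>.\<close>
    also have "\<dots> = T" by (simp add: T ev_pure \<chi>(1) \<phi>0)
    finally show ?thesis .
  qed
  \<comment> \<open>Coefficients and exponents of the form of the two specializations. Exponent 0
    means \<sigma> = -\<tau> by the choice of \<open>\<phi>\<close>; there
    \<open>\<chi> 0 = 1\<close>, so \<open>a\<close> is the term of the loop form and the constant
    term is 1.\<close>
  define a where "a = (\<lambda>(\<sigma>, \<tau>). \<chi> (\<sigma> + \<tau>) * lam \<sigma> \<tau> * form A (coef p \<sigma>) (coef q \<tau>))"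
  define k where "k = (\<lambda>(\<sigma>, \<tau>). \<phi> (\<sigma> + \<tau>))"
  define f where "f s = (\<Sum>i\<in>?P \<times> ?Q. a i * s powi k i)" for s
  have ev_form: "form A (ev s p) (ev s q) = f s" if s: "s \<noteq> 0" for s
  proof -
    have "form A (ev s p) (ev s q) = (\<Sum>\<sigma>\<in>?P. \<Sum>\<tau>\<in>?Q.
        ((\<chi> \<sigma> * s powi \<phi> \<sigma>) * (\<chi> \<tau> * s powi \<phi> \<tau>)) * form A (coef p \<sigma>) (coef q \<tau>))"
      unfolding ev_def form_sum_left unfolding form_sum_right by (simp add: mult_ac)
    also have "\<dots> = (\<Sum>\<sigma>\<in>?P. \<Sum>\<tau>\<in>?Q. a (\<sigma>, \<tau>) * s powi k (\<sigma>, \<tau>))"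
    proof (intro sum.cong refl)
      fix \<sigma> \<tau> assume "\<sigma> \<in> ?P" "\<tau> \<in> ?Q"
      then show "((\<chi> \<sigma> * s powi \<phi> \<sigma>) * (\<chi> \<tau> * s powi \<phi> \<tau>)) * form A (coef p \<sigma>) (coef q \<tau>) =
          a (\<sigma>, \<tau>) * s powi k (\<sigma>, \<tau>)"
        by (simp only: weight[OF _ _ s]) (simp add: a_def k_def)
    qed
    also have "\<dots> = f s" by (simp add: f_def sum.cartesian_product)
    finally show ?thesis .
  qed
  have "(\<Sum>i\<in>{i\<in>?P \<times> ?Q. k i = 0}. a i) = (\<Sum>i\<in>?P \<times> ?Q. if k i = 0 then a i else 0)"
    by (simp add: sum.inter_filter)
  also have "\<dots> = (\<Sum>\<sigma>\<in>?P. \<Sum>\<tau>\<in>?Q. if k (\<sigma>, \<tau>) = 0 then a (\<sigma>, \<tau>) else 0)"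
    by (simp add: sum.cartesian_product)
  also have "\<dots> = loop_form A lam p q"
    unfolding loop_form_def
  proof (intro sum.cong refl)
    fix \<sigma> \<tau> assume \<sigma>\<tau>: "\<sigma> \<in> ?P" "\<tau> \<in> ?Q"
    show "(if k (\<sigma>, \<tau>) = 0 then a (\<sigma>, \<tau>) else 0) =
        (if \<sigma> = - \<tau> then form A (coef p \<sigma>) (coef q \<tau>) * lam \<sigma> \<tau> else 0)"
      using \<phi>_eq_0[OF \<sigma>\<tau>] by (auto simp: k_def a_def \<chi>(1) eq_neg_iff_add_eq_0)
  qed
  finally have const: "(\<Sum>i\<in>{i\<in>?P \<times> ?Q. k i = 0}. a i) = 1" using form by simp
  have comp: "ev s p \<in> root_space A H \<alpha> \<inter> grade A b"
      "ev s q \<in> root_space A H (\<lambda>h. - \<alpha> h) \<inter> grade A c" for s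
    using p q unfolding ev_def components_in_def loop_grade_def
    by (auto intro!: subspace_sum subspace_scale subspace_root_space subspace_grade)
  have val: "\<beta> T / f s \<in> coroot_values A H" if s: "s \<noteq> 0" "f s \<noteq> 0" for s
  proof -
    \<comment> \<open>Scaling one factor normalizes the form to 1 and divides the product by
      \<open>f s\<close>, which keeps it in \<open>H\<close>.\<close>
    define x where "x = smul A (1 / f s) (ev s p)"
    have x: "x \<in> root_space A H \<alpha>" "x \<in> grade A b"
      using comp(1) by (auto simp: x_def intro!: subspace_scale subspace_root_space subspace_grade)
    have xy: "mul A x (ev s q) = smul A (1 / f s) T" "form A x (ev s q) = 1"
      using s by (simp_all add: x_def ev_mul ev_form)
    have "\<beta> (mul A x (ev s q)) = \<beta> T / f s"
      using \<beta> T(2) by (simp add: xy roots_def dualD(2))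
    moreover have "mul A x (ev s q) \<in> H" using T(2) subspace_scale[OF subspace_H] by (simp add: xy)
    ultimately show ?thesis
      unfolding coroot_values_def using \<alpha> \<beta> x comp(2)[of s] xy(2)
      by (intro CollectI exI[of _ \<alpha>] exI[of _ \<beta>] exI[of _ x] exI[of _ "ev s q"]) auto
  qed
  show ?thesis
  proof (cases "\<beta> T = 0")
    case False
    \<comment> \<open>A nonzero \<open>f s\<close> is recovered from the corresponding value for
      \<open>A\<close> as its quotient into \<open>\<beta> T\<close>, so finitely many values leave
      finitely many \<open>f s\<close>.\<close>
    have "f ` (UNIV - {0}) \<subseteq> insert 0 ((\<lambda>z. \<beta> T / z) ` coroot_values A H)"
    proof
      fix y assume "y \<in> f ` (UNIV - {0})"
      then obtain s where "s \<noteq> 0" "y = f s" by auto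
      then show "y \<in> insert 0 ((\<lambda>z. \<beta> T / z) ` coroot_values A H)"
        using val[of s] False by (cases "f s = 0") (auto intro!: image_eqI[of _ _ "\<beta> T / f s"])
    qed
    then have "finite (f ` (UNIV - {0}))" using fin by (auto intro: finite_subset)
    then obtain s where "s \<noteq> 0" "f s = 1"
      using laurent_finite_range_attains_1[OF _ const] unfolding f_def by auto
    then show ?thesis using val[of s] by simp
  qed simp
qed

end

section \<open>Extended algebras\<close>

lemma extended_algebra_iff:
  "extended_algebra A H \<longleftrightarrow> quadratic_toral_pair A H \<and>
     (\<forall>b. \<forall>\<alpha> \<in> roots_of_degree A H b - {\<lambda>_. 0}.
        \<exists>x \<in> root_space A H \<alpha> \<inter> grade A b.
        \<exists>y \<in> root_space A H (\<lambda>h. - \<alpha> h) \<inter> grade A (- b).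
          mul A x y \<noteq> 0 \<and> mul A x y \<in> H) \<and>
     finite (coroot_values A H)"
  by (simp add: extended_algebra_def coroot_values_def)

lemma coroot_valuesE:
  assumes "z \<in> coroot_values A H"
  obtains \<alpha> \<beta> x y b c where "z = \<beta> (mul A x y)" "\<alpha> \<in> roots A H" "\<beta> \<in> roots A H"
    "x \<in> root_space A H \<alpha>" "x \<in> grade A b" "y \<in> root_space A H (\<lambda>h. - \<alpha> h)" "y \<in> grade A c"
    "mul A x y \<in> H" "form A x y = 1"
  using assms unfolding coroot_values_def by blast

context loop_construction
begin

lemma component_root_of_degree:
  assumes "\<alpha> \<in> roots A H" "p \<in> components_in (root_space A H \<alpha>)" "p \<in> loop_grade A b" "p \<noteq> 0"
  shows "\<alpha> \<in> roots_of_degree A H b"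
proof -
  obtain \<sigma> where "coef p \<sigma> \<noteq> 0" using assms(4) poly_mapping_nonzeroE by blast
  then show ?thesis using assms(1-3)
    by (auto simp: roots_of_degree_def components_in_def loop_grade_def)
qed

lemma extended_algebra_partner:
  assumes "extended_algebra A H" "\<alpha> \<in> roots_of_degree A H b" "\<alpha> \<noteq> (\<lambda>_. 0)"
  obtains x y where "x \<in> root_space A H \<alpha>" "x \<in> grade A b"
    "y \<in> root_space A H (\<lambda>h. - \<alpha> h)" "y \<in> grade A (- b)" "mul A x y \<noteq> 0" "mul A x y \<in> H"
  using assms unfolding extended_algebra_def by blast

text \<open>For (E1) the partners from \<open>A\<close> are placed at \<open>t^0\<close>, where the
  cocycle is 1 and the product stays in \<open>H \<otimes> 1\<close>; (E2) is the specialization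
  argument.\<close>

lemma extended_loop:
  assumes tf: "\<forall>n (\<sigma>::'g). 0 < n \<and> nmult n \<sigma> = 0 \<longrightarrow> \<sigma> = 0"
    and ext: "extended_algebra A H"
  shows "extended_algebra LA (loop_H H)"
  unfolding extended_algebra_iff
proof (intro conjI allI ballI)
  fix b \<beta> assume "\<beta> \<in> roots_of_degree LA (loop_H H) b - {\<lambda>_. 0}"
  then have \<beta>: "\<beta> \<in> roots LA (loop_H H)" "root_space LA (loop_H H) \<beta> \<inter> loop_grade A b \<noteq> {0}"
      "\<beta> \<noteq> (\<lambda>_. 0)" by (auto simp: roots_of_degree_def)
  then obtain \<alpha> where \<alpha>: "\<alpha> \<in> roots A H" "\<beta> = loop_root \<alpha>" unfolding loop_roots by blast
  have "0 \<in> root_space LA (loop_H H) \<beta> \<inter> loop_grade A b"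
    using LA.subspace_0[OF LA.subspace_root_space] L.subspace_0[OF subspace_loop_grade] by blast
  with \<beta>(2) obtain p where p: "p \<in> root_space LA (loop_H H) \<beta>" "p \<in> loop_grade A b" "p \<noteq> 0"
    by blast
  have "\<alpha> \<in> roots_of_degree A H b"
    using component_root_of_degree[OF \<alpha>(1) _ p(2,3)] p(1) by (simp add: \<alpha>(2) loop_root_space)
  moreover have "\<alpha> \<noteq> (\<lambda>_. 0)" using \<alpha>(2) \<beta>(3) loop_root_zero by auto
  ultimately obtain x y where "x \<in> root_space A H \<alpha>" "x \<in> grade A b"
    "y \<in> root_space A H (\<lambda>h. - \<alpha> h)" "y \<in> grade A (- b)" "mul A x y \<noteq> 0" "mul A x y \<in> H"
    using extended_algebra_partner[OF ext] by blast
  then show "\<exists>x \<in> root_space LA (loop_H H) \<beta> \<inter> grade LA b.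
      \<exists>y \<in> root_space LA (loop_H H) (\<lambda>h. - \<beta> h) \<inter> grade LA (- b).
        mul LA x y \<noteq> 0 \<and> mul LA x y \<in> loop_H H"
    by (intro bexI[of _ "pure 0 x"] bexI[of _ "pure 0 y"])
      (simp_all add: \<alpha>(2) loop_root_neg loop_root_space components_in_pure subspace_root_space
        loop_grade_pure)
next
  have "coroot_values LA (loop_H H) \<subseteq> insert 0 (coroot_values A H)"
  proof
    fix z assume "z \<in> coroot_values LA (loop_H H)"
    then obtain \<alpha>' \<beta>' p q b c where z: "z = \<beta>' (mul LA p q)" "\<alpha>' \<in> roots LA (loop_H H)"
        "\<beta>' \<in> roots LA (loop_H H)" "p \<in> root_space LA (loop_H H) \<alpha>'" "p \<in> grade LA b"
        "q \<in> root_space LA (loop_H H) (\<lambda>h. - \<alpha>' h)" "q \<in> grade LA c"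
        "mul LA p q \<in> loop_H H" "form LA p q = 1"
      by (rule coroot_valuesE)
    obtain \<alpha> \<beta> where \<alpha>\<beta>: "\<alpha> \<in> roots A H" "\<alpha>' = loop_root \<alpha>" "\<beta> \<in> roots A H" "\<beta>' = loop_root \<beta>"
      using z(2,3) unfolding loop_roots by blast
    obtain T where T: "T \<in> H" "mul LA p q = pure 0 T" using z(8) by (rule loop_H_cases)
    have "z = \<beta> T" by (simp only: z(1) T(2) \<alpha>\<beta>(4)) (simp add: loop_root_def T(1))
    moreover have "\<beta> T \<in> insert 0 (coroot_values A H)"
      using coroot_values_loop[OF tf _ \<alpha>\<beta>(1,3), of p b q c T] z(4-7,9) T ext
      unfolding \<alpha>\<beta>(2) loop_root_neg loop_root_space extended_algebra_iff by simp
    ultimately show "z \<in> insert 0 (coroot_values A H)" by simp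
  qed
  then show "finite (coroot_values LA (loop_H H))"
    using ext by (auto simp: extended_algebra_iff intro: finite_subset)
qed (rule quadratic_loop)

lemma loop_nondegenerate_on:
  "nondegenerate_on A UNIV \<Longrightarrow> nondegenerate_on LA UNIV"
  "nondegenerate_on A H \<Longrightarrow> nondegenerate_on LA (loop_H H)"
proof -
  assume "nondegenerate_on A UNIV"
  then show "nondegenerate_on LA UNIV"
    using loop_nondegenerate unfolding nondegenerate_on_def by simp
next
  assume "nondegenerate_on A H"
  then show "nondegenerate_on LA (loop_H H)"
    by (auto simp: nondegenerate_on_def ball_loop_H)
qed

text \<open>The extended roots and the form ignore \<open>V\<close>, so central components affect
  neither the values in (E2) nor their normalization; for (E1), a nonzero root has no root vectors
  with a central component.\<close>

lemma extended_tilde: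
  assumes tf: "\<forall>n (\<sigma>::'g). 0 < n \<and> nmult n \<sigma> = 0 \<longrightarrow> \<sigma> = 0"
    and ext: "extended_algebra A H"
  shows "extended_algebra TA (tilde_H H)"
  unfolding extended_algebra_iff
proof (intro conjI allI ballI)
  fix b \<beta> assume "\<beta> \<in> roots_of_degree TA (tilde_H H) b - {\<lambda>_. 0}"
  then have \<beta>: "\<beta> \<in> roots TA (tilde_H H)" "root_space TA (tilde_H H) \<beta> \<inter> grade TA b \<noteq> {0}"
      "\<beta> \<noteq> (\<lambda>_. 0)" by (auto simp: roots_of_degree_def)
  then obtain \<alpha> where \<alpha>: "\<alpha> \<in> roots A H" "\<beta> = tilde_root H \<alpha>" unfolding tilde_roots by blast
  have "\<alpha> \<noteq> (\<lambda>_. 0)" using \<alpha>(2) \<beta>(3) by (metis tilde_root_zero)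
  have "0 \<in> root_space TA (tilde_H H) \<beta>" "0 \<in> grade TA b"
    using TA.subspace_0[OF TA.subspace_root_space] L.subspace_0[OF subspace_loop_grade]
    by (simp_all add: zero_prod_def)
  with \<beta>(2) obtain r where "r \<in> root_space TA (tilde_H H) \<beta>" "r \<in> grade TA b" "r \<noteq> 0"
    by blast
  then obtain p v where pv: "(p, v) \<in> root_space TA (tilde_H H) \<beta>" "(p, v) \<in> grade TA b"
      "(p, v) \<noteq> 0"
    by (cases r) blast
  have "\<exists>h\<in>H. \<alpha> h \<noteq> 0"
    using \<open>\<alpha> \<noteq> (\<lambda>_. 0)\<close> dual_eqI \<alpha>(1) by (auto simp: roots_def)
  then have "v = 0" "p \<in> components_in (root_space A H \<alpha>)"
    using pv(1) by (auto simp: \<alpha>(2) tilde_root_space)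
  then have "\<alpha> \<in> roots_of_degree A H b"
    using component_root_of_degree[OF \<alpha>(1)] pv(2,3) by (simp add: zero_prod_def)
  then obtain x y where "x \<in> root_space A H \<alpha>" "x \<in> grade A b"
    "y \<in> root_space A H (\<lambda>h. - \<alpha> h)" "y \<in> grade A (- b)" "mul A x y \<noteq> 0" "mul A x y \<in> H"
    using extended_algebra_partner[OF ext _ \<open>\<alpha> \<noteq> (\<lambda>_. 0)\<close>] by blast
  then show "\<exists>x \<in> root_space TA (tilde_H H) \<beta> \<inter> grade TA b.
      \<exists>y \<in> root_space TA (tilde_H H) (\<lambda>h. - \<beta> h) \<inter> grade TA (- b).
        mul TA x y \<noteq> 0 \<and> mul TA x y \<in> tilde_H H"
    by (intro bexI[of _ "(pure 0 x, 0)"] bexI[of _ "(pure 0 y, 0)"])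
      (simp_all add: \<alpha>(2) tilde_root_neg tilde_root_space components_in_pure subspace_root_space
        loop_grade_pure zero_prod_def)
next
  have "coroot_values TA (tilde_H H) \<subseteq> insert 0 (coroot_values A H)"
  proof
    fix z assume "z \<in> coroot_values TA (tilde_H H)"
    then obtain \<alpha>' \<beta>' x y b c where z: "z = \<beta>' (mul TA x y)" "\<alpha>' \<in> roots TA (tilde_H H)"
        "\<beta>' \<in> roots TA (tilde_H H)" "x \<in> root_space TA (tilde_H H) \<alpha>'" "x \<in> grade TA b"
        "y \<in> root_space TA (tilde_H H) (\<lambda>h. - \<alpha>' h)" "y \<in> grade TA c"
        "mul TA x y \<in> tilde_H H" "form TA x y = 1"
      by (rule coroot_valuesE)
    obtain p v q w where xy: "x = (p, v)" "y = (q, w)" by (cases x; cases y)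
    obtain \<alpha> \<beta> where \<alpha>\<beta>: "\<alpha> \<in> roots A H" "\<alpha>' = tilde_root H \<alpha>" "\<beta> \<in> roots A H" "\<beta>' = tilde_root H \<beta>"
      using z(2,3) unfolding tilde_roots by blast
    have "loop_mul A lam p q \<in> loop_H H" using z(8) by (simp add: xy)
    then obtain T where T: "T \<in> H" "loop_mul A lam p q = pure 0 T" by (rule loop_H_cases)
    have "z = \<beta> T" using z(1) T by (simp add: xy \<alpha>\<beta>(4))
    moreover have "\<beta> T \<in> insert 0 (coroot_values A H)"
      using coroot_values_loop[OF tf _ \<alpha>\<beta>(1,3), of p b q c T] z(4-7,9) T ext
      unfolding xy \<alpha>\<beta>(2) tilde_root_neg tilde_root_space extended_algebra_iff by simp
    ultimately show "z \<in> insert 0 (coroot_values A H)" by simp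
  qed
  then show "finite (coroot_values TA (tilde_H H))"
    using ext by (auto simp: extended_algebra_iff intro: finite_subset)
qed (rule quadratic_tilde)

text \<open>Partners are placed at \<open>t^\<sigma>\<close> and at the opposite degree. Their
  product may then acquire a central term, which is harmless for nonzero \<alpha> and is what makes
  the product nonzero when \<alpha> = 0.\<close>

lemma extended_hat:
  assumes tf: "\<forall>n (\<sigma>::'g). 0 < n \<and> nmult n \<sigma> = 0 \<longrightarrow> \<sigma> = 0"
    and ext: "extended_algebra A H"
    and H: "root_space A H (\<lambda>_. 0) \<inter> grade A 0 = H"
    and nd: "nondegenerate_on A (root_space A H (\<lambda>_. 0))"
  shows "extended_algebra HA (hat_H H)"
  unfolding extended_algebra_iff
proof (intro conjI allI ballI)
  fix b \<beta> assume "\<beta> \<in> roots_of_degree HA (hat_H H) b - {\<lambda>_. 0}"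
  then have \<beta>: "\<beta> \<in> roots HA (hat_H H)" "root_space HA (hat_H H) \<beta> \<inter> grade HA b \<noteq> {0}"
      "\<beta> \<noteq> (\<lambda>_. 0)" by (auto simp: roots_of_degree_def)
  then obtain \<alpha> \<sigma> where \<alpha>: "\<alpha> \<in> roots A H" "\<beta> = hat_root H \<alpha> \<sigma>" unfolding hat_roots by blast
  then have dual: "\<alpha> \<in> dual_of A H" by (simp add: roots_def)
  have nonzero: "(\<exists>h\<in>H. \<alpha> h \<noteq> 0) \<or> (\<exists>e :: ('g, 'f) gdual. dapp e (gembed \<sigma>) \<noteq> 0)"
  proof (rule ccontr)
    assume "\<not> ?thesis"
    then have "\<beta> = (\<lambda>_. 0)"
      by (auto simp: \<alpha>(2) hat_root_def fun_eq_iff elim!: loop_H_cases)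
    then show False using \<beta>(3) by simp
  qed
  have "0 \<in> root_space HA (hat_H H) \<beta>" "0 \<in> grade HA b"
    using HA.subspace_0[OF HA.subspace_root_space] L.subspace_0[OF subspace_loop_grade]
    by (simp_all add: zero_prod_def)
  with \<beta>(2) obtain r where "r \<in> root_space HA (hat_H H) \<beta>" "r \<in> grade HA b" "r \<noteq> 0"
    by blast
  then obtain p v d where pv: "(p, v, d) \<in> root_space HA (hat_H H) \<beta>" "(p, v, d) \<in> grade HA b"
      "(p, v, d) \<noteq> 0"
    by (cases r) blast
  have p: "v = 0" "d = 0" "p \<in> components_in (root_space A H \<alpha>)" "p \<in> loop_grade A b"
    using pv(1,2) nonzero by (auto simp: \<alpha>(2) hat_root_space)
  then have "p \<noteq> 0" using pv(3) by (simp add: zero_prod_def)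
  have "\<exists>x y. x \<in> root_space A H \<alpha> \<and> x \<in> grade A b \<and> y \<in> root_space A H (\<lambda>h. - \<alpha> h) \<and>
      y \<in> grade A (- b) \<and> mul A x y \<in> H \<and>
      (mul A x y \<noteq> 0 \<or> form A x y \<noteq> 0 \<and> gembed \<sigma> \<noteq> (0 :: ('g, 'f) gtensor))"
  proof (cases "\<alpha> = (\<lambda>_. 0)")
    case False
    have "\<alpha> \<in> roots_of_degree A H b"
      using component_root_of_degree[OF \<alpha>(1) p(3,4) \<open>p \<noteq> 0\<close>] .
    then show ?thesis using extended_algebra_partner[OF ext _ False] by metis
  next
    case True
    obtain \<tau> where "coef p \<tau> \<noteq> 0" using \<open>p \<noteq> 0\<close> poly_mapping_nonzeroE by blast
    define x where "x = coef p \<tau>"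
    have x: "x \<in> root_space A H (\<lambda>_. 0)" "x \<in> grade A b" "x \<noteq> 0"
      using p(3,4) \<open>coef p \<tau> \<noteq> 0\<close> True by (auto simp: x_def components_in_def loop_grade_def)
    then obtain y where y: "y \<in> root_space A H (\<lambda>_. 0)" "form A x y \<noteq> 0"
      using nd unfolding nondegenerate_on_def by blast
    obtain y' where y': "y' \<in> root_space A H (\<lambda>_. 0)" "y' \<in> grade A (- b)" "form A x y' \<noteq> 0"
      by (rule homogeneous_partner[OF x(2) y])
    \<comment> \<open>The product of two vectors in \<open>A^0\<close> of opposite degrees lies in
      \<open>A^0\<close> and has degree 0, and that space is \<open>H\<close>.\<close>
    have "mul A x y' \<in> H"
      using mul_root_space_0[OF x(1) y'(1)] mul_graded[OF x(2) y'(2)] H by auto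
    moreover have "gembed \<sigma> \<noteq> (0 :: ('g, 'f) gtensor)" using nonzero True by auto
    ultimately show ?thesis using True x y' by auto
  qed
  then obtain x y where "x \<in> root_space A H \<alpha>" "x \<in> grade A b" "y \<in> root_space A H (\<lambda>h. - \<alpha> h)"
      "y \<in> grade A (- b)" "mul A x y \<in> H"
      "mul A x y \<noteq> 0 \<or> form A x y \<noteq> 0 \<and> gembed \<sigma> \<noteq> (0 :: ('g, 'f) gtensor)"
    by blast
  then show "\<exists>x \<in> root_space HA (hat_H H) \<beta> \<inter> grade HA b.
      \<exists>y \<in> root_space HA (hat_H H) (\<lambda>h. - \<beta> h) \<inter> grade HA (- b).
        mul HA x y \<noteq> 0 \<and> mul HA x y \<in> hat_H H"
    using subspace_scale[OF subspace_H]
    by (intro bexI[of _ "(pure \<sigma> x, 0, 0)"] bexI[of _ "(pure (- \<sigma>) y, 0, 0)"])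
      (auto simp: \<alpha>(2) hat_root_neg hat_root_space components_in_pure subspace_root_space
        loop_grade_pure zero_prod_def)
next
  have "coroot_values HA (hat_H H) \<subseteq> insert 0 (coroot_values A H)"
  proof
    fix z assume "z \<in> coroot_values HA (hat_H H)"
    then obtain \<alpha>' \<beta>' x y b c where z: "z = \<beta>' (mul HA x y)" "\<alpha>' \<in> roots HA (hat_H H)"
        "\<beta>' \<in> roots HA (hat_H H)" "x \<in> root_space HA (hat_H H) \<alpha>'" "x \<in> grade HA b"
        "y \<in> root_space HA (hat_H H) (\<lambda>h. - \<alpha>' h)" "y \<in> grade HA c"
        "mul HA x y \<in> hat_H H" "form HA x y = 1"
      by (rule coroot_valuesE)
    obtain p v d q w e where xy: "x = (p, v, d)" "y = (q, w, e)" by (cases x; cases y)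
    obtain \<alpha> \<sigma> where \<alpha>: "\<alpha> \<in> roots A H" "\<alpha>' = hat_root H \<alpha> \<sigma>"
      using z(2) unfolding hat_roots by blast
    obtain \<beta> \<tau> where \<beta>: "\<beta> \<in> roots A H" "\<beta>' = hat_root H \<beta> \<tau>"
      using z(3) unfolding hat_roots by blast
    have p: "p \<in> components_in (root_space A H \<alpha>)" "p \<in> loop_grade A b"
        "degree_act A e p = lscale (dapp e (gembed \<sigma>)) p"
        "v = 0 \<and> d = 0 \<or> (\<forall>h\<in>H. \<alpha> h = 0) \<and> (\<forall>e :: ('g, 'f) gdual. dapp e (gembed \<sigma>) = 0)" for e
      using z(4,5) unfolding xy \<alpha>(2) hat_root_space by simp_all
    have q: "q \<in> components_in (root_space A H (\<lambda>h. - \<alpha> h))" "q \<in> loop_grade A c"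
        "degree_act A d q = lscale (- dapp d (gembed \<sigma>)) q"
        "w = 0 \<and> e = 0 \<or> (\<forall>h\<in>H. \<alpha> h = 0) \<and> (\<forall>e :: ('g, 'f) gdual. dapp e (gembed \<sigma>) = 0)"
      using z(6,7) unfolding xy \<alpha>(2) hat_root_neg hat_root_space
      by (simp_all add: gembed_minus dapp_minus)
    \<comment> \<open>Either the derivation part is 0, or \<sigma> acts as zero on all derivations;
      in both cases the two terms drop out of the product.\<close>
    have "degree_act A d q = 0" "degree_act A e p = 0" using p(3,4) q(3,4) by auto
    then have mul: "mul HA x y = (loop_mul A lam p q, loop_cocycle A lam p q, 0)"
      by (simp add: xy)
    then have "loop_mul A lam p q \<in> loop_H H" using z(8) by simp
    then obtain T where T: "T \<in> H" "loop_mul A lam p q = pure 0 T" by (rule loop_H_cases)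
    \<comment> \<open>A product has no derivation component, so the part \<tau> of the second root
      contributes nothing.\<close>
    have z_eq: "z = \<beta> T" using z(1) T by (simp add: mul \<beta>(2))
    show "z \<in> insert 0 (coroot_values A H)"
    proof (cases "\<alpha> = (\<lambda>_. 0)")
      case True
      have "T = 0"
      proof (rule nondegenerate_on_H[OF nd H T(1)])
        fix h assume h: "h \<in> H"
        have "form A h T = loop_form A lam (pure 0 h) (loop_mul A lam p q)" by (simp add: T(2))
        also have "\<dots> = loop_form A lam (loop_mul A lam (pure 0 h) p) q"
          by (rule loop_form_invariant[symmetric])
        also have "\<dots> = 0" using p(1) h by (simp add: components_in_root_space True)
        finally show "form A h T = 0" .
      qed
      then show ?thesis using \<beta>(1) by (simp add: z_eq roots_def dualD(4))
    next
      case False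
      then have "\<not> (\<forall>h\<in>H. \<alpha> h = 0)" using dual_eqI \<alpha>(1) by (auto simp: roots_def)
      \<comment> \<open>As \<alpha> is nonzero on \<open>H\<close>, both root vectors lie in the
        loop space and the form reduces to the loop form.\<close>
      then have "loop_form A lam p q = 1" using p(4) q(4) z(9) by (auto simp: xy)
      then show ?thesis
        using coroot_values_loop[OF tf _ \<alpha>(1) \<beta>(1) p(1,2) q(1,2) T(2,1)] ext
        by (simp add: z_eq extended_algebra_iff)
    qed
  qed
  then show "finite (coroot_values HA (hat_H H))"
    using ext by (auto simp: extended_algebra_iff intro: finite_subset)
qed (rule quadratic_hat)

end

theorem proposition1:
  fixes A :: "('f::field_char_0, 'b::{finite,idom}, 'a::ab_group_add) qalg"
    and H :: "'a set"
    and lam :: "'g::ab_group_add \<Rightarrow> 'g \<Rightarrow> 'f"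
  assumes "quadratic_toral_pair A H"
    and nontrivial: "\<exists>\<sigma>::'g. \<sigma> \<noteq> 0"
    and torsion_free: "\<forall>n (\<sigma>::'g). 0 < n \<and> nmult n \<sigma> = 0 \<longrightarrow> \<sigma> = 0"
    and "symmetric_cocycle lam"
    and "lam 0 0 = 1"
  shows
    \<comment> \<open>(i)\<close>
    "(quadratic_toral_pair (tilde_alg A lam) (tilde_H H) \<and>
      roots (tilde_alg A lam) (tilde_H H) = tilde_root H ` roots A H \<and>
      quadratic_toral_pair (hat_alg A lam) (hat_H H) \<and>
      roots (hat_alg A lam) (hat_H H) = {hat_root H \<alpha> \<sigma> | \<alpha> \<sigma>. \<alpha> \<in> roots A H} \<and>
      (nondegenerate_on A UNIV \<longrightarrow> nondegenerate_on (hat_alg A lam) UNIV) \<and>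
      (nondegenerate_on A H \<longrightarrow> nondegenerate_on (hat_alg A lam) (hat_H H)))
     \<and>
     (extended_algebra A H \<longrightarrow>
      \<comment> \<open>(ii)(a)\<close>
      (extended_algebra (tilde_alg A lam) (tilde_H H) \<and>
       (extended_affine_algebra A H \<longrightarrow> extended_affine_algebra (loop_alg A lam) (loop_H H)))
      \<and>
      \<comment> \<open>(ii)(b)\<close>
      (root_space A H (\<lambda>_. 0) \<inter> grade A 0 = H \<and> nondegenerate_on A (root_space A H (\<lambda>_. 0)) \<longrightarrow>
       extended_algebra (hat_alg A lam) (hat_H H) \<and>
       (extended_affine_algebra A H \<longrightarrow> extended_affine_algebra (hat_alg A lam) (hat_H H))))"
proof -
  interpret loop_construction A H lam
    using assms by unfold_locales
  show ?thesis
    using quadratic_tilde tilde_roots quadratic_hat hat_roots hat_nondegenerate hat_H_nondegenerate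
      extended_tilde[OF torsion_free] extended_loop[OF torsion_free] loop_nondegenerate_on
      extended_hat[OF torsion_free]
    unfolding extended_affine_algebra_def by (intro conjI impI) simp_all
qed

end
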